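(* Let $U$ be an associative $\mathsf{k}$-algebra and let $U\supset\Lambda\supset\Gamma$ be subalgebras such that $\Lambda$ and $\Gamma$ are quasicommutative and Noetherian, and $\Lambda$ is finitely generated both as a left and as a right $\Gamma$-module. Then $\Lambda$ is a Harish-Chandra subalgebra of $U$ if and only if $\Gamma$ is a Harish-Chandra subalgebra of $U$. Moreover (in this case) $\mathbb{H}(U,\Lambda)=\mathbb{H}(U,\Gamma)$. In particular, suppose $\Lambda$ is a (Noetherian) Harish-Chandra subalgebra of $U$ and let $W$ be any finite group of algebra automorphisms of $\Lambda$ whose order is invertible in $\mathsf{k}$. Then $\Lambda^W$ is a Harish-Chandra subalgebra of $U$ and $\mathbb{H}(U,\Lambda)=\mathbb{H}(U,\Lambda^W)$.
   Context: $\mathsf{k}$ is an arbitrary field. All modules are left modules unless stated otherwise; Noetherian means left and right Noetherian. For a $\mathsf{k}$-algebra $\Gamma$, $\operatorname{cfs}\Gamma$ is the set of maximal two-sided ideals $\mathfrak{m}$ with $\Gamma/\mathfrak{m}$ finite dimensional over $\mathsf{k}$; for such $\mathfrak m$, $\mathsf{S}_{\mathfrak{m}}$ is the unique simple $\Gamma/\mathfrak{m}$-module, viewed as a $\Gamma$-module. $\Gamma$ is quasicommutative if $\operatorname{Ext}^1_\Gamma(\mathsf{S}_{\mathfrak{m}},\mathsf{S}_{\mathfrak{n}})=0$ for all distinct $\mathfrak{m},\mathfrak{n}\in\operatorname{cfs}\Gamma$. A subalgebra $\Gamma\subset U$ is quasicentral in $U$ if for every $u\in U$ the $\Gamma$-bimodule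 $\Gamma u\Gamma$ is finitely generated as a left and as a right $\Gamma$-module. $\Gamma$ is a Harish-Chandra subalgebra of $U$ if it is quasicommutative and quasicentral in $U$. A Harish-Chandra module for the pair $(U,\Gamma)$ is a finitely generated $U$-module $M$ with $M=\bigoplus_{\mathfrak{n}\in\operatorname{cfs}\Gamma}M(\mathfrak{n})$, where $M(\mathfrak{n})=\{x\in M:\mathfrak{n}^{N}x=0\text{ for some }N\in\mathbb{Z}_{>0}\}$. $\mathbb{H}(U,\Gamma)$ is the full subcategory of $U$-modules consisting of the Harish-Chandra modules for $(U,\Gamma)$.
   Formalization: In the last part Λ^W is additionally assumed to be quasicommutative; without this the claim fails, e.g. for U = Λ = M_2(k[e]/(e^2)), char k ≠ 2, with W generated by conjugation by diag(1,-1) composed with e -> -e. *)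

theory Defs
  imports "HOL-Algebra.Algebra"
begin

text \<open>
  The modules of \<^theory>\<open>HOL-Algebra.Module\<close> are modules over commutative rings. Only their record
  type and \<^const>\<open>submodule\<close> (which makes no commutativity assumption) are used for modules over
  arbitrary rings. That record type extends \<open>ring\<close>; for a module that is not an algebra, the fields
  \<open>mult\<close> and \<open>one\<close> carry no meaning and no definition below depends on them.

  A subset \<open>S\<close> of a ring, algebra or module \<open>A\<close> is regarded as a structure in its own right as
  \<open>A\<lparr>carrier := S\<rparr>\<close>; this also turns a module over a ring into a module over a subring.
  Right modules are left modules over the opposite ring.
\<close>

section \<open>Modules over arbitrary rings\<close>

locale left_module = R?: ring R + M?: abelian_group M
  for R :: "('r, 'c) ring_scheme" (structure) and M :: "('r, 'm) module" (structure) +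
  assumes smult_closed: "\<lbrakk>a \<in> carrier R; x \<in> carrier M\<rbrakk> \<Longrightarrow> a \<odot>\<^bsub>M\<^esub> x \<in> carrier M"
    and smult_l_distr: "\<lbrakk>a \<in> carrier R; b \<in> carrier R; x \<in> carrier M\<rbrakk> \<Longrightarrow>
      (a \<oplus> b) \<odot>\<^bsub>M\<^esub> x = a \<odot>\<^bsub>M\<^esub> x \<oplus>\<^bsub>M\<^esub> b \<odot>\<^bsub>M\<^esub> x"
    and smult_r_distr: "\<lbrakk>a \<in> carrier R; x \<in> carrier M; y \<in> carrier M\<rbrakk> \<Longrightarrow>
      a \<odot>\<^bsub>M\<^esub> (x \<oplus>\<^bsub>M\<^esub> y) = a \<odot>\<^bsub>M\<^esub> x \<oplus>\<^bsub>M\<^esub> a \<odot>\<^bsub>M\<^esub> y"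
    and smult_assoc1: "\<lbrakk>a \<in> carrier R; b \<in> carrier R; x \<in> carrier M\<rbrakk> \<Longrightarrow>
      (a \<otimes> b) \<odot>\<^bsub>M\<^esub> x = a \<odot>\<^bsub>M\<^esub> (b \<odot>\<^bsub>M\<^esub> x)"
    and smult_one: "x \<in> carrier M \<Longrightarrow> \<one> \<odot>\<^bsub>M\<^esub> x = x"

definition fin_gen :: "('r, 'c) ring_scheme \<Rightarrow> ('r, 'm) module \<Rightarrow> bool" where
  "fin_gen R M \<longleftrightarrow>
     (\<exists>B. finite B \<and> B \<subseteq> carrier M \<and> (\<forall>N. submodule N R M \<and> B \<subseteq> N \<longrightarrow> N = carrier M))"

definition simple_module :: "('r, 'c) ring_scheme \<Rightarrow> ('r, 'm) module \<Rightarrow> bool" where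
  "simple_module R M \<longleftrightarrow> left_module R M \<and> carrier M \<noteq> {\<zero>\<^bsub>M\<^esub>} \<and>
     (\<forall>N. submodule N R M \<longrightarrow> N = {\<zero>\<^bsub>M\<^esub>} \<or> N = carrier M)"

definition left_regular :: "('r, 'c) ring_scheme \<Rightarrow> ('r, 'r) module" where
  "left_regular R = \<lparr>carrier = carrier R, monoid.mult = monoid.mult R, one = one R,
     ring.zero = ring.zero R, ring.add = ring.add R, smult = monoid.mult R\<rparr>"

definition opp_ring :: "('r, 'c) ring_scheme \<Rightarrow> 'r ring" where
  "opp_ring R = \<lparr>carrier = carrier R, monoid.mult = (\<lambda>x y. y \<otimes>\<^bsub>R\<^esub> x), one = one R,
     ring.zero = ring.zero R, ring.add = ring.add R\<rparr>"

definition left_noetherian :: "('r, 'c) ring_scheme \<Rightarrow> bool" where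
  "left_noetherian R \<longleftrightarrow>
     (\<forall>I. submodule I R (left_regular R) \<longrightarrow> fin_gen R ((left_regular R)\<lparr>carrier := I\<rparr>))"

text \<open>The library's \<^const>\<open>noetherian_ring\<close> concerns two-sided ideals.\<close>

definition noetherian :: "('r, 'c) ring_scheme \<Rightarrow> bool" where
  "noetherian R \<longleftrightarrow> left_noetherian R \<and> left_noetherian (opp_ring R)"

text \<open>For an algebra \<open>M\<close> and an ideal \<open>N\<close> the underlying ring is \<open>M Quot N\<close>.\<close>

definition quot_module :: "('r, 'm) module \<Rightarrow> 'm set \<Rightarrow> ('r, 'm set) module" where
  "quot_module M N = \<lparr>carrier = a_rcosets\<^bsub>M\<^esub> N, monoid.mult = rcoset_mult M N,
     one = N +>\<^bsub>M\<^esub> \<one>\<^bsub>M\<^esub>, ring.zero = N, ring.add = set_add M, smult = (\<lambda>a C. \<Union>x\<in>C. N +>\<^bsub>M\<^esub> (a \<odot>\<^bsub>M\<^esub> x))\<rparr>"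

definition restrict_scalars :: "('r \<Rightarrow> 's) \<Rightarrow> ('s, 'm) module \<Rightarrow> ('r, 'm) module" where
  "restrict_scalars h M = \<lparr>carrier = carrier M, monoid.mult = monoid.mult M, one = one M,
     ring.zero = ring.zero M, ring.add = ring.add M, smult = (\<lambda>a. smult M (h a))\<rparr>"

text \<open>\<open>M\<close> is the internal direct sum of the family \<open>H\<close> of subgroups.\<close>

definition is_direct_sum :: "('r, 'm) module \<Rightarrow> 'i set \<Rightarrow> ('i \<Rightarrow> 'm set) \<Rightarrow> bool" where
  "is_direct_sum M I H \<longleftrightarrow> (\<forall>i\<in>I. subgroup (H i) (add_monoid M)) \<and>
     (\<lambda>f. gfinprod (add_monoid M) f I)
       \<in> iso (sum_group I (\<lambda>i. (add_monoid M)\<lparr>carrier := H i\<rparr>)) (add_monoid M)"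


section \<open>First extension groups\<close>

definition module_hom :: "('r, 'c) ring_scheme \<Rightarrow> ('r, 'm) module \<Rightarrow> ('r, 'n) module \<Rightarrow> ('m \<Rightarrow> 'n) set"
  where "module_hom R M N = {f \<in> carrier M \<rightarrow>\<^sub>E carrier N.
     (\<forall>x\<in>carrier M. \<forall>y\<in>carrier M. f (x \<oplus>\<^bsub>M\<^esub> y) = f x \<oplus>\<^bsub>N\<^esub> f y) \<and>
     (\<forall>a\<in>carrier R. \<forall>x\<in>carrier M. f (a \<odot>\<^bsub>M\<^esub> x) = a \<odot>\<^bsub>N\<^esub> f x)}"

definition Hom_group :: "('r, 'c) ring_scheme \<Rightarrow> ('r, 'm) module \<Rightarrow> ('r, 'n) module \<Rightarrow> ('m \<Rightarrow> 'n) monoid"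
  where "Hom_group R M N = \<lparr>carrier = module_hom R M N,
     monoid.mult = (\<lambda>f g. \<lambda>x\<in>carrier M. f x \<oplus>\<^bsub>N\<^esub> g x), one = (\<lambda>x\<in>carrier M. \<zero>\<^bsub>N\<^esub>)\<rparr>"

text \<open>The free module with basis \<open>B\<close>: finitely supported functions on \<open>B\<close> with pointwise operations.\<close>

definition free_module :: "('r, 'c) ring_scheme \<Rightarrow> 'i set \<Rightarrow> ('r, 'i \<Rightarrow> 'r) module" where
  "free_module R B = \<lparr>carrier = {f \<in> B \<rightarrow>\<^sub>E carrier R. finite {x \<in> B. f x \<noteq> \<zero>\<^bsub>R\<^esub>}},
     monoid.mult = (\<lambda>f g. \<lambda>x\<in>B. f x \<otimes>\<^bsub>R\<^esub> g x), one = (\<lambda>x\<in>B. \<one>\<^bsub>R\<^esub>),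
     ring.zero = (\<lambda>x\<in>B. \<zero>\<^bsub>R\<^esub>), ring.add = (\<lambda>f g. \<lambda>x\<in>B. f x \<oplus>\<^bsub>R\<^esub> g x),
     smult = (\<lambda>a f. \<lambda>x\<in>B. a \<otimes>\<^bsub>R\<^esub> f x)\<rparr>"

text \<open>
  The canonical presentation \<open>0 \<rightarrow> syzygy R M \<rightarrow> free_module R (carrier M) \<rightarrow> M \<rightarrow> 0\<close>,
  in which the basis element belonging to \<open>x\<close> is mapped to \<open>x\<close>.
\<close>

definition syzygy :: "('r, 'c) ring_scheme \<Rightarrow> ('r, 'm) module \<Rightarrow> ('r, 'm \<Rightarrow> 'r) module" where
  "syzygy R M = (free_module R (carrier M))\<lparr>carrier :=
     {f \<in> carrier (free_module R (carrier M)).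
        gfinprod (add_monoid M) (\<lambda>x. f x \<odot>\<^bsub>M\<^esub> x) (carrier M) = \<zero>\<^bsub>M\<^esub>}\<rparr>"

text \<open>
  With \<open>F = free_module R (carrier M)\<close> and \<open>K = syzygy R M\<close>, the long exact sequence and
  \<open>Ext\<^sup>1(F, N) = 0\<close> give \<open>Ext\<^sup>1(M, N) = coker (Hom(F, N) \<rightarrow> Hom(K, N))\<close>, the map being restriction.
\<close>

definition Ext1 ::
    "('r, 'c) ring_scheme \<Rightarrow> ('r, 'm) module \<Rightarrow> ('r, 'n) module \<Rightarrow> (('m \<Rightarrow> 'r) \<Rightarrow> 'n) set monoid"
  where "Ext1 R M N = Hom_group R (syzygy R M) N Mod
     (\<lambda>f. restrict f (carrier (syzygy R M))) ` module_hom R (free_module R (carrier M)) N"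


section \<open>Associative algebras\<close>

text \<open>Algebras are unital; subalgebras contain the unit.\<close>

definition assoc_algebra :: "('k, 'c) ring_scheme \<Rightarrow> ('k, 'a) module \<Rightarrow> bool" where
  "assoc_algebra K A \<longleftrightarrow> field K \<and> module K A \<and> ring A \<and>
     (\<forall>c\<in>carrier K. \<forall>x\<in>carrier A. \<forall>y\<in>carrier A.
        (c \<odot>\<^bsub>A\<^esub> x) \<otimes>\<^bsub>A\<^esub> y = c \<odot>\<^bsub>A\<^esub> (x \<otimes>\<^bsub>A\<^esub> y) \<and> x \<otimes>\<^bsub>A\<^esub> (c \<odot>\<^bsub>A\<^esub> y) = c \<odot>\<^bsub>A\<^esub> (x \<otimes>\<^bsub>A\<^esub> y))"

definition is_subalgebra :: "('k, 'c) ring_scheme \<Rightarrow> ('k, 'a) module \<Rightarrow> 'a set \<Rightarrow> bool" where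
  "is_subalgebra K A S \<longleftrightarrow> subring S A \<and> (\<forall>c\<in>carrier K. \<forall>x\<in>S. c \<odot>\<^bsub>A\<^esub> x \<in> S)"

definition algebra_auto :: "('k, 'c) ring_scheme \<Rightarrow> ('k, 'a) module \<Rightarrow> ('a \<Rightarrow> 'a) set" where
  "algebra_auto K A = {s \<in> Bij (carrier A). s \<in> ring_iso A A \<and>
     (\<forall>c\<in>carrier K. \<forall>x\<in>carrier A. s (c \<odot>\<^bsub>A\<^esub> x) = c \<odot>\<^bsub>A\<^esub> s x)}"

definition algebra_AutoGroup :: "('k, 'c) ring_scheme \<Rightarrow> ('k, 'a) module \<Rightarrow> ('a \<Rightarrow> 'a) monoid" where
  "algebra_AutoGroup K A = (BijGroup (carrier A))\<lparr>carrier := algebra_auto K A\<rparr>"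

definition fixed_ring :: "'a set \<Rightarrow> ('a \<Rightarrow> 'a) set \<Rightarrow> 'a set" where
  "fixed_ring S W = {x \<in> S. \<forall>s\<in>W. s x = x}"

text \<open>The cofinite spectrum. Note that \<^const>\<open>maximalideal\<close> refers to two-sided ideals.\<close>

definition cfs :: "('k, 'c) ring_scheme \<Rightarrow> ('k, 'a) module \<Rightarrow> 'a set set" where
  "cfs K A = {m. maximalideal m A \<and> fin_gen K (quot_module A m)}"

text \<open>
  The representatives of \<open>S\<^sub>m\<close>, i.e. the simple \<open>A/m\<close>-modules viewed as \<open>A\<close>-modules. For \<open>m \<in> cfs K A\<close>
  the simple \<open>A/m\<close>-module is unique up to isomorphism, and since \<open>A/m\<close> is finite dimensional it is
  realized by a minimal left ideal of \<open>A/m\<close>, which is a set of cosets; so there are representatives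
  of the type chosen here.
\<close>

definition simples_at :: "('k, 'a) module \<Rightarrow> 'a set \<Rightarrow> ('a, 'a set) module set" where
  "simples_at A m = {restrict_scalars (\<lambda>a. m +>\<^bsub>A\<^esub> a) S | S. simple_module (A Quot m) S}"

definition quasicommutative :: "('k, 'c) ring_scheme \<Rightarrow> ('k, 'a) module \<Rightarrow> bool" where
  "quasicommutative K A \<longleftrightarrow>
     (\<forall>m\<in>cfs K A. \<forall>n\<in>cfs K A. m \<noteq> n \<longrightarrow>
        (\<forall>S\<in>simples_at A m. \<forall>T\<in>simples_at A n. trivial_group (Ext1 A S T)))"


section \<open>Harish-Chandra subalgebras and modules\<close>

text \<open>\<open>fin_gen_left U G B\<close> and \<open>fin_gen_right U G B\<close>: the additive subgroup \<open>B\<close> of \<open>U\<close>, closed under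
  left (right) multiplication by the subring \<open>G\<close>, is finitely generated as left (right) \<open>G\<close>-module.\<close>

definition fin_gen_left :: "('k, 'a) module \<Rightarrow> 'a set \<Rightarrow> 'a set \<Rightarrow> bool" where
  "fin_gen_left U G B \<longleftrightarrow> fin_gen (U\<lparr>carrier := G\<rparr>) ((left_regular U)\<lparr>carrier := B\<rparr>)"

definition fin_gen_right :: "('k, 'a) module \<Rightarrow> 'a set \<Rightarrow> 'a set \<Rightarrow> bool" where
  "fin_gen_right U G B \<longleftrightarrow>
     fin_gen (opp_ring (U\<lparr>carrier := G\<rparr>)) ((left_regular (opp_ring U))\<lparr>carrier := B\<rparr>)"

definition bimodule_gen :: "('k, 'a) module \<Rightarrow> 'a set \<Rightarrow> 'a \<Rightarrow> 'a set" where
  "bimodule_gen U G u = generate (add_monoid U) {a \<otimes>\<^bsub>U\<^esub> u \<otimes>\<^bsub>U\<^esub> b | a b. a \<in> G \<and> b \<in> G}"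

definition quasicentral :: "('k, 'a) module \<Rightarrow> 'a set \<Rightarrow> bool" where
  "quasicentral U G \<longleftrightarrow>
     (\<forall>u\<in>carrier U. fin_gen_left U G (bimodule_gen U G u) \<and> fin_gen_right U G (bimodule_gen U G u))"

definition HC_subalgebra :: "('k, 'c) ring_scheme \<Rightarrow> ('k, 'a) module \<Rightarrow> 'a set \<Rightarrow> bool" where
  "HC_subalgebra K U G \<longleftrightarrow>
     is_subalgebra K U G \<and> quasicommutative K (U\<lparr>carrier := G\<rparr>) \<and> quasicentral U G"

primrec ideal_power :: "('a, 'c) ring_scheme \<Rightarrow> 'a set \<Rightarrow> nat \<Rightarrow> 'a set" where
  "ideal_power A n 0 = carrier A"
| "ideal_power A n (Suc N) = ideal_prod A (ideal_power A n N) n"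

definition primary_part :: "('a, 'c) ring_scheme \<Rightarrow> ('a, 'm) module \<Rightarrow> 'a set \<Rightarrow> 'm set" where
  "primary_part A M n =
     {x \<in> carrier M. \<exists>N>0. \<forall>a\<in>ideal_power A n N. a \<odot>\<^bsub>M\<^esub> x = \<zero>\<^bsub>M\<^esub>}"

text \<open>The objects of \<open>\<bbbH>(U, G)\<close>, up to the choice of a carrier type. Being a full subcategory of the
  category of \<open>U\<close>-modules, \<open>\<bbbH>(U, G)\<close> is determined by them.\<close>

definition HC_modules :: "('k, 'c) ring_scheme \<Rightarrow> ('k, 'a) module \<Rightarrow> 'a set \<Rightarrow> ('a, 'm) module set" where
  "HC_modules K U G = {M. left_module U M \<and> fin_gen U M \<and>
     is_direct_sum M (cfs K (U\<lparr>carrier := G\<rparr>)) (primary_part (U\<lparr>carrier := G\<rparr>) M)}"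

end

theory Submission
  imports Defs
begin

text \<open>
  Quasicentrality passes between \<open>\<Lambda>\<close> and \<open>\<Gamma>\<close> by finite generation and the Noetherian property.

  For the module categories, the point is that a direct sum decomposition of \<open>M\<close> into primary parts
  is equivalent to local finiteness: every \<open>\<Gamma> x\<close> is finite dimensional. If \<open>n\<^sup>N x = 0\<close>, then \<open>\<Gamma> x\<close> is a
  quotient of \<open>\<Gamma> / n\<^sup>N\<close>, which is finite dimensional since \<open>\<Gamma>\<close> is Noetherian. Conversely, a finite
  dimensional module is killed by a product of ideals in the cofinite spectrum, and quasicommutativity
  implies \<open>m n = m \<inter> n = n m\<close> for distinct \<open>m\<close>, \<open>n\<close>; so the factors of the product can be sorted and
  the module splits by comaximality. Local finiteness over \<open>\<Gamma>\<close> and over \<open>\<Lambda> = \<Sum> l\<^sub>i \<Gamma>\<close> is the same, since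
  \<open>\<Lambda> x = \<Sum> l\<^sub>i \<Gamma> x\<close>.

  For a finite group \<open>W\<close> of invertible order, averaging shows that \<open>\<Lambda>\<^sup>W\<close> is Noetherian and that \<open>\<Lambda>\<close> is
  finitely generated over it.
\<close>

section \<open>Submodules and finite generation\<close>

text \<open>The hypothesis on \<open>Ext1\<close> concerns one canonical free presentation, but what
  the proof needs is an extension property: a linear map defined on \<open>m\<close> extends to a
  left ideal minimal over \<open>m\<close>. Quasicommutativity enters through this property alone,
  and it yields the inclusion of the intersection of \<open>m\<close> and \<open>n\<close> in the
  product \<open>n m\<close>. Since \<open>simples_at\<close> admits only modules whose elements are
  subsets of the algebra, both simple modules have to be realised by cosets: a left ideal minimal
  over \<open>m\<close>, taken modulo \<open>m\<close>, and \<open>m\<close> modulo a left ideal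
  that is maximal among those avoiding a given element. Dimensions are not counted by bases.
  Finiteness means that a strictly increasing function with natural values exists on the submodules
  of an interval; such functions can be added and transported along linear maps, and they provide
  minimal and maximal submodules. The field acts through its copy in the algebra, the same one for
  both subalgebras, so the two notions of local finiteness differ only in the orbit of a vector.
  Right-hand statements are left-hand ones over the opposite ring.\<close>

definition lsub :: "'r set \<Rightarrow> ('r, 'm) module \<Rightarrow> 'm set \<Rightarrow> bool" where
  "lsub S M N \<longleftrightarrow> N \<subseteq> carrier M \<and> \<zero>\<^bsub>M\<^esub> \<in> N \<and> (\<forall>x\<in>N. \<forall>y\<in>N. x \<oplus>\<^bsub>M\<^esub> y \<in> N) \<and>
     (\<forall>a\<in>S. \<forall>x\<in>N. a \<odot>\<^bsub>M\<^esub> x \<in> N)"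

text \<open>For \<open>E\<close> outside the carrier no submodule qualifies and the intersection is
  the whole type; hence the recurring side condition \<open>E \<subseteq> carrier M\<close>.\<close>

definition lspan :: "'r set \<Rightarrow> ('r, 'm) module \<Rightarrow> 'm set \<Rightarrow> 'm set" where
  "lspan S M E = \<Inter>{N. lsub S M N \<and> E \<subseteq> N}"

lemma lsubI:
  assumes "N \<subseteq> carrier M" "\<zero>\<^bsub>M\<^esub> \<in> N" "\<And>x y. x \<in> N \<Longrightarrow> y \<in> N \<Longrightarrow> x \<oplus>\<^bsub>M\<^esub> y \<in> N"
    "\<And>a x. a \<in> S \<Longrightarrow> x \<in> N \<Longrightarrow> a \<odot>\<^bsub>M\<^esub> x \<in> N"
  shows "lsub S M N"
  using assms unfolding lsub_def by blast

lemma lsubD: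
  assumes "lsub S M N"
  shows "N \<subseteq> carrier M" "x \<in> N \<Longrightarrow> x \<in> carrier M" "\<zero>\<^bsub>M\<^esub> \<in> N" "x \<in> N \<Longrightarrow> y \<in> N \<Longrightarrow> x \<oplus>\<^bsub>M\<^esub> y \<in> N"
    "a \<in> S \<Longrightarrow> x \<in> N \<Longrightarrow> a \<odot>\<^bsub>M\<^esub> x \<in> N"
  using assms unfolding lsub_def by blast+

lemma lsub_mono: "lsub S M N \<Longrightarrow> T \<subseteq> S \<Longrightarrow> lsub T M N"
  unfolding lsub_def by blast

lemma lsub_Int: "lsub S M N \<Longrightarrow> lsub S M N' \<Longrightarrow> lsub S M (N \<inter> N')"
  unfolding lsub_def by blast

lemma lsub_restrict_carrier:
  "B \<subseteq> carrier M \<Longrightarrow> lsub S (M\<lparr>carrier := B\<rparr>) N \<longleftrightarrow> lsub S M N \<and> N \<subseteq> B"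
  unfolding lsub_def by auto

lemma lspan_superset: "E \<subseteq> lspan S M E"
  unfolding lspan_def by blast

lemma lspan_least: "lsub S M N \<Longrightarrow> E \<subseteq> N \<Longrightarrow> lspan S M E \<subseteq> N"
  unfolding lspan_def by blast

lemma lspan_mono: "E \<subseteq> Y \<Longrightarrow> lspan S M E \<subseteq> lspan S M Y"
  unfolding lspan_def by blast

context left_module
begin

lemma smult_zero_l [simp]: "x \<in> carrier M \<Longrightarrow> \<zero> \<odot>\<^bsub>M\<^esub> x = \<zero>\<^bsub>M\<^esub>"
  using smult_l_distr[of \<zero> \<zero> x] smult_closed[of \<zero> x] by simp

lemma smult_zero_r [simp]: "a \<in> carrier R \<Longrightarrow> a \<odot>\<^bsub>M\<^esub> \<zero>\<^bsub>M\<^esub> = \<zero>\<^bsub>M\<^esub>"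
  using smult_r_distr[of a "\<zero>\<^bsub>M\<^esub>" "\<zero>\<^bsub>M\<^esub>"] smult_closed[of a "\<zero>\<^bsub>M\<^esub>"] by simp

lemma smult_minus_l: "a \<in> carrier R \<Longrightarrow> x \<in> carrier M \<Longrightarrow> (\<ominus> a) \<odot>\<^bsub>M\<^esub> x = \<ominus>\<^bsub>M\<^esub> (a \<odot>\<^bsub>M\<^esub> x)"
  using smult_l_distr[of "\<ominus> a" a x]
  by (intro M.minus_equality[symmetric]) (auto simp: smult_closed R.l_neg)

lemma smult_minus_r: "a \<in> carrier R \<Longrightarrow> x \<in> carrier M \<Longrightarrow> a \<odot>\<^bsub>M\<^esub> (\<ominus>\<^bsub>M\<^esub> x) = \<ominus>\<^bsub>M\<^esub> (a \<odot>\<^bsub>M\<^esub> x)"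
  using smult_r_distr[of a "\<ominus>\<^bsub>M\<^esub> x" x]
  by (intro M.minus_equality[symmetric]) (auto simp: smult_closed M.l_neg)

lemma smult_diff_r:
  "a \<in> carrier R \<Longrightarrow> x \<in> carrier M \<Longrightarrow> y \<in> carrier M \<Longrightarrow>
    a \<odot>\<^bsub>M\<^esub> (x \<ominus>\<^bsub>M\<^esub> y) = a \<odot>\<^bsub>M\<^esub> x \<ominus>\<^bsub>M\<^esub> a \<odot>\<^bsub>M\<^esub> y"
  by (simp add: M.minus_eq smult_r_distr smult_minus_r)

lemma lsub_minus: "lsub (carrier R) M N \<Longrightarrow> x \<in> N \<Longrightarrow> \<ominus>\<^bsub>M\<^esub> x \<in> N"
  using lsubD(5)[of "carrier R" M N "\<ominus> \<one>" x] lsubD(2)[of "carrier R" M N x]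
  by (simp add: smult_minus_l smult_one)

lemma lsub_diff: "lsub (carrier R) M N \<Longrightarrow> x \<in> N \<Longrightarrow> y \<in> N \<Longrightarrow> x \<ominus>\<^bsub>M\<^esub> y \<in> N"
  by (simp add: M.minus_eq lsubD(4) lsub_minus)

lemma lsub_cancel:
  assumes "lsub (carrier R) M N" "x \<in> carrier M" "y \<in> N" "x \<oplus>\<^bsub>M\<^esub> y \<in> N"
  shows "x \<in> N"
proof -
  have "x = (x \<oplus>\<^bsub>M\<^esub> y) \<ominus>\<^bsub>M\<^esub> y"
    using assms lsubD(2)[OF assms(1)] by (simp add: M.minus_eq M.a_assoc M.r_neg)
  then show ?thesis using lsub_diff[OF assms(1)] assms by metis
qed

text \<open>\<open>lsub\<close> takes a bare set of scalars, so that restriction of scalars is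
  \<open>lsub_mono\<close>. It can leave out closure under negation because -1 is a scalar as soon
  as the scalars form a ring.\<close>

lemma submodule_iff_lsub: "submodule N R M \<longleftrightarrow> lsub (carrier R) M N"
proof
  assume "submodule N R M"
  then interpret submodule N R M .
  show "lsub (carrier R) M N"
    using subset one_closed m_closed smult_closed by (auto intro!: lsubI)
next
  assume N: "lsub (carrier R) M N"
  show "submodule N R M"
  proof (intro submodule.intro submodule_axioms.intro)
    show "subgroup N (add_monoid M)"
      using lsubD[OF N] lsub_minus[OF N] by (intro M.add.subgroupI) (auto simp: a_inv_def)
  qed (use lsubD[OF N] in auto)
qed

lemma lsub_carrier: "lsub (carrier R) M (carrier M)"
  by (auto intro!: lsubI smult_closed)

lemma lsub_zero: "lsub (carrier R) M {\<zero>\<^bsub>M\<^esub>}"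
  by (auto intro!: lsubI)

lemma lsub_lspan: "E \<subseteq> carrier M \<Longrightarrow> lsub (carrier R) M (lspan (carrier R) M E)"
  using lsub_carrier unfolding lspan_def lsub_def[of _ _ "\<Inter>_"] by (auto simp: lsubD)

lemma lspan_carrier: "E \<subseteq> carrier M \<Longrightarrow> lspan (carrier R) M E \<subseteq> carrier M"
  using lspan_least[OF lsub_carrier] .

lemma lsub_left_module:
  assumes B: "lsub (carrier R) M B"
  shows "left_module R (M\<lparr>carrier := B\<rparr>)"
proof -
  have "abelian_group (M\<lparr>carrier := B\<rparr>)"
  proof (rule abelian_groupI; simp)
    show "\<exists>y\<in>B. y \<oplus>\<^bsub>M\<^esub> x = \<zero>\<^bsub>M\<^esub>" if "x \<in> B" for x
      using that lsub_minus[OF B] lsubD(2)[OF B] M.l_neg by blast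
  qed (use lsubD[OF B] in \<open>auto simp: M.a_ac\<close>)
  moreover have "left_module_axioms R (M\<lparr>carrier := B\<rparr>)"
    by standard (use lsubD[OF B] in \<open>auto simp: smult_l_distr smult_r_distr smult_assoc1 smult_one\<close>)
  ultimately show ?thesis by (intro left_module.intro R.ring_axioms)
qed

lemma subring_left_module: "subring S R \<Longrightarrow> left_module (R\<lparr>carrier := S\<rparr>) M"
  apply (intro left_module.intro R.subring_is_ring M.abelian_group_axioms)
  apply (auto dest: subringE(1) intro!: left_module_axioms.intro
      simp: smult_closed smult_l_distr smult_r_distr smult_assoc1 smult_one subset_iff)
  done

lemma fin_gen_iff:
  assumes B: "lsub (carrier R) M B"
  shows "fin_gen R (M\<lparr>carrier := B\<rparr>) \<longleftrightarrow> (\<exists>E. finite E \<and> E \<subseteq> B \<and> lspan (carrier R) M E = B)"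
proof -
  interpret B: left_module R "M\<lparr>carrier := B\<rparr>" by (rule lsub_left_module[OF B])
  have "(\<forall>N. lsub (carrier R) M N \<and> N \<subseteq> B \<and> E \<subseteq> N \<longrightarrow> N = B) \<longleftrightarrow> lspan (carrier R) M E = B"
    if E: "E \<subseteq> B" for E
  proof
    assume *: "\<forall>N. lsub (carrier R) M N \<and> N \<subseteq> B \<and> E \<subseteq> N \<longrightarrow> N = B"
    have "lsub (carrier R) M (lspan (carrier R) M E)"
      using E lsubD(1)[OF B] by (intro lsub_lspan) auto
    then show "lspan (carrier R) M E = B"
      using * lspan_least[OF B E] lspan_superset[of E "carrier R" M] by blast
  next
    assume "lspan (carrier R) M E = B"
    then show "\<forall>N. lsub (carrier R) M N \<and> N \<subseteq> B \<and> E \<subseteq> N \<longrightarrow> N = B"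
      using lspan_least by blast
  qed
  then show ?thesis
    unfolding fin_gen_def B.submodule_iff_lsub lsub_restrict_carrier[OF lsubD(1)[OF B]]
    by (intro ex_cong1) (auto simp: conj_assoc)
qed

text \<open>Spans of finite sets can be studied one generator at a time, with an explicit
  coefficient at the new generator. The inductions over generating sets below rest on this.\<close>

lemma lspan_insert:
  assumes E: "E \<subseteq> carrier M" and x: "x \<in> carrier M"
  shows "lspan (carrier R) M (insert x E) =
    {a \<odot>\<^bsub>M\<^esub> x \<oplus>\<^bsub>M\<^esub> y | a y. a \<in> carrier R \<and> y \<in> lspan (carrier R) M E}" (is "_ = ?T")
proof
  note S = lsubD[OF lsub_lspan[OF E]]
  have "lsub (carrier R) M ?T"
  proof (rule lsubI)
    show "?T \<subseteq> carrier M" using S x by (auto intro!: M.a_closed smult_closed)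
    show "\<zero>\<^bsub>M\<^esub> \<in> ?T" using S(3) x by (auto intro!: exI[of _ \<zero>] exI[of _ "\<zero>\<^bsub>M\<^esub>"])
    show "u \<oplus>\<^bsub>M\<^esub> v \<in> ?T" if uv: "u \<in> ?T" "v \<in> ?T" for u v
    proof -
      obtain a y b z where e: "u = a \<odot>\<^bsub>M\<^esub> x \<oplus>\<^bsub>M\<^esub> y" "v = b \<odot>\<^bsub>M\<^esub> x \<oplus>\<^bsub>M\<^esub> z"
        and m: "a \<in> carrier R" "b \<in> carrier R" "y \<in> lspan (carrier R) M E" "z \<in> lspan (carrier R) M E"
        using uv by blast
      note mm = m S(2)[OF m(3)] S(2)[OF m(4)]
      have "u \<oplus>\<^bsub>M\<^esub> v = (a \<oplus> b) \<odot>\<^bsub>M\<^esub> x \<oplus>\<^bsub>M\<^esub> (y \<oplus>\<^bsub>M\<^esub> z)"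
        using mm x unfolding e by (simp add: smult_l_distr smult_closed M.a_ac)
      then show ?thesis using m S(4) by blast
    qed
    show "a \<odot>\<^bsub>M\<^esub> u \<in> ?T" if a: "a \<in> carrier R" and u: "u \<in> ?T" for a u
    proof -
      obtain b y where e: "u = b \<odot>\<^bsub>M\<^esub> x \<oplus>\<^bsub>M\<^esub> y"
        and m: "b \<in> carrier R" "y \<in> lspan (carrier R) M E" using u by blast
      have "a \<odot>\<^bsub>M\<^esub> u = (a \<otimes> b) \<odot>\<^bsub>M\<^esub> x \<oplus>\<^bsub>M\<^esub> (a \<odot>\<^bsub>M\<^esub> y)"
        using m S(2)[OF m(2)] x a unfolding e by (simp add: smult_r_distr smult_assoc1 smult_closed)
      then show ?thesis using m S(5) a by blast
    qed
  qed
  moreover have "insert x E \<subseteq> ?T"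
  proof -
    have "x = \<one> \<odot>\<^bsub>M\<^esub> x \<oplus>\<^bsub>M\<^esub> \<zero>\<^bsub>M\<^esub>" using x by (simp add: smult_one)
    moreover have "y = \<zero> \<odot>\<^bsub>M\<^esub> x \<oplus>\<^bsub>M\<^esub> y" if "y \<in> E" for y using x that E by auto
    ultimately show ?thesis using S(3) lspan_superset[of E "carrier R" M] by blast
  qed
  ultimately show "lspan (carrier R) M (insert x E) \<subseteq> ?T" by (rule lspan_least)
next
  have "insert x E \<subseteq> carrier M" using E x by auto
  note S = lsubD[OF lsub_lspan[OF this]]
  have "x \<in> lspan (carrier R) M (insert x E)" "lspan (carrier R) M E \<subseteq> lspan (carrier R) M (insert x E)"
    using lspan_superset[of "insert x E" "carrier R" M] lspan_mono[of E "insert x E"] by auto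
  then show "?T \<subseteq> lspan (carrier R) M (insert x E)" using S by blast
qed

lemma lspan_empty: "lspan (carrier R) M {} = {\<zero>\<^bsub>M\<^esub>}"
  using lspan_least[OF lsub_zero, of "{}"] lsubD(3)[OF lsub_lspan[of "{}"]] by auto

end

section \<open>Images and preimages under maps that are linear on a submodule\<close>

lemma lsub_preimage:
  assumes "left_module R M" "left_module R M'"
    and W: "lsub (carrier R) M' W" and V: "lsub (carrier R) M V"
    and h: "\<And>x. x \<in> V \<Longrightarrow> h x \<in> carrier M'"
      "\<And>x y. x \<in> V \<Longrightarrow> y \<in> V \<Longrightarrow> h (x \<oplus>\<^bsub>M\<^esub> y) = h x \<oplus>\<^bsub>M'\<^esub> h y"
      "\<And>a x. a \<in> carrier R \<Longrightarrow> x \<in> V \<Longrightarrow> h (a \<odot>\<^bsub>M\<^esub> x) = a \<odot>\<^bsub>M'\<^esub> h x"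
  shows "lsub (carrier R) M {x \<in> V. h x \<in> W}"
proof (rule lsubI)
  interpret M: left_module R M by fact
  interpret M': left_module R M' by fact
  have z: "\<zero>\<^bsub>M\<^esub> \<in> V" using lsubD(3)[OF V] .
  \<comment> \<open>Zero as the scalar zero times zero: compatibility with scalars alone gives the
    value of \<open>h\<close> at zero.\<close>
  have "h (\<zero>\<^bsub>R\<^esub> \<odot>\<^bsub>M\<^esub> \<zero>\<^bsub>M\<^esub>) = \<zero>\<^bsub>R\<^esub> \<odot>\<^bsub>M'\<^esub> h \<zero>\<^bsub>M\<^esub>" using z by (intro h(3)) auto
  then have "h \<zero>\<^bsub>M\<^esub> = \<zero>\<^bsub>M'\<^esub>" using h(1)[OF z] by simp
  then show "\<zero>\<^bsub>M\<^esub> \<in> {x \<in> V. h x \<in> W}" using z lsubD(3)[OF W] by simp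
qed (use lsubD[OF V] lsubD[OF W] h in auto)

lemma lsub_image:
  assumes "left_module R M" "left_module R M'" and N: "lsub (carrier R) M N"
    and h: "\<And>x. x \<in> N \<Longrightarrow> h x \<in> carrier M'"
      "\<And>x y. x \<in> N \<Longrightarrow> y \<in> N \<Longrightarrow> h (x \<oplus>\<^bsub>M\<^esub> y) = h x \<oplus>\<^bsub>M'\<^esub> h y"
      "\<And>a x. a \<in> carrier R \<Longrightarrow> x \<in> N \<Longrightarrow> h (a \<odot>\<^bsub>M\<^esub> x) = a \<odot>\<^bsub>M'\<^esub> h x"
  shows "lsub (carrier R) M' (h ` N)"
proof (rule lsubI)
  interpret M: left_module R M by fact
  interpret M': left_module R M' by fact
  show "h ` N \<subseteq> carrier M'" using h(1) by blast
  have z: "\<zero>\<^bsub>M\<^esub> \<in> N" using lsubD(3)[OF N] .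
  have "h (\<zero>\<^bsub>R\<^esub> \<odot>\<^bsub>M\<^esub> \<zero>\<^bsub>M\<^esub>) = \<zero>\<^bsub>R\<^esub> \<odot>\<^bsub>M'\<^esub> h \<zero>\<^bsub>M\<^esub>" using z by (intro h(3)) auto
  then have "h \<zero>\<^bsub>M\<^esub> = \<zero>\<^bsub>M'\<^esub>" using h(1)[OF z] by simp
  then show "\<zero>\<^bsub>M'\<^esub> \<in> h ` N" using z by force
  show "x \<oplus>\<^bsub>M'\<^esub> y \<in> h ` N" if xy: "x \<in> h ` N" "y \<in> h ` N" for x y
  proof -
    obtain u v where "u \<in> N" "v \<in> N" "x = h u" "y = h v" using xy by blast
    then show ?thesis using h(2)[of u v] lsubD(4)[OF N, of u v] by (metis image_eqI)
  qed
  show "a \<odot>\<^bsub>M'\<^esub> x \<in> h ` N" if ax: "a \<in> carrier R" "x \<in> h ` N" for a x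
  proof -
    obtain u where "u \<in> N" "x = h u" using ax by blast
    then show ?thesis using h(3)[of a u] ax(1) lsubD(5)[OF N, of a u] by (metis image_eqI)
  qed
qed

lemma left_regular_simps [simp]:
  "carrier (left_regular R) = carrier R" "\<zero>\<^bsub>left_regular R\<^esub> = \<zero>\<^bsub>R\<^esub>"
  "x \<oplus>\<^bsub>left_regular R\<^esub> y = x \<oplus>\<^bsub>R\<^esub> y" "a \<odot>\<^bsub>left_regular R\<^esub> x = a \<otimes>\<^bsub>R\<^esub> x"
  by (simp_all add: left_regular_def)

lemma (in ring) left_regular_module: "left_module R (left_regular R)"
proof -
  have "abelian_group (left_regular R)"
    using l_neg by (intro abelian_groupI) (auto simp: a_ac intro!: bexI)
  then show ?thesis
    by (intro left_module.intro ring_axioms left_module_axioms.intro)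
      (auto simp: l_distr r_distr m_assoc)
qed

lemma (in ring) left_regular_minus: "x \<in> carrier R \<Longrightarrow> \<ominus>\<^bsub>left_regular R\<^esub> x = \<ominus> x"
proof -
  assume x: "x \<in> carrier R"
  note neg = l_neg[OF x]
  interpret left_module R "left_regular R" by (rule left_regular_module)
  show ?thesis using x neg by (intro M.minus_equality) auto
qed

lemma (in ring) left_regular_diff:
  "x \<in> carrier R \<Longrightarrow> y \<in> carrier R \<Longrightarrow> x \<ominus>\<^bsub>left_regular R\<^esub> y = x \<ominus> y"
  unfolding a_minus_def by (simp add: left_regular_minus)

section \<open>Submodules of finitely generated modules over Noetherian rings\<close>

lemma (in ring) left_noetherian_fg:
  assumes "left_noetherian R" "lsub (carrier R) (left_regular R) I"
  obtains E where "finite E" "E \<subseteq> I" "lspan (carrier R) (left_regular R) E = I"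
proof -
  interpret left_module R "left_regular R" by (rule left_regular_module)
  show ?thesis
    using assms that unfolding left_noetherian_def submodule_iff_lsub
    by (auto simp: fin_gen_iff)
qed

text \<open>Induction on the generators. The coefficients at \<open>x\<close> that occur in
  \<open>N\<close> form a left ideal with finitely many generators; these are lifted to
  \<open>N\<close>, and together with generators of the part of \<open>N\<close> inside the span of
  \<open>E\<close> they generate \<open>N\<close>.\<close>

lemma (in left_module) noetherian_lsub_fg:
  assumes R: "left_noetherian R" and "finite E" "E \<subseteq> carrier M"
    and N: "lsub (carrier R) M N" "N \<subseteq> lspan (carrier R) M E"
  obtains Y where "finite Y" "Y \<subseteq> N" "lspan (carrier R) M Y = N"
proof -
  have "\<exists>Y. finite Y \<and> Y \<subseteq> N \<and> lspan (carrier R) M Y = N"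
    using assms(2-)
  proof (induction E arbitrary: N)
    case empty
    then show ?case using lsubD(3)[OF empty(2)] by (intro exI[of _ "{}"]) (auto simp: lspan_empty)
  next
    case (insert x E)
    let ?S = "lspan (carrier R) M"
    have E: "E \<subseteq> carrier M" and x: "x \<in> carrier M" using insert by auto
    note S = lsubD[OF lsub_lspan[OF E]] and N = lsubD[OF insert.prems(2)]
    interpret reg: left_module R "left_regular R" by (rule R.left_regular_module)
    \<comment> \<open>Stated for every submodule, since it serves for \<open>N\<close> and again for
      the span of the proposed generators.\<close>
    have lsubI': "lsub (carrier R) (left_regular R) {a \<in> carrier R. \<exists>y\<in>?S E. a \<odot>\<^bsub>M\<^esub> x \<oplus>\<^bsub>M\<^esub> y \<in> N'}"
      if "lsub (carrier R) M N'" for N'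
    proof -
      note N' = lsubD[OF that]
      show ?thesis
      proof (rule lsubI, goal_cases)
        case 2
        show ?case using x S(3) N'(3) by (auto intro!: bexI[of _ "\<zero>\<^bsub>M\<^esub>"])
      next
        case (3 a b)
        then obtain y z where m: "a \<in> carrier R" "b \<in> carrier R" "y \<in> ?S E" "z \<in> ?S E"
          "a \<odot>\<^bsub>M\<^esub> x \<oplus>\<^bsub>M\<^esub> y \<in> N'" "b \<odot>\<^bsub>M\<^esub> x \<oplus>\<^bsub>M\<^esub> z \<in> N'" by blast
        have "(a \<oplus> b) \<odot>\<^bsub>M\<^esub> x \<oplus>\<^bsub>M\<^esub> (y \<oplus>\<^bsub>M\<^esub> z) = (a \<odot>\<^bsub>M\<^esub> x \<oplus>\<^bsub>M\<^esub> y) \<oplus>\<^bsub>M\<^esub> (b \<odot>\<^bsub>M\<^esub> x \<oplus>\<^bsub>M\<^esub> z)"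
          using m S(2)[OF m(3)] S(2)[OF m(4)] x by (simp add: smult_l_distr smult_closed M.a_ac)
        then show ?case using m S(4) N'(4) by (auto intro!: bexI[of _ "y \<oplus>\<^bsub>M\<^esub> z"])
      next
        case (4 c a)
        then obtain y where m: "c \<in> carrier R" "a \<in> carrier R" "y \<in> ?S E"
          "a \<odot>\<^bsub>M\<^esub> x \<oplus>\<^bsub>M\<^esub> y \<in> N'" by blast
        have "(c \<otimes> a) \<odot>\<^bsub>M\<^esub> x \<oplus>\<^bsub>M\<^esub> (c \<odot>\<^bsub>M\<^esub> y) = c \<odot>\<^bsub>M\<^esub> (a \<odot>\<^bsub>M\<^esub> x \<oplus>\<^bsub>M\<^esub> y)"
          using m S(2)[OF m(3)] x by (simp add: smult_r_distr smult_assoc1 smult_closed)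
        then show ?case using m S(5) N'(5) by (auto intro!: bexI[of _ "c \<odot>\<^bsub>M\<^esub> y"])
      qed auto
    qed
    obtain A where A: "finite A" "A \<subseteq> {a \<in> carrier R. \<exists>y\<in>?S E. a \<odot>\<^bsub>M\<^esub> x \<oplus>\<^bsub>M\<^esub> y \<in> N}"
      "lspan (carrier R) (left_regular R) A = {a \<in> carrier R. \<exists>y\<in>?S E. a \<odot>\<^bsub>M\<^esub> x \<oplus>\<^bsub>M\<^esub> y \<in> N}"
      by (rule R.left_noetherian_fg[OF R lsubI'[OF insert.prems(2)]])
    from A(2) have "\<forall>a\<in>A. \<exists>y. y \<in> ?S E \<and> a \<odot>\<^bsub>M\<^esub> x \<oplus>\<^bsub>M\<^esub> y \<in> N" by blast
    then obtain g where g: "\<And>a. a \<in> A \<Longrightarrow> g a \<in> ?S E \<and> a \<odot>\<^bsub>M\<^esub> x \<oplus>\<^bsub>M\<^esub> g a \<in> N" by metis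
    obtain Y where Y: "finite Y" "Y \<subseteq> N \<inter> ?S E" "?S Y = N \<inter> ?S E"
      using insert.IH[OF E lsub_Int[OF insert.prems(2) lsub_lspan[OF E]]] by auto
    let ?Z = "Y \<union> (\<lambda>a. a \<odot>\<^bsub>M\<^esub> x \<oplus>\<^bsub>M\<^esub> g a) ` A"
    have Z: "?Z \<subseteq> N" using Y g by auto
    then have Zc: "?Z \<subseteq> carrier M" using N(1) by auto
    note SZ = lsub_lspan[OF Zc]
    \<comment> \<open>The coefficient ideal of \<open>N\<close> is generated by \<open>A\<close>,
      whose members are coefficients of elements of \<open>?Z\<close>. So every coefficient
      occurring in \<open>N\<close> also occurs in the span of \<open>?Z\<close>.\<close>
    have AZ: "lspan (carrier R) (left_regular R) A \<subseteq> {a \<in> carrier R. \<exists>y\<in>?S E. a \<odot>\<^bsub>M\<^esub> x \<oplus>\<^bsub>M\<^esub> y \<in> ?S ?Z}"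
      using lspan_superset[of ?Z "carrier R" M] g A(2) by (intro lspan_least lsubI'[OF SZ]) blast
    have "N \<subseteq> ?S ?Z"
    proof
      fix u assume u: "u \<in> N"
      then obtain a y where ay: "a \<in> carrier R" "y \<in> ?S E" "u = a \<odot>\<^bsub>M\<^esub> x \<oplus>\<^bsub>M\<^esub> y"
        using insert.prems(3) unfolding lspan_insert[OF E x] by blast
      then have "a \<in> lspan (carrier R) (left_regular R) A" using u A(3) by blast
      then obtain z where z: "z \<in> ?S E" "a \<odot>\<^bsub>M\<^esub> x \<oplus>\<^bsub>M\<^esub> z \<in> ?S ?Z" using AZ by blast
      have c: "y \<in> carrier M" "z \<in> carrier M" using ay z S(2) by auto
      \<comment> \<open>Two elements with the same coefficient \<open>a\<close> at \<open>x\<close>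
        differ by an element of the span of \<open>E\<close>, where the induction hypothesis
        applies.\<close>
      have e: "u = (y \<ominus>\<^bsub>M\<^esub> z) \<oplus>\<^bsub>M\<^esub> (a \<odot>\<^bsub>M\<^esub> x \<oplus>\<^bsub>M\<^esub> z)"
      proof -
        have "(y \<ominus>\<^bsub>M\<^esub> z) \<oplus>\<^bsub>M\<^esub> (a \<odot>\<^bsub>M\<^esub> x \<oplus>\<^bsub>M\<^esub> z) = (a \<odot>\<^bsub>M\<^esub> x \<oplus>\<^bsub>M\<^esub> y) \<oplus>\<^bsub>M\<^esub> (\<ominus>\<^bsub>M\<^esub> z \<oplus>\<^bsub>M\<^esub> z)"
          using c ay x unfolding M.minus_eq by (simp add: smult_closed M.a_ac)
        then show ?thesis using c ay x by (simp add: smult_closed M.l_neg)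
      qed
      have zN: "a \<odot>\<^bsub>M\<^esub> x \<oplus>\<^bsub>M\<^esub> z \<in> N" using z lspan_least[OF insert.prems(2) Z] by blast
      have dN: "y \<ominus>\<^bsub>M\<^esub> z \<in> N"
        by (rule lsub_cancel[OF insert.prems(2) _ zN]) (use c u e in simp_all)
      have dX: "y \<ominus>\<^bsub>M\<^esub> z \<in> ?S E" using lsub_diff[OF lsub_lspan[OF E]] ay z by blast
      have "y \<ominus>\<^bsub>M\<^esub> z \<in> ?S ?Z"
        using dN dX Y(3) lspan_mono[of Y ?Z "carrier R" M] by blast
      from lsubD(4)[OF SZ this z(2)] show "u \<in> ?S ?Z" unfolding e[symmetric] .
    qed
    then have "?S ?Z = N" using lspan_least[OF insert.prems(2) Z] by blast
    then show ?case using Z Y(1) A(1) by (intro exI[of _ ?Z]) auto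
  qed
  then show ?thesis using that by blast
qed

section \<open>Quasicentral subrings\<close>

lemma opp_ring_simps [simp]:
  "carrier (opp_ring R) = carrier R" "\<zero>\<^bsub>opp_ring R\<^esub> = \<zero>\<^bsub>R\<^esub>" "\<one>\<^bsub>opp_ring R\<^esub> = \<one>\<^bsub>R\<^esub>"
  "ring.add (opp_ring R) = ring.add R" "x \<otimes>\<^bsub>opp_ring R\<^esub> y = y \<otimes>\<^bsub>R\<^esub> x"
  by (simp_all add: opp_ring_def)

lemma opp_ring_restrict: "opp_ring (R\<lparr>carrier := G\<rparr>) = (opp_ring R)\<lparr>carrier := G\<rparr>"
  by (simp add: opp_ring_def)

lemma (in ring) opp_ring_ring: "ring (opp_ring R)"
proof (rule ringI)
  show "abelian_group (opp_ring R)"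
    using l_neg by (intro abelian_groupI) (auto simp: a_ac intro!: bexI)
  show "Group.monoid (opp_ring R)"
    by (rule monoidI) (auto simp: m_assoc)
qed (auto simp: l_distr r_distr)

lemma (in ring) opp_ring_minus: "x \<in> carrier R \<Longrightarrow> \<ominus>\<^bsub>opp_ring R\<^esub> x = \<ominus> x"
proof -
  assume x: "x \<in> carrier R"
  note neg = l_neg[OF x]
  interpret opp: ring "opp_ring R" by (rule opp_ring_ring)
  show ?thesis using x neg by (intro opp.minus_equality) auto
qed

lemma (in ring) opp_subring:
  assumes "subring G R"
  shows "subring G (opp_ring R)"
proof -
  interpret opp: ring "opp_ring R" by (rule opp_ring_ring)
  note G = subringE[OF assms]
  show ?thesis
    using G by (intro opp.subringI) (auto simp: opp_ring_minus subset_iff)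
qed

text \<open>The formula of \<open>bimodule_gen\<close> for arbitrary ring records:
  \<open>opp_ring\<close> produces a record without scalar multiplication, to which
  \<open>bimodule_gen\<close> cannot be applied.\<close>

definition bimod :: "('r, 'c) ring_scheme \<Rightarrow> 'r set \<Rightarrow> 'r \<Rightarrow> 'r set" where
  "bimod R G u = generate (add_monoid R) {a \<otimes>\<^bsub>R\<^esub> u \<otimes>\<^bsub>R\<^esub> b | a b. a \<in> G \<and> b \<in> G}"

lemma bimodule_gen_eq: "bimodule_gen U G u = bimod U G u"
  by (simp add: bimodule_gen_def bimod_def)

text \<open>\<open>G u G\<close> does not distinguish left from right, so right generation of this
  set becomes left generation of the same set over the opposite ring.\<close>

lemma (in ring) opp_bimod:
  assumes "G \<subseteq> carrier R" "u \<in> carrier R"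
  shows "bimod (opp_ring R) G u = bimod R G u"
proof -
  have "{b \<otimes> (u \<otimes> a) | a b. a \<in> G \<and> b \<in> G} = {a \<otimes> u \<otimes> b | a b. a \<in> G \<and> b \<in> G}"
  proof -
    have "b \<otimes> (u \<otimes> a) = b \<otimes> u \<otimes> a" if "a \<in> G" "b \<in> G" for a b
      using assms that by (simp add: subset_iff m_assoc)
    then have "(\<exists>a b. x = b \<otimes> (u \<otimes> a) \<and> a \<in> G \<and> b \<in> G) \<longleftrightarrow>
      (\<exists>b a. x = b \<otimes> u \<otimes> a \<and> b \<in> G \<and> a \<in> G)" for x
      by (subst ex_comm) (intro ex_cong1, auto)
    then show ?thesis by (intro Collect_cong)
  qed
  moreover have "generate (add_monoid (opp_ring R)) H = generate (add_monoid R) H"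
    if H: "H \<subseteq> carrier R" for H
  proof -
    have opp_inv: "inv\<^bsub>add_monoid (opp_ring R)\<^esub> h = inv\<^bsub>add_monoid R\<^esub> h" if "h \<in> H" for h
      using opp_ring_minus[of h] H that by (auto simp: a_inv_def)
    have "x \<in> generate (add_monoid R) H" if "x \<in> generate (add_monoid (opp_ring R)) H" for x
      using that
    proof (induction rule: generate.induct)
      case (eng x y)
      then show ?case using generate.eng[of x "add_monoid R" H y] by simp
    qed (use opp_inv generate.incl[of _ H "add_monoid R"] generate.inv[of _ H "add_monoid R"] generate.one[of "add_monoid R" H] in auto)
    moreover have "x \<in> generate (add_monoid (opp_ring R)) H" if "x \<in> generate (add_monoid R) H" for x
      using that
    proof (induction rule: generate.induct)
      case (inv h)
      then show ?case using generate.inv[of h H "add_monoid (opp_ring R)"] opp_inv by simp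
    next
      case (eng x y)
      then show ?case using generate.eng[of x "add_monoid (opp_ring R)" H y] by simp
    qed (use generate.incl[of _ H "add_monoid (opp_ring R)"] generate.one[of "add_monoid (opp_ring R)" H] in auto)
    ultimately show ?thesis by blast
  qed
  moreover have "{a \<otimes> u \<otimes> b | a b. a \<in> G \<and> b \<in> G} \<subseteq> carrier R"
    using assms by auto
  ultimately show ?thesis unfolding bimod_def by simp
qed

section \<open>Bimodules generated by one element\<close>

context ring
begin

context
  fixes G u
  assumes G: "subring G R" and u: "u \<in> carrier R"
begin

lemma bimod_gen: "a \<in> G \<Longrightarrow> b \<in> G \<Longrightarrow> a \<otimes> u \<otimes> b \<in> bimod R G u"
  unfolding bimod_def by (intro generate.incl) blast

lemma bimod_subset: "bimod R G u \<subseteq> carrier R"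
  unfolding bimod_def using add.generate_incl[of "{a \<otimes> u \<otimes> b | a b. a \<in> G \<and> b \<in> G}"]
    subringE(1)[OF G] u by auto

lemma bimod_induct [consumes 1, case_names gen minus zero add]:
  assumes "x \<in> bimod R G u"
    and "\<And>a b. a \<in> G \<Longrightarrow> b \<in> G \<Longrightarrow> P (a \<otimes> u \<otimes> b)"
    and "\<And>x. x \<in> bimod R G u \<Longrightarrow> P x \<Longrightarrow> P (\<ominus> x)"
    and "P \<zero>"
    and "\<And>x y. x \<in> bimod R G u \<Longrightarrow> y \<in> bimod R G u \<Longrightarrow> P x \<Longrightarrow> P y \<Longrightarrow> P (x \<oplus> y)"
  shows "P x"
  using assms(1) unfolding bimod_def
proof (induction rule: generate.induct)
  case (inv h)
  then show ?case using assms(2) assms(3)[of h] bimod_gen by (auto simp: a_inv_def)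
next
  case (eng h1 h2)
  then show ?case using assms(5)[of h1 h2] by (simp add: bimod_def)
qed (use assms in auto)

lemma bimod_add: "x \<in> bimod R G u \<Longrightarrow> y \<in> bimod R G u \<Longrightarrow> x \<oplus> y \<in> bimod R G u"
  unfolding bimod_def using generate.eng[of x "add_monoid R" _ y] by simp

lemma bimod_zero: "\<zero> \<in> bimod R G u"
  unfolding bimod_def using generate.one[of "add_monoid R"] by simp

lemma bimod_minus: "x \<in> bimod R G u \<Longrightarrow> \<ominus> x \<in> bimod R G u"
  using u subringE(1)[OF G] add.generate_m_inv_closed[of "{a \<otimes> u \<otimes> b | a b. a \<in> G \<and> b \<in> G}" x]
  unfolding bimod_def by auto

lemma bimod_mult:
  assumes "x \<in> bimod R G u" "g \<in> G"
  shows "g \<otimes> x \<in> bimod R G u" "x \<otimes> g \<in> bimod R G u"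
proof -
  note g = subringE(1)[OF G, THEN subsetD] subringE(6)[OF G]
  have "g \<otimes> x \<in> bimod R G u \<and> x \<otimes> g \<in> bimod R G u"
    using assms(1)
  proof (induction rule: bimod_induct)
    case (gen a b)
    have "g \<otimes> (a \<otimes> u \<otimes> b) = (g \<otimes> a) \<otimes> u \<otimes> b" "(a \<otimes> u \<otimes> b) \<otimes> g = a \<otimes> u \<otimes> (b \<otimes> g)"
      using gen g(1) assms(2) u by (auto simp: m_assoc)
    then show ?case using bimod_gen g(2) gen assms(2) by auto
  next
    case (minus x)
    then show ?case
      using bimod_minus bimod_subset g(1)[OF assms(2)] by (auto simp: r_minus l_minus subset_iff)
  next
    case zero
    then show ?case using bimod_zero g(1)[OF assms(2)] by simp
  next
    case (add x y)
    then show ?case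
      using bimod_add bimod_subset g(1)[OF assms(2)] by (auto simp: r_distr l_distr subset_iff)
  qed
  then show "g \<otimes> x \<in> bimod R G u" "x \<otimes> g \<in> bimod R G u" by auto
qed

lemma lsub_bimod: "lsub G (left_regular R) (bimod R G u)"
  using bimod_subset bimod_zero bimod_add bimod_mult by (auto intro!: lsubI)

lemma bimod_least:
  assumes D: "lsub G (left_regular R) D" and gen: "\<And>a b. a \<in> G \<Longrightarrow> b \<in> G \<Longrightarrow> a \<otimes> u \<otimes> b \<in> D"
  shows "bimod R G u \<subseteq> D"
proof
  fix x assume "x \<in> bimod R G u"
  then show "x \<in> D"
  proof (induction rule: bimod_induct)
    case (minus x)
    \<comment> \<open>Negatives are multiples by \<open>\<ominus> \<one>\<close>, which lies in
      \<open>G\<close>.\<close>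
    then have "\<ominus> x = (\<ominus> \<one>) \<otimes> x" using bimod_subset by (auto simp: l_minus)
    then show ?case using lsubD(5)[OF D] minus(2) subringE(3,5)[OF G] by simp
  qed (use lsubD[OF D] gen in auto)
qed

lemma bimod_self: "u \<in> bimod R G u"
  using bimod_gen[OF subringE(3)[OF G] subringE(3)[OF G]] u by simp

end

lemma lsub_mult_right_preimage:
  assumes "subring G R" "lsub G (left_regular R) D" "t \<in> carrier R"
  shows "lsub G (left_regular R) {w \<in> carrier R. w \<otimes> t \<in> D}"
proof -
  interpret RG: left_module "R\<lparr>carrier := G\<rparr>" "left_regular R"
    by (intro left_module.subring_left_module left_regular_module assms)
  show ?thesis
    using lsub_preimage[OF RG.left_module_axioms RG.left_module_axioms, of D "carrier R" "\<lambda>w. w \<otimes> t"]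
      RG.lsub_carrier assms subringE(1)[OF assms(1)] by (simp add: l_distr m_assoc subset_iff)
qed

text \<open>Since \<open>L\<close> is the sum of the \<open>G t\<close>, the set \<open>u L\<close>
  lies in the sum of the \<open>(G u G) t\<close>; so \<open>L u L\<close> is generated over
  \<open>L\<close> by the products \<open>v t\<close>.\<close>

lemma bimod_fg_extend:
  assumes G: "subring G R" and L: "subring L R" and GL: "G \<subseteq> L" and u: "u \<in> carrier R"
    and T: "finite T" "T \<subseteq> L" "lspan G (left_regular R) T = L"
    and V: "finite V" "V \<subseteq> bimod R G u" "lspan G (left_regular R) V = bimod R G u"
  shows "\<exists>E. finite E \<and> E \<subseteq> bimod R L u \<and> lspan L (left_regular R) E = bimod R L u"
proof -
  let ?E = "(\<lambda>(v, t). v \<otimes> t) ` (V \<times> T)"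
  interpret RL: left_module "R\<lparr>carrier := L\<rparr>" "left_regular R"
    by (intro left_module.subring_left_module left_regular_module L)
  note Gs = subringE[OF G] and Ls = subringE[OF L]
  have GLu: "bimod R G u \<subseteq> bimod R L u"
    using lsub_mono[OF lsub_bimod[OF L u] GL] GL
    by (intro bimod_least[OF G u]) (auto intro: bimod_gen[OF L u])
  have E: "?E \<subseteq> bimod R L u"
    using V(2) T(2) GLu by (auto intro!: bimod_mult(2)[OF L u])
  then have Ec: "?E \<subseteq> carrier R" using bimod_subset[OF L u] by auto
  let ?D = "lspan L (left_regular R) ?E"
  have D: "lsub L (left_regular R) ?D"
    using RL.lsub_lspan[of ?E] Ec by simp
  have 1: "w \<otimes> t \<in> ?D" if w: "w \<in> bimod R G u" and t: "t \<in> T" for w t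
  proof -
    have tc: "t \<in> carrier R" using t T(2) Ls(1) by blast
    have "lsub G (left_regular R) {w \<in> carrier R. w \<otimes> t \<in> ?D}"
      by (rule lsub_mult_right_preimage[OF G lsub_mono[OF D GL] tc])
    moreover have "V \<subseteq> {w \<in> carrier R. w \<otimes> t \<in> ?D}"
      using V(2) bimod_subset[OF G u] t lspan_superset[of ?E L "left_regular R"] by auto
    ultimately show ?thesis using lspan_least V(3) w by blast
  qed
  have 2: "w \<otimes> b \<in> ?D" if w: "w \<in> bimod R G u" and b: "b \<in> L" for w b
  proof -
    \<comment> \<open>All \<open>w\<close> are quantified inside the set, because multiplying
      \<open>b\<close> on the left by an element \<open>a\<close> of \<open>G\<close> is absorbed by
      replacing \<open>w\<close> with \<open>w \<otimes> a\<close>, which is again in the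
      bimodule.\<close>
    have "lsub G (left_regular R) {b \<in> L. \<forall>w \<in> bimod R G u. w \<otimes> b \<in> ?D}"
    proof (rule lsubI, goal_cases)
      case (4 a b)
      have "w \<otimes> (a \<otimes> b) = (w \<otimes> a) \<otimes> b" if "w \<in> bimod R G u" for w
        using that bimod_subset[OF G u] 4 Gs(1) Ls(1) by (auto simp: m_assoc subset_iff)
      then show ?case using 4 bimod_mult(2)[OF G u] GL Ls(6) by auto
    next
      case (3 x y)
      then show ?case using lsubD(4)[OF D] Ls bimod_subset[OF G u] by (auto simp: r_distr subset_iff)
    next
      case 2
      then show ?case using lsubD(3)[OF D] Ls bimod_subset[OF G u] by (auto simp: subset_iff)
    qed (use Ls in auto)
    moreover have "T \<subseteq> {b \<in> L. \<forall>w \<in> bimod R G u. w \<otimes> b \<in> ?D}" using 1 T(2) by auto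
    ultimately show ?thesis using lspan_least T(3) w b by blast
  qed
  have "bimod R L u \<subseteq> ?D"
  proof (rule bimod_least[OF L u D])
    fix a b assume "a \<in> L" "b \<in> L"
    moreover have "a \<otimes> u \<otimes> b = a \<otimes> (u \<otimes> b)" using Ls(1) \<open>a \<in> L\<close> \<open>b \<in> L\<close> u by (intro m_assoc) auto
    ultimately show "a \<otimes> u \<otimes> b \<in> ?D"
      using 2[OF bimod_self[OF G u]] lsubD(5)[OF D, of a "u \<otimes> b"] by simp
  qed
  moreover have "?D \<subseteq> bimod R L u" by (rule lspan_least[OF lsub_bimod[OF L u] E])
  ultimately show ?thesis using E V(1) T(1) by (intro exI[of _ ?E]) auto
qed

text \<open>\<open>L u L\<close> is the sum of the \<open>L v\<close>, hence of the
  \<open>G t v\<close>, and therefore finitely generated over \<open>G\<close>. The submodule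
  \<open>G u G\<close> is then finitely generated because \<open>G\<close> is Noetherian.\<close>

lemma bimod_fg_restrict:
  assumes G: "subring G R" and L: "subring L R" and GL: "G \<subseteq> L" and u: "u \<in> carrier R"
    and noeth: "left_noetherian (R\<lparr>carrier := G\<rparr>)"
    and T: "finite T" "T \<subseteq> L" "lspan G (left_regular R) T = L"
    and V: "finite V" "V \<subseteq> bimod R L u" "lspan L (left_regular R) V = bimod R L u"
  shows "\<exists>E. finite E \<and> E \<subseteq> bimod R G u \<and> lspan G (left_regular R) E = bimod R G u"
proof -
  let ?E = "(\<lambda>(t, v). t \<otimes> v) ` (T \<times> V)"
  interpret RG: left_module "R\<lparr>carrier := G\<rparr>" "left_regular R"
    by (intro left_module.subring_left_module left_regular_module G)
  note Gs = subringE[OF G] and Ls = subringE[OF L]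
  have Vc: "V \<subseteq> carrier R" using V(2) bimod_subset[OF L u] by auto
  have Ec: "?E \<subseteq> carrier R" using Vc T(2) Ls(1) by auto
  let ?D = "lspan G (left_regular R) ?E"
  have D: "lsub G (left_regular R) ?D" using RG.lsub_lspan[of ?E] Ec by simp
  have 1: "l \<otimes> v \<in> ?D" if v: "v \<in> V" and l: "l \<in> L" for l v
  proof -
    have vc: "v \<in> carrier R" using v Vc by auto
    have "lsub G (left_regular R) {l \<in> carrier R. l \<otimes> v \<in> ?D}"
      by (rule lsub_mult_right_preimage[OF G D vc])
    moreover have "T \<subseteq> {l \<in> carrier R. l \<otimes> v \<in> ?D}"
      using T(2) Ls(1) v lspan_superset[of ?E G "left_regular R"] by auto
    ultimately show ?thesis using lspan_least T(3) l by blast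
  qed
  \<comment> \<open>Quantifying over \<open>l\<close> makes the set closed under \<open>L\<close>,
    so that generators over \<open>L\<close> suffice; at the end \<open>l\<close> is taken to be
    1.\<close>
  have "lsub L (left_regular R) {w \<in> carrier R. \<forall>l\<in>L. l \<otimes> w \<in> ?D}"
  proof (rule lsubI, goal_cases)
    case (4 a w)
    have "l \<otimes> (a \<otimes> w) = (l \<otimes> a) \<otimes> w" if "l \<in> L" for l
      using that 4 Ls(1) by (auto simp: m_assoc subset_iff)
    then show ?case using 4 Ls(1,6) by auto
  next
    case (3 x y)
    then show ?case using lsubD(4)[OF D] Ls(1) by (auto simp: r_distr subset_iff)
  next
    case 2
    then show ?case using lsubD(3)[OF D] Ls(1) by (auto simp: subset_iff)
  qed auto
  moreover have "V \<subseteq> {w \<in> carrier R. \<forall>l\<in>L. l \<otimes> w \<in> ?D}" using 1 Vc by auto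
  ultimately have "bimod R L u \<subseteq> {w \<in> carrier R. \<forall>l\<in>L. l \<otimes> w \<in> ?D}"
    using lspan_least V(3) by blast
  moreover have "bimod R G u \<subseteq> bimod R L u"
    using lsub_mono[OF lsub_bimod[OF L u] GL] GL
    by (intro bimod_least[OF G u]) (auto intro: bimod_gen[OF L u])
  ultimately have "bimod R G u \<subseteq> ?D" using bimod_subset[OF G u] Ls(3) by fastforce
  then obtain Y where "finite Y" "Y \<subseteq> bimod R G u" "lspan G (left_regular R) Y = bimod R G u"
    using RG.noetherian_lsub_fg[OF noeth, of ?E "bimod R G u"] T(1) V(1) Ec lsub_bimod[OF G u] by auto
  then show ?thesis by blast
qed

lemma fin_gen_restrict_iff:
  assumes "subring G R" "lsub G (left_regular R) B"
  shows "fin_gen (R\<lparr>carrier := G\<rparr>) ((left_regular R)\<lparr>carrier := B\<rparr>) \<longleftrightarrow>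
    (\<exists>E. finite E \<and> E \<subseteq> B \<and> lspan G (left_regular R) E = B)"
proof -
  interpret RG: left_module "R\<lparr>carrier := G\<rparr>" "left_regular R"
    by (intro left_module.subring_left_module left_regular_module assms)
  show ?thesis using RG.fin_gen_iff[of B] assms by simp
qed

lemma lsub_subring:
  assumes "subring L R" "G \<subseteq> L" shows "lsub G (left_regular R) L"
  using subringE(1,2,6,7)[OF assms(1)] assms(2) unfolding lsub_def by auto

lemma fin_gen_bimod_iff:
  assumes G: "subring G R" and L: "subring L R" and GL: "G \<subseteq> L" and u: "u \<in> carrier R"
    and noeth: "left_noetherian (R\<lparr>carrier := G\<rparr>)"
    and fg: "fin_gen (R\<lparr>carrier := G\<rparr>) ((left_regular R)\<lparr>carrier := L\<rparr>)"
  shows "fin_gen (R\<lparr>carrier := L\<rparr>) ((left_regular R)\<lparr>carrier := bimod R L u\<rparr>) \<longleftrightarrow>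
    fin_gen (R\<lparr>carrier := G\<rparr>) ((left_regular R)\<lparr>carrier := bimod R G u\<rparr>)"
proof -
  obtain T where T: "finite T" "T \<subseteq> L" "lspan G (left_regular R) T = L"
    using fg fin_gen_restrict_iff[OF G lsub_subring[OF L GL]] by auto
  show ?thesis
    unfolding fin_gen_restrict_iff[OF G lsub_bimod[OF G u]] fin_gen_restrict_iff[OF L lsub_bimod[OF L u]]
    using bimod_fg_restrict[OF G L GL u noeth T] bimod_fg_extend[OF G L GL u T] by (intro iffI; elim exE conjE)
qed

end

text \<open>The right-hand equivalence is the left-hand one over the opposite ring, by
  \<open>opp_bimod\<close>.\<close>

lemma quasicentral_iff:
  assumes U: "ring U" and G: "subring G U" and L: "subring L U" and GL: "G \<subseteq> L"
    and noeth: "noetherian (U\<lparr>carrier := G\<rparr>)"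
    and fg: "fin_gen_left U G L" "fin_gen_right U G L"
  shows "quasicentral U L \<longleftrightarrow> quasicentral U G"
proof -
  interpret U: ring U by fact
  interpret opp: ring "opp_ring U" by (rule U.opp_ring_ring)
  note c = subringE(1)[OF G] subringE(1)[OF L]
  have "fin_gen_left U L (bimod U L u) \<longleftrightarrow> fin_gen_left U G (bimod U G u)" if u: "u \<in> carrier U" for u
    using U.fin_gen_bimod_iff[OF G L GL u] noeth fg(1)
    unfolding noetherian_def fin_gen_left_def by blast
  moreover have "fin_gen_right U L (bimod U L u) \<longleftrightarrow> fin_gen_right U G (bimod U G u)"
    if u: "u \<in> carrier U" for u
    using opp.fin_gen_bimod_iff[OF U.opp_subring[OF G] U.opp_subring[OF L] GL, of u] noeth fg(2) u
    unfolding noetherian_def fin_gen_right_def opp_ring_restrict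
      U.opp_bimod[OF c(1) u] U.opp_bimod[OF c(2) u] opp_ring_simps by blast
  ultimately show ?thesis unfolding quasicentral_def bimodule_gen_eq by blast
qed

section \<open>Modules of finite length\<close>

text \<open>Over a field acting through \<open>S\<close>, this says that \<open>V / W\<close> is finite dimensional.\<close>

definition flen :: "'r set \<Rightarrow> ('r, 'm) module \<Rightarrow> 'm set \<Rightarrow> 'm set \<Rightarrow> bool" where
  "flen S M W V \<longleftrightarrow> (\<exists>d :: 'm set \<Rightarrow> nat. \<forall>N N'.
     lsub S M N \<and> lsub S M N' \<and> W \<subseteq> N \<and> N \<subset> N' \<and> N' \<subseteq> V \<longrightarrow> d N < d N')"

definition lsum :: "('r, 'm) module \<Rightarrow> 'm set \<Rightarrow> 'm set \<Rightarrow> 'm set" where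
  "lsum M V W = {x \<oplus>\<^bsub>M\<^esub> y | x y. x \<in> V \<and> y \<in> W}"

lemma flenE:
  fixes M :: "('r, 'm) module"
  assumes "flen S M W V"
  obtains d :: "'m set \<Rightarrow> nat" where
    "\<And>N N'. lsub S M N \<Longrightarrow> lsub S M N' \<Longrightarrow> W \<subseteq> N \<Longrightarrow> N \<subset> N' \<Longrightarrow> N' \<subseteq> V \<Longrightarrow> d N < d N'"
proof -
  obtain d :: "'m set \<Rightarrow> nat" where
    "\<forall>N N'. lsub S M N \<and> lsub S M N' \<and> W \<subseteq> N \<and> N \<subset> N' \<and> N' \<subseteq> V \<longrightarrow> d N < d N'"
    using assms unfolding flen_def by (elim exE)
  then show thesis by (intro that[of d]) simp
qed

lemma flen_mono: "flen S M W V \<Longrightarrow> W \<subseteq> W' \<Longrightarrow> V' \<subseteq> V \<Longrightarrow> flen S M W' V'"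
  unfolding flen_def by (meson order_trans)

lemma flen_scalars_mono: "flen S M W V \<Longrightarrow> S \<subseteq> T \<Longrightarrow> flen T M W V"
  unfolding flen_def by (meson lsub_mono)

lemma flen_refl: "flen S M W W"
  unfolding flen_def by blast

text \<open>A submodule with \<open>P\<close> of least rank is minimal, as a strictly smaller one
  has strictly smaller rank.\<close>

lemma flen_minimal:
  assumes "flen S M W V" "\<exists>N. lsub S M N \<and> W \<subseteq> N \<and> N \<subseteq> V \<and> P N"
  obtains N where "lsub S M N" "W \<subseteq> N" "N \<subseteq> V" "P N"
    "\<And>N'. lsub S M N' \<Longrightarrow> W \<subseteq> N' \<Longrightarrow> N' \<subset> N \<Longrightarrow> \<not> P N'"
proof -
  obtain d where
    d: "\<And>N N'. lsub S M N \<Longrightarrow> lsub S M N' \<Longrightarrow> W \<subseteq> N \<Longrightarrow> N \<subset> N' \<Longrightarrow> N' \<subseteq> V \<Longrightarrow> d N < (d N' :: nat)"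
    using flenE[OF assms(1)] by metis
  let ?Q = "\<lambda>N. lsub S M N \<and> W \<subseteq> N \<and> N \<subseteq> V \<and> P N"
  obtain N0 where N0: "?Q N0" using assms(2) by (elim exE)
  obtain N where N': "?Q N \<and> (\<forall>N'. ?Q N' \<longrightarrow> d N \<le> d N')"
    using ex_has_least_nat[of ?Q N0 d, OF N0] by (elim exE)
  note N = conjunct1[OF N'] conjunct2[OF N', rule_format]
  show ?thesis
  proof (rule that)
    show "\<not> P N'" if "lsub S M N'" "W \<subseteq> N'" "N' \<subset> N" for N'
      using d[of N' N] N(2)[of N'] N(1) that by fastforce
  qed (use N(1) in auto)
qed

text \<open>Dually with greatest rank. Here \<open>V\<close> itself has to be a submodule: its rank
  is the bound that makes a greatest one exist.\<close>

lemma flen_maximal: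
  assumes "flen S M W V" "lsub S M V" "\<exists>N. lsub S M N \<and> W \<subseteq> N \<and> N \<subseteq> V \<and> P N"
  obtains N where "lsub S M N" "W \<subseteq> N" "N \<subseteq> V" "P N"
    "\<And>N'. lsub S M N' \<Longrightarrow> N \<subset> N' \<Longrightarrow> N' \<subseteq> V \<Longrightarrow> \<not> P N'"
proof -
  obtain d where
    d: "\<And>N N'. lsub S M N \<Longrightarrow> lsub S M N' \<Longrightarrow> W \<subseteq> N \<Longrightarrow> N \<subset> N' \<Longrightarrow> N' \<subseteq> V \<Longrightarrow> d N < (d N' :: nat)"
    using flenE[OF assms(1)] by metis
  have bound: "d N \<le> d V" if "lsub S M N" "W \<subseteq> N" "N \<subseteq> V" for N
    using d[of N V] that assms(2) by (cases "N = V") (auto simp: psubset_eq)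
  let ?Q = "\<lambda>N. lsub S M N \<and> W \<subseteq> N \<and> N \<subseteq> V \<and> P N"
  have "\<forall>N. ?Q N \<longrightarrow> d N < Suc (d V)" using bound by (auto simp: less_Suc_eq_le)
  note le = this
  obtain N0 where N0: "?Q N0" using assms(3) by (elim exE)
  obtain N where N': "?Q N \<and> (\<forall>N'. ?Q N' \<longrightarrow> d N' \<le> d N)"
    using ex_has_greatest_nat[of ?Q N0 d, OF N0 le] by (elim exE)
  note N = conjunct1[OF N'] conjunct2[OF N', rule_format]
  show ?thesis
  proof (rule that)
    show "\<not> P N'" if "lsub S M N'" "N \<subset> N'" "N' \<subseteq> V" for N'
      using d[of N N'] N(2)[of N'] N(1) that by fastforce
  qed (use N(1) in auto)
qed

context left_module
begin

lemma lsub_lsum: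
  assumes V: "lsub (carrier R) M V" and W: "lsub (carrier R) M W"
  shows "lsub (carrier R) M (lsum M V W)"
  unfolding lsum_def
proof (rule lsubI, goal_cases)
  case 1
  show ?case using lsubD(2)[OF V] lsubD(2)[OF W] by auto
next
  case 2
  show ?case using lsubD(3)[OF V] lsubD(3)[OF W] by (auto intro!: exI[of _ "\<zero>\<^bsub>M\<^esub>"])
next
  case (3 x y)
  then obtain a b c d where m: "a \<in> V" "b \<in> W" "c \<in> V" "d \<in> W"
    and e: "x = a \<oplus>\<^bsub>M\<^esub> b" "y = c \<oplus>\<^bsub>M\<^esub> d" by blast
  have "x \<oplus>\<^bsub>M\<^esub> y = (a \<oplus>\<^bsub>M\<^esub> c) \<oplus>\<^bsub>M\<^esub> (b \<oplus>\<^bsub>M\<^esub> d)"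
    using m lsubD(2)[OF V] lsubD(2)[OF W] unfolding e by (simp add: M.a_ac)
  then show ?case using m lsubD(4)[OF V] lsubD(4)[OF W] by blast
next
  case (4 a x)
  then obtain b c where m: "b \<in> V" "c \<in> W" and e: "x = b \<oplus>\<^bsub>M\<^esub> c" by blast
  have "a \<odot>\<^bsub>M\<^esub> x = a \<odot>\<^bsub>M\<^esub> b \<oplus>\<^bsub>M\<^esub> a \<odot>\<^bsub>M\<^esub> c"
    using m 4(1) lsubD(2)[OF V] lsubD(2)[OF W] unfolding e by (simp add: smult_r_distr)
  then show ?case using m 4(1) lsubD(5)[OF V] lsubD(5)[OF W] by blast
qed

lemma lsum_superset:
  assumes V: "lsub (carrier R) M V" and W: "lsub (carrier R) M W"
  shows "V \<subseteq> lsum M V W" "W \<subseteq> lsum M V W"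
proof -
  have "x = x \<oplus>\<^bsub>M\<^esub> \<zero>\<^bsub>M\<^esub>" if "x \<in> V" for x using that lsubD(2)[OF V] by simp
  then show "V \<subseteq> lsum M V W" using lsubD(3)[OF W] unfolding lsum_def by blast
  have "x = \<zero>\<^bsub>M\<^esub> \<oplus>\<^bsub>M\<^esub> x" if "x \<in> W" for x using that lsubD(2)[OF W] by simp
  then show "W \<subseteq> lsum M V W" using lsubD(3)[OF V] unfolding lsum_def by blast
qed

lemma lsub_add_cancel:
  assumes "lsub (carrier R) M N" "n \<in> N" "w \<in> carrier M" "n \<oplus>\<^bsub>M\<^esub> w \<in> N"
  shows "w \<in> N"
  using lsub_cancel[of N w n] assms lsubD(2)[OF assms(1)] by (simp add: M.a_comm)

text \<open>The rank of \<open>N\<close> is the rank of its trace on \<open>E\<close> plus the rank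
  of its sum with \<open>E\<close>. It increases strictly because, by the modular law, nested
  submodules with equal trace and equal sum coincide.\<close>

lemma flen_trans:
  assumes E: "lsub (carrier R) M E" "W \<subseteq> E" "E \<subseteq> V" and V: "lsub (carrier R) M V"
    and "flen (carrier R) M W E" "flen (carrier R) M E V"
  shows "flen (carrier R) M W V"
proof -
  let ?L = "lsub (carrier R) M"
  obtain d1 where
    d1: "\<And>N N'. ?L N \<Longrightarrow> ?L N' \<Longrightarrow> W \<subseteq> N \<Longrightarrow> N \<subset> N' \<Longrightarrow> N' \<subseteq> E \<Longrightarrow> d1 N < (d1 N' :: nat)"
    using flenE[OF assms(5)] by metis
  obtain d2 where
    d2: "\<And>N N'. ?L N \<Longrightarrow> ?L N' \<Longrightarrow> E \<subseteq> N \<Longrightarrow> N \<subset> N' \<Longrightarrow> N' \<subseteq> V \<Longrightarrow> d2 N < (d2 N' :: nat)"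
    using flenE[OF assms(6)] by metis
  have "d1 (N \<inter> E) + d2 (lsum M N E) < d1 (N' \<inter> E) + d2 (lsum M N' E)"
    if N: "?L N" "?L N'" "W \<subseteq> N" "N \<subset> N'" "N' \<subseteq> V" for N N'
  proof -
    have 1: "N \<inter> E \<subseteq> N' \<inter> E" "lsum M N E \<subseteq> lsum M N' E"
      using N(4) unfolding lsum_def by blast+
    have VE: "lsum M N' E \<subseteq> V" using N(5) E(3) lsubD(4)[OF V] unfolding lsum_def by blast
    have "\<not> (N \<inter> E = N' \<inter> E \<and> lsum M N E = lsum M N' E)"
    proof
      assume eq: "N \<inter> E = N' \<inter> E \<and> lsum M N E = lsum M N' E"
      have "N' \<subseteq> N"
      proof
        fix x assume x: "x \<in> N'"
        then have "x \<in> lsum M N E" using eq lsum_superset(1)[OF N(2) E(1)] by blast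
        then obtain n w where nw: "x = n \<oplus>\<^bsub>M\<^esub> w" "n \<in> N" "w \<in> E" unfolding lsum_def by blast
        then have "w \<in> N'"
          using lsub_add_cancel[OF N(2), of n w] x N(4) lsubD(2)[OF E(1)] by blast
        then have "w \<in> N" using eq nw(3) by blast
        then show "x \<in> N" using nw lsubD(4)[OF N(1)] by blast
      qed
      then show False using N(4) by blast
    qed
    then have "N \<inter> E \<subset> N' \<inter> E \<or> lsum M N E \<subset> lsum M N' E" using 1 by blast
    moreover have "d1 (N \<inter> E) < d1 (N' \<inter> E)" if "N \<inter> E \<subset> N' \<inter> E"
      using that N(3) E by (intro d1 lsub_Int N(1,2)) auto
    moreover have "d2 (lsum M N E) < d2 (lsum M N' E)" if "lsum M N E \<subset> lsum M N' E"
      using that lsum_superset(2)[OF N(1) E(1)] VE by (intro d2 lsub_lsum N(1,2) E(1)) auto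
    ultimately show ?thesis using 1 by (metis add_less_le_mono add_le_less_mono order_le_less
          psubsetI le_eq_less_or_eq)
  qed
  then show ?thesis unfolding flen_def by (intro exI[of _ "\<lambda>N. d1 (N \<inter> E) + d2 (lsum M N E)"]) blast
qed

text \<open>Submodules between \<open>V1\<close> and the sum are separated by their traces on
  \<open>V2\<close>, so the interval above \<open>V1\<close> inherits the rank of \<open>V2\<close>
  over \<open>W\<close>.\<close>

lemma flen_lsum:
  assumes V1: "lsub (carrier R) M V1" and V2: "lsub (carrier R) M V2"
    and W: "W \<subseteq> V1" "W \<subseteq> V2" "flen (carrier R) M W V1" "flen (carrier R) M W V2"
  shows "flen (carrier R) M W (lsum M V1 V2)"
proof (rule flen_trans[OF V1])
  let ?L = "lsub (carrier R) M"
  obtain d where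
    d: "\<And>N N'. ?L N \<Longrightarrow> ?L N' \<Longrightarrow> W \<subseteq> N \<Longrightarrow> N \<subset> N' \<Longrightarrow> N' \<subseteq> V2 \<Longrightarrow> d N < (d N' :: nat)"
    using flenE[OF W(4)] by metis
  have "d (N \<inter> V2) < d (N' \<inter> V2)"
    if N: "?L N" "?L N'" "V1 \<subseteq> N" "N \<subset> N'" "N' \<subseteq> lsum M V1 V2" for N N'
  proof (intro d lsub_Int N V2)
    obtain x where x: "x \<in> N'" "x \<notin> N" using N(4) by blast
    then obtain v w where vw: "x = v \<oplus>\<^bsub>M\<^esub> w" "v \<in> V1" "w \<in> V2" using N(5) unfolding lsum_def by blast
    then have "w \<in> N'" using lsub_add_cancel[OF N(2), of v w] x N(3,4) lsubD(2)[OF V2] by blast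
    moreover have "w \<notin> N" using vw x(2) N(3) lsubD(4)[OF N(1)] by blast
    ultimately show "N \<inter> V2 \<subset> N' \<inter> V2" using N(4) vw(3) by blast
  qed (use W N in auto)
  then show "flen (carrier R) M V1 (lsum M V1 V2)"
    unfolding flen_def by (intro exI[of _ "\<lambda>N. d (N \<inter> V2)"]) blast
qed (use assms lsub_lsum lsum_superset in auto)

text \<open>Over a division ring one more vector raises the dimension by at most one: of two
  strictly nested submodules above the old span, the larger contains some \<open>a v\<close> with
  \<open>a\<close> nonzero, hence \<open>v\<close>. The rank is therefore the indicator of the full
  span.\<close>

lemma flen_lspan_insert:
  assumes fld: "\<And>a. a \<in> carrier R \<Longrightarrow> a \<noteq> \<zero> \<Longrightarrow> \<exists>b\<in>carrier R. b \<otimes> a = \<one>"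
    and E: "E \<subseteq> carrier M" and v: "v \<in> carrier M"
  shows "flen (carrier R) M (lspan (carrier R) M E) (lspan (carrier R) M (insert v E))"
proof -
  let ?L = "lsub (carrier R) M" and ?S = "lspan (carrier R) M E"
  have "N' = lspan (carrier R) M (insert v E)"
    if N: "?L N" "?L N'" "?S \<subseteq> N" "N \<subset> N'" "N' \<subseteq> lspan (carrier R) M (insert v E)" for N N'
  proof -
    obtain x where x: "x \<in> N'" "x \<notin> N" using N(4) by blast
    then obtain a y where ay: "a \<in> carrier R" "y \<in> ?S" "x = a \<odot>\<^bsub>M\<^esub> v \<oplus>\<^bsub>M\<^esub> y"
      using N(5) lspan_insert[OF E v] by auto
    have y: "y \<in> N" "y \<in> N'" using ay N by auto
    have av: "a \<odot>\<^bsub>M\<^esub> v \<in> N'"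
      using lsub_cancel[OF N(2) _ y(2), of "a \<odot>\<^bsub>M\<^esub> v"] x(1) ay v smult_closed by blast
    have "a \<noteq> \<zero>" using x(2) y(1) ay v lsubD(2)[OF N(1)] by auto
    then obtain b where "b \<in> carrier R" "b \<otimes> a = \<one>" using fld ay(1) by blast
    then have "v \<in> N'"
      using lsubD(5)[OF N(2) _ av, of b] ay(1) v by (simp add: smult_assoc1[symmetric] smult_one)
    then have "insert v E \<subseteq> N'" using lspan_superset[of E "carrier R" M] N by blast
    then show ?thesis using lspan_least[OF N(2)] N(5) by blast
  qed
  then show ?thesis
    unfolding flen_def
    by (intro exI[of _ "\<lambda>N. if N = lspan (carrier R) M (insert v E) then 1 else 0"]) auto
qed

lemma flen_lspan:
  assumes fld: "\<And>a. a \<in> carrier R \<Longrightarrow> a \<noteq> \<zero> \<Longrightarrow> \<exists>b\<in>carrier R. b \<otimes> a = \<one>"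
    and W: "lsub (carrier R) M W" and "finite E" "E \<subseteq> carrier M"
  shows "flen (carrier R) M W (lspan (carrier R) M (E \<union> W))"
  using assms(3,4)
proof (induction E)
  case empty
  have "lspan (carrier R) M W = W" using lspan_least[OF W order_refl] lspan_superset[of W "carrier R" M] by blast
  then show ?case by (simp add: flen_refl)
next
  case (insert v E)
  let ?S = "lspan (carrier R) M"
  have c: "E \<union> W \<subseteq> carrier M" "insert v E \<union> W \<subseteq> carrier M" using insert lsubD(1)[OF W] by auto
  show ?case
  proof (rule flen_trans)
    show "lsub (carrier R) M (?S (E \<union> W))" "lsub (carrier R) M (?S (insert v E \<union> W))"
      using c by (auto intro!: lsub_lspan)
    show "W \<subseteq> ?S (E \<union> W)" using lspan_superset[of "E \<union> W" "carrier R" M] by blast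
    show "?S (E \<union> W) \<subseteq> ?S (insert v E \<union> W)" by (rule lspan_mono) auto
    show "flen (carrier R) M W (?S (E \<union> W))" using insert by blast
    show "flen (carrier R) M (?S (E \<union> W)) (?S (insert v E \<union> W))"
      using flen_lspan_insert[OF fld c(1), of v] insert.prems by simp
  qed
qed

text \<open>A submodule that is maximal among those generated over \<open>W\<close> by finitely many
  elements of \<open>V\<close> is all of \<open>V\<close>, since a missing vector could be added to
  its generators.\<close>

lemma flen_fin_gen:
  assumes fl: "flen (carrier R) M W V"
    and W: "lsub (carrier R) M W" and V: "lsub (carrier R) M V" "W \<subseteq> V"
  obtains E where "finite E" "E \<subseteq> V" "lspan (carrier R) M (E \<union> W) = V"
proof -
  let ?S = "lspan (carrier R) M"
  let ?P = "\<lambda>N. \<exists>E. finite E \<and> E \<subseteq> V \<and> ?S (E \<union> W) = N"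
  have c: "\<And>E. E \<subseteq> V \<Longrightarrow> E \<union> W \<subseteq> carrier M" using lsubD(1)[OF W] lsubD(1)[OF V(1)] by auto
  have "?S W = W" using lspan_least[OF W order_refl] lspan_superset[of W "carrier R" M] by blast
  then have "lsub (carrier R) M W \<and> W \<subseteq> W \<and> W \<subseteq> V \<and> ?P W"
    using W V(2) by (auto intro!: exI[of _ "{}"])
  then have ex: "\<exists>N. lsub (carrier R) M N \<and> W \<subseteq> N \<and> N \<subseteq> V \<and> ?P N" by blast
  obtain N where N: "lsub (carrier R) M N" "W \<subseteq> N" "N \<subseteq> V" "?P N"
    "\<And>N'. lsub (carrier R) M N' \<Longrightarrow> N \<subset> N' \<Longrightarrow> N' \<subseteq> V \<Longrightarrow> \<not> ?P N'"
    using flen_maximal[OF fl V(1) ex] by blast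
  obtain E where E: "finite E" "E \<subseteq> V" "?S (E \<union> W) = N" using N(4) by blast
  have "V \<subseteq> N"
  proof (rule ccontr)
    assume "\<not> V \<subseteq> N"
    then obtain v where v: "v \<in> V" "v \<notin> N" by blast
    let ?N = "?S (insert v E \<union> W)"
    have iv: "insert v E \<subseteq> V" using v E by blast
    have "lsub (carrier R) M ?N" using c[OF iv] by (rule lsub_lspan)
    moreover have "N \<subset> ?N"
      using v E lspan_mono[of "E \<union> W" "insert v E \<union> W" "carrier R" M]
        lspan_superset[of "insert v E \<union> W" "carrier R" M] by blast
    moreover have "?N \<subseteq> V" using lspan_least[OF V(1), of "insert v E \<union> W"] iv V(2) by blast
    ultimately have "\<not> ?P ?N" by (rule N(5))
    then show False using iv E(1) by blast
  qed
  then show ?thesis using that E N(3) by blast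
qed

end

section \<open>Finite length along linear maps\<close>

text \<open>The rank of \<open>N\<close> is that of \<open>h(N) + W'\<close>. Strict inclusions
  survive: if \<open>h x = h n + w\<close> with \<open>w\<close> in \<open>W'\<close>, then
  \<open>x - n\<close> lies in the preimage of \<open>W'\<close>, hence in \<open>N\<close>.\<close>

lemma flen_preimage:
  assumes MS: "left_module R M" and MS': "left_module R M'"
    and V: "lsub (carrier R) M V" and W': "lsub (carrier R) M' W'"
    and fl: "flen (carrier R) M' W' V'" and V': "W' \<subseteq> V'" "lsub (carrier R) M' V'"
    and h: "\<And>x. x \<in> V \<Longrightarrow> h x \<in> V'" "\<And>x y. x \<in> V \<Longrightarrow> y \<in> V \<Longrightarrow> h (x \<oplus>\<^bsub>M\<^esub> y) = h x \<oplus>\<^bsub>M'\<^esub> h y"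
      "\<And>a x. a \<in> carrier R \<Longrightarrow> x \<in> V \<Longrightarrow> h (a \<odot>\<^bsub>M\<^esub> x) = a \<odot>\<^bsub>M'\<^esub> h x"
  shows "flen (carrier R) M {x \<in> V. h x \<in> W'} V"
proof -
  interpret M: left_module R M by fact
  interpret M': left_module R M' by fact
  let ?L = "lsub (carrier R) M" and ?L' = "lsub (carrier R) M'"
  obtain d where
    d: "\<And>N N'. ?L' N \<Longrightarrow> ?L' N' \<Longrightarrow> W' \<subseteq> N \<Longrightarrow> N \<subset> N' \<Longrightarrow> N' \<subseteq> V' \<Longrightarrow> d N < (d N' :: nat)"
    using flenE[OF fl] by metis
  have im: "?L' (h ` N)" if N: "?L N" "N \<subseteq> V" for N
    using h lsubD(1)[OF V'(2)] N(2) by (intro lsub_image[OF MS MS' N(1)]) blast+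
  have "d (lsum M' (h ` N) W') < d (lsum M' (h ` N') W')"
    if N: "?L N" "?L N'" "{x \<in> V. h x \<in> W'} \<subseteq> N" "N \<subset> N'" "N' \<subseteq> V" for N N'
  proof (intro d M'.lsub_lsum im N W')
    show NV: "N \<subseteq> V" using N by blast
    show "W' \<subseteq> lsum M' (h ` N) W'" by (rule M'.lsum_superset(2)[OF im[OF N(1) NV] W'])
    show "lsum M' (h ` N') W' \<subseteq> V'"
      using h(1) N(5) V' lsubD(4)[OF V'(2)] unfolding lsum_def by blast
    have 1: "lsum M' (h ` N) W' \<subseteq> lsum M' (h ` N') W'" using N(4) unfolding lsum_def by blast
    obtain x where x: "x \<in> N'" "x \<notin> N" using N(4) by blast
    have "h x \<in> lsum M' (h ` N') W'"
      using M'.lsum_superset(1)[OF im[OF N(2,5)] W'] x(1) by blast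
    moreover have "h x \<notin> lsum M' (h ` N) W'"
    proof
      assume "h x \<in> lsum M' (h ` N) W'"
      then obtain n w where nw: "n \<in> N" "w \<in> W'" "h x = h n \<oplus>\<^bsub>M'\<^esub> w" unfolding lsum_def by blast
      have xV: "x \<in> V" "n \<in> V" using x nw NV N(5) by auto
      let ?y = "x \<ominus>\<^bsub>M\<^esub> n"
      have y: "?y \<in> V" by (rule M.lsub_diff[OF V xV])
      have e: "?y \<oplus>\<^bsub>M\<^esub> n = x"
        using xV lsubD(2)[OF V] by (simp add: M.minus_eq M.a_assoc M.M.l_neg)
      have c: "h ?y \<in> carrier M'" "h n \<in> carrier M'" "w \<in> carrier M'"
        using h(1)[OF y] h(1)[OF xV(2)] lsubD(2)[OF V'(2)] lsubD(2)[OF W'] nw(2) by auto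
      have "h n \<oplus>\<^bsub>M'\<^esub> h ?y = h n \<oplus>\<^bsub>M'\<^esub> w"
        using h(2)[OF y xV(2)] nw(3) e c by (simp add: M'.a_comm)
      then have "h ?y = w" using c by simp
      then have "?y \<in> N" using N(3) y nw(2) by blast
      then have "x \<in> N" using lsubD(4)[OF N(1) _ nw(1)] e by metis
      then show False using x by blast
    qed
    ultimately show "lsum M' (h ` N) W' \<subset> lsum M' (h ` N') W'" using 1 by blast
  qed
  then show ?thesis
    unfolding flen_def by (intro exI[of _ "\<lambda>N. d (lsum M' (h ` N) W')"]) blast
qed

text \<open>The rank of \<open>N\<close> is that of its preimage in \<open>V\<close>. If
  \<open>h v + w\<close> lies only in the larger of two submodules, then \<open>w\<close> belongs to
  both of them, so \<open>v\<close> separates the preimages.\<close>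

lemma flen_image:
  assumes M: "left_module R M" and M': "left_module R M'"
    and V: "lsub (carrier R) M V"
    and W': "lsub (carrier R) M' W'"
    and fl: "flen (carrier R) M W V" and W: "\<And>x. x \<in> W \<Longrightarrow> x \<in> V \<and> h x \<in> W'"
    and h: "\<And>x. x \<in> V \<Longrightarrow> h x \<in> carrier M'"
      "\<And>x y. x \<in> V \<Longrightarrow> y \<in> V \<Longrightarrow> h (x \<oplus>\<^bsub>M\<^esub> y) = h x \<oplus>\<^bsub>M'\<^esub> h y"
      "\<And>a x. a \<in> carrier R \<Longrightarrow> x \<in> V \<Longrightarrow> h (a \<odot>\<^bsub>M\<^esub> x) = a \<odot>\<^bsub>M'\<^esub> h x"
  shows "flen (carrier R) M' W' (lsum M' (h ` V) W')"
proof -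
  interpret M: left_module R M by fact
  interpret M': left_module R M' by fact
  let ?L = "lsub (carrier R) M" and ?L' = "lsub (carrier R) M'"
  obtain d where
    d: "\<And>N N'. ?L N \<Longrightarrow> ?L N' \<Longrightarrow> W \<subseteq> N \<Longrightarrow> N \<subset> N' \<Longrightarrow> N' \<subseteq> V \<Longrightarrow> d N < (d N' :: nat)"
    using flenE[OF fl] by metis
  have pre: "?L {x \<in> V. h x \<in> N}" if N: "?L' N" for N
    by (rule lsub_preimage[OF M M' N V h])
  have "d {x \<in> V. h x \<in> N} < d {x \<in> V. h x \<in> N'}"
    if N: "?L' N" "?L' N'" "W' \<subseteq> N" "N \<subset> N'" "N' \<subseteq> lsum M' (h ` V) W'" for N N'
  proof (intro d pre N)
    obtain x where x: "x \<in> N'" "x \<notin> N" using N(4) by blast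
    then obtain v w where vw: "x = h v \<oplus>\<^bsub>M'\<^esub> w" "v \<in> V" "w \<in> W'" using N(5) unfolding lsum_def by blast
    have w: "w \<in> N" "w \<in> N'" using vw(3) N(3,4) by auto
    have "h v \<in> N'" using M'.lsub_cancel[OF N(2) h(1)[OF vw(2)] w(2)] x(1) vw(1) by simp
    moreover have "h v \<notin> N" using lsubD(4)[OF N(1) _ w(1)] x(2) vw(1) by blast
    ultimately show "{x \<in> V. h x \<in> N} \<subset> {x \<in> V. h x \<in> N'}" using vw(2) N(4) by blast
  qed (use N(3) W in auto)
  then show ?thesis
    unfolding flen_def by (intro exI[of _ "\<lambda>N. d {x \<in> V. h x \<in> N}"]) blast
qed

section \<open>The cofinite spectrum\<close>

locale assoc_alg =
  fixes K :: "('k, 'c) ring_scheme" and A :: "('k, 'a) module" (structure)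
  assumes alg: "assoc_algebra K A"

sublocale assoc_alg \<subseteq> ring A
  using alg unfolding assoc_algebra_def by blast

text \<open>The copy of the field inside the algebra. The record of an \<open>A\<close>-module has
  no action of \<open>K\<close>; with scalars taken from \<open>A\<close>, every
  \<open>A\<close>-submodule is a subspace by \<open>lsub_mono\<close>.\<close>

definition scal :: "('k, 'c) ring_scheme \<Rightarrow> ('k, 'a) module \<Rightarrow> 'a set" where
  "scal K A = (\<lambda>c. c \<odot>\<^bsub>A\<^esub> \<one>\<^bsub>A\<^esub>) ` carrier K"

context ring
begin

lemma lsub_abelian_subgroup:
  assumes "lsub (carrier R) (left_regular R) Y"
  shows "abelian_subgroup Y R"
proof (intro abelian_subgroupI3 abelian_group_axioms additive_subgroupI add.subgroupI)
  interpret left_module R "left_regular R" by (rule left_regular_module)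
  fix x assume "x \<in> Y"
  then show "\<ominus> x \<in> Y"
    using lsub_minus[OF assms] lsubD(2)[OF assms] left_regular_minus by auto
qed (use lsubD[OF assms] in auto)

lemma lsub_regular_diff:
  "lsub (carrier R) (left_regular R) Y \<Longrightarrow> x \<in> Y \<Longrightarrow> y \<in> Y \<Longrightarrow> x \<ominus> y \<in> Y"
  using left_module.lsub_diff[OF left_regular_module, of Y x y] lsubD(2)[of "carrier R" "left_regular R" Y]
  by (auto simp: left_regular_diff)

lemma ideal_lsub: "ideal I R \<Longrightarrow> lsub (carrier R) (left_regular R) I"
  by (auto intro!: lsubI simp: ideal.I_l_closed ideal.Icarr additive_subgroup.a_closed
      additive_subgroup.zero_closed ideal.axioms)

lemma lsub_idealI:
  assumes "lsub (carrier R) (left_regular R) I" "\<And>a x. a \<in> I \<Longrightarrow> x \<in> carrier R \<Longrightarrow> a \<otimes> x \<in> I"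
  shows "ideal I R"
  using lsub_abelian_subgroup[OF assms(1)] assms(2) lsubD(5)[OF assms(1)]
  by (intro idealI ring_axioms) (auto dest: additive_subgroup.a_subgroup abelian_subgroup.axioms)

context
  fixes Y assumes Y: "abelian_subgroup Y R"
begin

lemma mem_coset_iff:
  assumes "x \<in> carrier R"
  shows "u \<in> Y +> x \<longleftrightarrow> u \<in> carrier R \<and> u \<ominus> x \<in> Y"
proof -
  interpret abelian_subgroup Y R by (rule Y)
  show ?thesis
  proof
    assume "u \<in> Y +> x"
    then obtain y where y: "y \<in> Y" "u = y \<oplus> x" unfolding a_r_coset_def' by blast
    then have "u \<ominus> x = y" using assms a_Hcarr by (simp add: minus_eq a_assoc r_neg)
    then show "u \<in> carrier R \<and> u \<ominus> x \<in> Y" using y assms a_Hcarr by simp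
  next
    assume u: "u \<in> carrier R \<and> u \<ominus> x \<in> Y"
    then have "u = (u \<ominus> x) \<oplus> x" using assms by (simp add: minus_eq a_assoc l_neg)
    then show "u \<in> Y +> x" using u unfolding a_r_coset_def' by blast
  qed
qed

lemma coset_eq_iff:
  assumes "x \<in> carrier R" "y \<in> carrier R"
  shows "Y +> x = Y +> y \<longleftrightarrow> x \<ominus> y \<in> Y"
proof -
  interpret abelian_subgroup Y R by (rule Y)
  show ?thesis
    using mem_coset_iff[OF assms(2), of x] a_rcos_self[OF assms(1)] a_repr_independence'[of x y] assms
    by auto
qed

lemma coset_eq_self_iff: "x \<in> carrier R \<Longrightarrow> Y +> x = Y \<longleftrightarrow> x \<in> Y"
  using coset_eq_iff[of x \<zero>] additive_subgroup.a_subset[OF abelian_subgroup.axioms(1)[OF Y]]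
    a_coset_add_zero[of Y] by (simp add: minus_eq)

end

end

context assoc_alg
begin

lemma fieldK: "field K" and moduleK: "module K A"
  using alg unfolding assoc_algebra_def by blast+

lemma smult_mult:
  assumes "c \<in> carrier K" "x \<in> carrier A" "y \<in> carrier A"
  shows "(c \<odot>\<^bsub>A\<^esub> x) \<otimes> y = c \<odot>\<^bsub>A\<^esub> (x \<otimes> y)" "x \<otimes> (c \<odot>\<^bsub>A\<^esub> y) = c \<odot>\<^bsub>A\<^esub> (x \<otimes> y)"
  using alg assms unfolding assoc_algebra_def by blast+

lemmas K_smult_closed = module.smult_closed[OF moduleK]

lemma scal_mult:
  assumes "c \<in> carrier K" "x \<in> carrier A"
  shows "(c \<odot>\<^bsub>A\<^esub> \<one>) \<otimes> x = c \<odot>\<^bsub>A\<^esub> x" "x \<otimes> (c \<odot>\<^bsub>A\<^esub> \<one>) = c \<odot>\<^bsub>A\<^esub> x"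
  using smult_mult[of c \<one> x] smult_mult[of c x \<one>] assms by auto

lemma scal_central: "f \<in> scal K A \<Longrightarrow> x \<in> carrier A \<Longrightarrow> f \<otimes> x = x \<otimes> f"
  unfolding scal_def by (auto simp: scal_mult)

lemma scal_subset: "scal K A \<subseteq> carrier A"
  unfolding scal_def using K_smult_closed by auto

lemma subring_scal: "subring (scal K A) A"
proof -
  interpret K: field K by (rule fieldK)
  interpret KA: module K A by (rule moduleK)
  show ?thesis
  proof (rule subringI)
    show "\<one> \<in> scal K A" unfolding scal_def using KA.smult_one[of \<one>] by force
    show "\<ominus> h \<in> scal K A" if h: "h \<in> scal K A" for h
    proof -
      obtain c where c: "c \<in> carrier K" "h = c \<odot>\<^bsub>A\<^esub> \<one>" using h unfolding scal_def by blast
      then have "\<ominus> h = (\<ominus>\<^bsub>K\<^esub> c) \<odot>\<^bsub>A\<^esub> \<one>" using KA.smult_l_minus[of c \<one>] by simp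
      then show ?thesis using c unfolding scal_def by blast
    qed
    show "a \<otimes> b \<in> scal K A" "a \<oplus> b \<in> scal K A" if ab: "a \<in> scal K A" "b \<in> scal K A" for a b
    proof -
      obtain c d where c: "c \<in> carrier K" "a = c \<odot>\<^bsub>A\<^esub> \<one>" "d \<in> carrier K" "b = d \<odot>\<^bsub>A\<^esub> \<one>"
        using ab unfolding scal_def by blast
      then have "a \<otimes> b = (c \<otimes>\<^bsub>K\<^esub> d) \<odot>\<^bsub>A\<^esub> \<one>" "a \<oplus> b = (c \<oplus>\<^bsub>K\<^esub> d) \<odot>\<^bsub>A\<^esub> \<one>"
        by (simp_all add: scal_mult(1) KA.smult_assoc1 KA.smult_l_distr)
      then show "a \<otimes> b \<in> scal K A" "a \<oplus> b \<in> scal K A" using c unfolding scal_def by blast+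
    qed
  qed (rule scal_subset)
qed

lemma scal_inverse:
  assumes "a \<in> scal K A" "a \<noteq> \<zero>"
  shows "\<exists>b\<in>scal K A. b \<otimes> a = \<one>"
proof -
  interpret K: field K by (rule fieldK)
  interpret KA: module K A by (rule moduleK)
  obtain c where c: "c \<in> carrier K" "a = c \<odot>\<^bsub>A\<^esub> \<one>" using assms(1) unfolding scal_def by blast
  then have "c \<noteq> \<zero>\<^bsub>K\<^esub>" using assms(2) KA.smult_l_null[of \<one>] by auto
  then have inv: "inv\<^bsub>K\<^esub> c \<in> carrier K" "inv\<^bsub>K\<^esub> c \<otimes>\<^bsub>K\<^esub> c = \<one>\<^bsub>K\<^esub>"
    using c K.field_Units by auto
  then have "(inv\<^bsub>K\<^esub> c \<odot>\<^bsub>A\<^esub> \<one>) \<otimes> a = (inv\<^bsub>K\<^esub> c \<otimes>\<^bsub>K\<^esub> c) \<odot>\<^bsub>A\<^esub> \<one>"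
    using c inv(1) by (simp add: scal_mult(1) KA.smult_assoc1[symmetric])
  then have "(inv\<^bsub>K\<^esub> c \<odot>\<^bsub>A\<^esub> \<one>) \<otimes> a = \<one>" using inv by simp
  then show ?thesis using inv(1) unfolding scal_def by blast
qed

lemma lsub_scal_iff:
  "lsub (scal K A) (left_regular A) V \<longleftrightarrow> V \<subseteq> carrier A \<and> \<zero> \<in> V \<and>
    (\<forall>x\<in>V. \<forall>y\<in>V. x \<oplus> y \<in> V) \<and> (\<forall>c\<in>carrier K. \<forall>x\<in>V. c \<odot>\<^bsub>A\<^esub> x \<in> V)"
  unfolding lsub_def scal_def by (auto simp: scal_mult subset_iff)

lemma scal_left_module:
  "left_module A M \<Longrightarrow> left_module (A\<lparr>carrier := scal K A\<rparr>) M"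
  using left_module.subring_left_module subring_scal by blast

lemma quot_module_left_module:
  assumes m: "ideal m A"
  shows "left_module K (quot_module A m)"
    and "c \<in> carrier K \<Longrightarrow> x \<in> carrier A \<Longrightarrow> c \<odot>\<^bsub>quot_module A m\<^esub> (m +> x) = m +> (c \<odot>\<^bsub>A\<^esub> x)"
proof -
  interpret K: field K by (rule fieldK)
  interpret KA: module K A by (rule moduleK)
  interpret m: ideal m A by (rule m)
  have carr: "carrier (quot_module A m) = {m +> x | x. x \<in> carrier A}"
    unfolding quot_module_def A_RCOSETS_def' by auto
  have sm: "c \<odot>\<^bsub>quot_module A m\<^esub> (m +> x) = m +> (c \<odot>\<^bsub>A\<^esub> x)"
    if c: "c \<in> carrier K" and x: "x \<in> carrier A" for c x
  proof -
    \<comment> \<open>The scalar action on cosets is defined as a union over representatives. All of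
      them yield the same coset, so the union is that coset.\<close>
    have "m +> (c \<odot>\<^bsub>A\<^esub> y) = m +> (c \<odot>\<^bsub>A\<^esub> x)" if y: "y \<in> m +> x" for y
    proof -
      have yx: "y \<in> carrier A" "y \<ominus> x \<in> m" using y mem_coset_iff[OF m.abelian_subgroup_axioms x] by auto
      have "c \<odot>\<^bsub>A\<^esub> y \<ominus> c \<odot>\<^bsub>A\<^esub> x = c \<odot>\<^bsub>A\<^esub> (y \<ominus> x)"
        unfolding minus_eq KA.smult_r_minus[OF c x, symmetric]
        by (rule KA.smult_r_distr[symmetric]) (use c x yx in auto)
      also have "\<dots> = (c \<odot>\<^bsub>A\<^esub> \<one>) \<otimes> (y \<ominus> x)"
        by (rule scal_mult(1)[symmetric]) (use c x yx in auto)
      finally have "c \<odot>\<^bsub>A\<^esub> y \<ominus> c \<odot>\<^bsub>A\<^esub> x \<in> m" using m.I_l_closed[OF yx(2), of "c \<odot>\<^bsub>A\<^esub> \<one>"] c by simp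
      then show ?thesis using coset_eq_iff[OF m.abelian_subgroup_axioms] c yx x by simp
    qed
    moreover have "x \<in> m +> x" using x by (rule m.a_rcos_self)
    ultimately have "(\<Union>y\<in>m +> x. m +> (c \<odot>\<^bsub>A\<^esub> y)) = m +> (c \<odot>\<^bsub>A\<^esub> x)" by (intro equalityI UN_least) blast+
    then show ?thesis by (simp add: quot_module_def)
  qed
  have add: "(m +> x) \<oplus>\<^bsub>quot_module A m\<^esub> (m +> y) = m +> (x \<oplus> y)"
    if "x \<in> carrier A" "y \<in> carrier A" for x y
    using that by (simp add: quot_module_def m.a_rcos_sum)
  have zero: "\<zero>\<^bsub>quot_module A m\<^esub> = m +> \<zero>"
    using a_coset_add_zero[OF m.a_subset] by (simp add: quot_module_def)
  have "abelian_group (quot_module A m)"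
  proof (rule abelian_groupI)
    fix x assume "x \<in> carrier (quot_module A m)"
    then obtain u where u: "x = m +> u" "u \<in> carrier A" unfolding carr by blast
    then have "(m +> (\<ominus> u)) \<oplus>\<^bsub>quot_module A m\<^esub> x = \<zero>\<^bsub>quot_module A m\<^esub>"
      unfolding zero by (simp add: add l_neg)
    then show "\<exists>y\<in>carrier (quot_module A m). y \<oplus>\<^bsub>quot_module A m\<^esub> x = \<zero>\<^bsub>quot_module A m\<^esub>"
      using u unfolding carr by blast
  qed (auto simp: carr add zero a_ac)
  moreover have "left_module_axioms K (quot_module A m)"
    by standard (auto simp: carr add sm KA.smult_l_distr KA.smult_r_distr KA.smult_assoc1)
  ultimately show "left_module K (quot_module A m)" by (intro left_module.intro K.ring_axioms)
  show "c \<in> carrier K \<Longrightarrow> x \<in> carrier A \<Longrightarrow> c \<odot>\<^bsub>quot_module A m\<^esub> (m +> x) = m +> (c \<odot>\<^bsub>A\<^esub> x)"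
    by (rule sm)
qed

text \<open>Generators of the quotient lift to representatives \<open>E\<close>, and
  \<open>E \<union> m\<close> spans \<open>A\<close> over the field. The two directions are
  \<open>flen_lspan\<close> and \<open>flen_fin_gen\<close>.\<close>

lemma fin_gen_quot_module_iff:
  assumes m: "ideal m A"
  shows "fin_gen K (quot_module A m) \<longleftrightarrow> flen (scal K A) (left_regular A) m (carrier A)"
proof -
  let ?Q = "quot_module A m" and ?F = "scal K A" and ?A = "left_regular A"
  interpret K: field K by (rule fieldK)
  interpret KA: module K A by (rule moduleK)
  interpret m: ideal m A by (rule m)
  interpret Q: left_module K ?Q by (rule quot_module_left_module[OF m])
  interpret FA: left_module "A\<lparr>carrier := ?F\<rparr>" ?A by (rule scal_left_module[OF left_regular_module])
  note Fm = lsub_mono[OF ideal_lsub[OF m] scal_subset]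
  have carr: "carrier ?Q = {m +> x | x. x \<in> carrier A}"
    unfolding quot_module_def A_RCOSETS_def' by auto
  have add: "(m +> x) \<oplus>\<^bsub>?Q\<^esub> (m +> y) = m +> (x \<oplus> y)" if "x \<in> carrier A" "y \<in> carrier A" for x y
    using that by (simp add: quot_module_def m.a_rcos_sum)
  have zero: "\<zero>\<^bsub>?Q\<^esub> = m" by (simp add: quot_module_def)
  note sm = quot_module_left_module(2)[OF m]
  note ceq = coset_eq_iff[OF m.abelian_subgroup_axioms] coset_eq_self_iff[OF m.abelian_subgroup_axioms]
  have FAc: "lsub ?F ?A (carrier A)" using FA.lsub_carrier by simp
  show ?thesis
  proof
    assume "fin_gen K ?Q"
    then obtain B where B: "finite B" "B \<subseteq> carrier ?Q" "\<And>N. lsub (carrier K) ?Q N \<Longrightarrow> B \<subseteq> N \<Longrightarrow> N = carrier ?Q"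
      unfolding fin_gen_def Q.submodule_iff_lsub by blast
    have "B \<subseteq> (\<lambda>x. m +> x) ` carrier A" using B(2) carr by blast
    then obtain E where E: "finite E" "E \<subseteq> carrier A" "B = (\<lambda>x. m +> x) ` E"
      using finite_subset_image[OF B(1)] by metis
    let ?V = "lspan ?F ?A (E \<union> m)"
    have Vs: "E \<union> m \<subseteq> ?V" by (rule lspan_superset)
    have "lsub (scal K A) ?A ?V" using FA.lsub_lspan[of "E \<union> m"] E(2) m.a_subset by simp
    then have V: "?V \<subseteq> carrier A" "\<zero> \<in> ?V" "\<And>x y. x \<in> ?V \<Longrightarrow> y \<in> ?V \<Longrightarrow> x \<oplus> y \<in> ?V"
      "\<And>c x. c \<in> carrier K \<Longrightarrow> x \<in> ?V \<Longrightarrow> c \<odot>\<^bsub>A\<^esub> x \<in> ?V" unfolding lsub_scal_iff by auto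
    have "lsub (carrier K) ?Q ((\<lambda>x. m +> x) ` ?V)"
    proof (rule lsubI, goal_cases)
      case 2
      show ?case using V(2) ceq(2)[of \<zero>] lsubD(3)[OF Fm] unfolding zero by (intro image_eqI[of _ _ \<zero>]) auto
    next
      case (3 x y)
      then obtain u v where "x = m +> u" "y = m +> v" "u \<in> ?V" "v \<in> ?V" by blast
      moreover then have "x \<oplus>\<^bsub>?Q\<^esub> y = m +> (u \<oplus> v)" using V(1) add by blast
      ultimately show ?case using V(3) by blast
    next
      case (4 c x)
      then obtain u where "x = m +> u" "u \<in> ?V" by blast
      moreover then have "c \<odot>\<^bsub>?Q\<^esub> x = m +> (c \<odot>\<^bsub>A\<^esub> u)" using V(1) 4 sm by blast
      ultimately show ?case using V(4) 4(1) by blast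
    qed (use V(1) carr in auto)
    moreover have "B \<subseteq> (\<lambda>x. m +> x) ` ?V" using E Vs by blast
    ultimately have eq: "(\<lambda>x. m +> x) ` ?V = carrier ?Q" by (rule B(3))
    have "carrier A \<subseteq> ?V"
    proof
      fix x assume x: "x \<in> carrier A"
      then have "m +> x \<in> (\<lambda>x. m +> x) ` ?V" unfolding eq carr by blast
      then obtain v where v: "v \<in> ?V" "m +> x = m +> v" by blast
      then have "x \<ominus> v \<in> ?V" using ceq(1)[OF x] V(1) Vs by blast
      moreover have "x = (x \<ominus> v) \<oplus> v" using x v V(1) by (auto simp: minus_eq a_assoc l_neg)
      ultimately show "x \<in> ?V" using V(3) v by metis
    qed
    then have "?V = carrier A" using V(1) by blast
    moreover have "flen ?F ?A m ?V"
      using FA.flen_lspan[OF _ _ E(1), of m] Fm E(2) scal_inverse by simp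
    ultimately show "flen ?F ?A m (carrier A)" by simp
  next
    assume fl: "flen ?F ?A m (carrier A)"
    obtain E where E: "finite E" "E \<subseteq> carrier A" "lspan ?F ?A (E \<union> m) = carrier A"
      using FA.flen_fin_gen[of m "carrier A"] fl Fm FAc m.a_subset by auto
    have "N = carrier ?Q" if N: "lsub (carrier K) ?Q N" "(\<lambda>x. m +> x) ` E \<subseteq> N" for N
    proof -
      have "lsub ?F ?A {x \<in> carrier A. m +> x \<in> N}"
        unfolding lsub_scal_iff
      proof (intro conjI ballI CollectI; (elim CollectE conjE)?)
        show "m +> \<zero> \<in> N" using lsubD(3)[OF N(1)] zero a_coset_add_zero[OF m.a_subset] by simp
        show "m +> (x \<oplus> y) \<in> N" if "x \<in> carrier A" "m +> x \<in> N" "y \<in> carrier A" "m +> y \<in> N" for x y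
          using lsubD(4)[OF N(1)] that add by metis
        show "m +> (c \<odot>\<^bsub>A\<^esub> x) \<in> N" if "c \<in> carrier K" "x \<in> carrier A" "m +> x \<in> N" for c x
          using lsubD(5)[OF N(1)] that sm by metis
      qed auto
      moreover have "E \<union> m \<subseteq> {x \<in> carrier A. m +> x \<in> N}"
      proof -
        have "m +> t \<in> N" if "t \<in> m" for t
          using that ceq(2)[OF m.a_Hcarr[OF that]] lsubD(3)[OF N(1)] zero by simp
        then show ?thesis using E(2) N(2) m.a_subset by auto
      qed
      ultimately have "carrier A \<subseteq> {x \<in> carrier A. m +> x \<in> N}" using lspan_least E(3) by metis
      then show ?thesis using lsubD(1)[OF N(1)] carr by auto
    qed
    then show "fin_gen K ?Q"
      unfolding fin_gen_def Q.submodule_iff_lsub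
      using E(1,2) carr by (intro exI[of _ "(\<lambda>x. m +> x) ` E"]) auto
  qed
qed

text \<open>In this form cofiniteness speaks of subspaces of \<open>A\<close> itself and the cosets
  disappear.\<close>

lemma cfs_iff:
  "m \<in> cfs K A \<longleftrightarrow> maximalideal m A \<and> flen (scal K A) (left_regular A) m (carrier A)"
  unfolding cfs_def using fin_gen_quot_module_iff maximalideal.axioms(1) by blast

end

section \<open>Products and powers of ideals\<close>

text \<open>The head is the rightmost factor, as the new factor is in \<open>ideal_power\<close>; on
  a module it acts first.\<close>

primrec ideal_list_prod :: "('a, 'c) ring_scheme \<Rightarrow> 'a set list \<Rightarrow> 'a set" where
  "ideal_list_prod A [] = carrier A"
| "ideal_list_prod A (m # ms) = ideal_prod A (ideal_list_prod A ms) m"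

lemma ideal_power_eq: "ideal_power A n N = ideal_list_prod A (replicate N n)"
  by (induction N) auto

lemma (in left_module) smult_diff_l:
  "a \<in> carrier R \<Longrightarrow> b \<in> carrier R \<Longrightarrow> x \<in> carrier M \<Longrightarrow>
    (a \<ominus> b) \<odot>\<^bsub>M\<^esub> x = a \<odot>\<^bsub>M\<^esub> x \<ominus>\<^bsub>M\<^esub> b \<odot>\<^bsub>M\<^esub> x"
  by (simp add: a_minus_def smult_l_distr smult_minus_l)

lemma (in abelian_group) add_minus_cancel_left:
  "x \<in> carrier G \<Longrightarrow> y \<in> carrier G \<Longrightarrow> (x \<oplus> y) \<ominus> x = y"
proof -
  assume c: "x \<in> carrier G" "y \<in> carrier G"
  then have "(x \<oplus> y) \<ominus> x = y \<oplus> (x \<oplus> \<ominus> x)" by (simp add: a_minus_def a_ac)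
  then show ?thesis using c by (simp add: r_neg)
qed

context ring
begin

lemma add_diff_regroup:
  "j \<in> carrier R \<Longrightarrow> n \<in> carrier R \<Longrightarrow> c \<in> carrier R \<Longrightarrow> j \<oplus> n = (j \<oplus> c) \<oplus> (n \<ominus> c)"
proof -
  assume a: "j \<in> carrier R" "n \<in> carrier R" "c \<in> carrier R"
  then have "(j \<oplus> c) \<oplus> (n \<ominus> c) = (j \<oplus> n) \<oplus> (c \<oplus> \<ominus> c)" by (simp add: minus_eq a_ac)
  then show ?thesis using a by (simp add: r_neg)
qed

lemma ideal_list_prod_ideal: "\<forall>m\<in>set ms. ideal m R \<Longrightarrow> ideal (ideal_list_prod R ms) R"
  by (induction ms) (auto intro: ideal_prod_is_ideal oneideal)

lemma ideal_prod_least: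
  assumes "lsub S (left_regular R) N" "\<And>a b. a \<in> I \<Longrightarrow> b \<in> J \<Longrightarrow> a \<otimes> b \<in> N"
  shows "I \<cdot> J \<subseteq> N"
proof
  fix x assume "x \<in> I \<cdot> J"
  then show "x \<in> N"
    by (induction rule: ideal_prod.induct) (use assms lsubD(4)[OF assms(1)] in auto)
qed

lemma ideal_prod_carrier_left:
  assumes "ideal I R"
  shows "carrier R \<cdot> I = I"
proof
  show "carrier R \<cdot> I \<subseteq> I"
    using ideal_prod_inter[OF oneideal assms] by blast
  show "I \<subseteq> carrier R \<cdot> I"
    using ideal_prod.prod[OF one_closed, of _ I R] ideal.Icarr[OF assms] by fastforce
qed

text \<open>Powers are built by multiplication on the right, while generators of a left ideal are
  multiplied on the left; this exchanges the two sides.\<close>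

lemma ideal_power_commute:
  assumes n: "ideal n R"
  shows "n \<cdot> ideal_power R n N = ideal_power R n N \<cdot> n"
proof (induction N)
  case 0
  then show ?case using ideal_prod_one[OF n] ideal_prod_carrier_left[OF n] by simp
next
  case (Suc N)
  have "ideal (ideal_power R n N) R" unfolding ideal_power_eq using n by (intro ideal_list_prod_ideal) auto
  then show ?case using Suc n by (simp add: ideal_prod_assoc[symmetric])
qed

end

section \<open>Annihilators of simple subquotients\<close>

locale alg_module = assoc_alg K A + left_module A M
  for K :: "('k, 'c) ring_scheme" and A :: "('k, 'a) module" (structure) and M :: "('a, 'm) module"
begin

abbreviation F where "F \<equiv> scal K A"

lemma scal_module: "left_module (A\<lparr>carrier := F\<rparr>) M"
  by (rule scal_left_module[OF left_module_axioms])

text \<open>Centrality of the scalars makes every \<open>a\<close> act linearly over the field, so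
  kernels and images of its action are subspaces even when they are not submodules.\<close>

lemma scal_smult_commute:
  assumes "f \<in> F" "a \<in> carrier A" "v \<in> carrier M"
  shows "a \<odot>\<^bsub>M\<^esub> (f \<odot>\<^bsub>M\<^esub> v) = f \<odot>\<^bsub>M\<^esub> (a \<odot>\<^bsub>M\<^esub> v)"
  using assms scal_subset scal_central[OF assms(1,2)] smult_assoc1[of a f v] smult_assoc1[of f a v] by auto

lemma lsub_scal: "lsub (carrier A) M N \<Longrightarrow> lsub F M N"
  using lsub_mono scal_subset by blast

lemma lsub_smult_image:
  assumes J: "lsub (carrier A) (left_regular A) J" and v: "v \<in> carrier M"
  shows "lsub (carrier A) M ((\<lambda>a. a \<odot>\<^bsub>M\<^esub> v) ` J)"
  using lsubD(2)[OF J] v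
  by (intro lsub_image[OF left_regular_module left_module_axioms J])
    (auto simp: smult_closed smult_l_distr smult_assoc1)

text \<open>Sending \<open>a\<close> to \<open>a v\<close> presents \<open>(A v + N) / N\<close> as
  a quotient of \<open>A / J\<close>.\<close>

lemma flen_smult_image:
  assumes J: "lsub F (left_regular A) J" and N: "lsub F M N" and v: "v \<in> carrier M"
    and JN: "\<And>a. a \<in> J \<Longrightarrow> a \<odot>\<^bsub>M\<^esub> v \<in> N" and fl: "flen F (left_regular A) J (carrier A)"
  shows "flen F M N (lsum M ((\<lambda>a. a \<odot>\<^bsub>M\<^esub> v) ` carrier A) N)"
proof -
  interpret FA: left_module "A\<lparr>carrier := F\<rparr>" "left_regular A"
    by (rule scal_left_module[OF left_regular_module])
  show ?thesis
    using flen_image[OF FA.left_module_axioms scal_module, of "carrier A" N J "\<lambda>a. a \<odot>\<^bsub>M\<^esub> v"] assms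
      FA.lsub_carrier lsubD(1)[OF J] scal_subset
    by (auto simp: smult_closed smult_l_distr smult_assoc1 subset_iff)
qed

context
  fixes W V
  assumes W: "lsub (carrier A) M W" and V: "lsub (carrier A) M V" and WV: "W \<subseteq> V"
begin

definition ann :: "'a set" where "ann = {a \<in> carrier A. \<forall>v\<in>V. a \<odot>\<^bsub>M\<^esub> v \<in> W}"

text \<open>In general only a left ideal, unlike \<open>ann\<close>, but it can be cut down one
  vector at a time.\<close>

definition annset :: "'m set \<Rightarrow> 'a set" where "annset B = {a \<in> carrier A. \<forall>v\<in>B. a \<odot>\<^bsub>M\<^esub> v \<in> W}"

lemma lsub_annset: "B \<subseteq> V \<Longrightarrow> lsub (carrier A) (left_regular A) (annset B)"
  unfolding annset_def
  using lsubD[OF W] lsubD(2)[OF V]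
  by (intro lsubI) (auto simp: smult_l_distr smult_assoc1 subset_iff)

lemma ideal_ann: "ideal ann A"
proof (rule lsub_idealI)
  show "lsub (carrier A) (left_regular A) ann" using lsub_annset[of V] unfolding ann_def annset_def by simp
  show "a \<otimes> x \<in> ann" if "a \<in> ann" "x \<in> carrier A" for a x
    using that lsubD(2,5)[OF V] unfolding ann_def by (auto simp: smult_assoc1)
qed

text \<open>A finite set that spans \<open>V\<close> modulo \<open>W\<close> over the field detects
  annihilation, because each \<open>a\<close> acts linearly over the field.\<close>

lemma ann_eq_annset:
  assumes fl: "flen F M W V"
  obtains B where "finite B" "B \<subseteq> V" "ann = annset B"
proof -
  interpret FM: left_module "A\<lparr>carrier := F\<rparr>" M by (rule scal_module)
  obtain B where B: "finite B" "B \<subseteq> V" "lspan F M (B \<union> W) = V"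
    using FM.flen_fin_gen[of W V] fl lsub_scal[OF W] lsub_scal[OF V] WV by auto
  have "annset B \<subseteq> ann"
  proof
    fix a assume a: "a \<in> annset B"
    then have ac: "a \<in> carrier A" unfolding annset_def by blast
    have "lsub F M {v \<in> V. a \<odot>\<^bsub>M\<^esub> v \<in> W}"
      using lsub_preimage[OF scal_module scal_module, of W V "\<lambda>v. a \<odot>\<^bsub>M\<^esub> v"] lsub_scal[OF W] lsub_scal[OF V] ac lsubD(2)[OF V]
      by (auto simp: smult_closed smult_r_distr scal_smult_commute)
    moreover have "B \<union> W \<subseteq> {v \<in> V. a \<odot>\<^bsub>M\<^esub> v \<in> W}"
      using a ac B(2) WV lsubD(5)[OF W] unfolding annset_def by blast
    ultimately have "V \<subseteq> {v \<in> V. a \<odot>\<^bsub>M\<^esub> v \<in> W}" using lspan_least B(3) by metis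
    then show "a \<in> ann" using ac unfolding ann_def by blast
  qed
  moreover have "ann \<subseteq> annset B" using B(2) unfolding ann_def annset_def by blast
  ultimately show ?thesis using that[OF B(1,2)] by blast
qed

lemma annset_insert: "annset (insert v B) = {a \<in> annset B. a \<odot>\<^bsub>M\<^esub> v \<in> W}"
  unfolding annset_def by blast

text \<open>Adding \<open>v\<close> to \<open>B\<close> replaces \<open>annset B\<close> by the
  kernel of its map to \<open>V / W\<close> given by \<open>v\<close>, and this kernel has finite
  codimension.\<close>

lemma annset_cofinite:
  assumes fl: "flen F M W V" and "finite B" "B \<subseteq> V"
  shows "flen F (left_regular A) (annset B) (carrier A)"
  using assms(2,3)
proof (induction B)
  case empty
  show ?case by (simp add: annset_def flen_refl)
next
  case (insert v B)
  interpret FA: left_module "A\<lparr>carrier := F\<rparr>" "left_regular A"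
    by (rule scal_left_module[OF left_regular_module])
  have v: "v \<in> V" "v \<in> carrier M" and B: "B \<subseteq> V" using insert.prems lsubD(2)[OF V] by auto
  note l = lsub_mono[OF lsub_annset[OF B] scal_subset]
  have "flen F (left_regular A) {x \<in> annset B. x \<odot>\<^bsub>M\<^esub> v \<in> W} (annset B)"
    using flen_preimage[OF FA.left_module_axioms scal_module, of "annset B" W V "\<lambda>a. a \<odot>\<^bsub>M\<^esub> v"]
      l lsub_scal[OF W] lsub_scal[OF V] fl WV v lsubD(2)[OF l] lsubD(5)[OF V _ v(1)] scal_subset
    by (auto simp: smult_l_distr smult_assoc1 subset_iff)
  moreover have "{x \<in> annset B. x \<odot>\<^bsub>M\<^esub> v \<in> W} \<subseteq> annset B" by blast
  ultimately show ?case
    using FA.flen_trans[of "annset B" "annset (insert v B)" "carrier A"] insert.IH[OF B]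
      l lsubD(1)[OF l] FA.lsub_carrier
    by (simp add: annset_insert)
qed

text \<open>
  Maximality of \<open>ann\<close> without the density theorem: if \<open>I\<close> is an ideal properly containing \<open>ann\<close>, then
  \<open>I + annset C = A\<close> by induction on the finite set \<open>C \<subseteq> V\<close>, because simplicity of \<open>V / W\<close> gives
  \<open>(I \<inter> annset C) v + W = V\<close> unless \<open>annset C\<close> maps \<open>v\<close> into \<open>W\<close>.
\<close>

lemma ann_cfs:
  assumes fl: "flen F M W V" and ne: "W \<noteq> V"
    and simple: "\<And>N. lsub (carrier A) M N \<Longrightarrow> W \<subseteq> N \<Longrightarrow> N \<subseteq> V \<Longrightarrow> N = W \<or> N = V"
  shows "ann \<in> cfs K A"
proof -
  obtain B where B: "finite B" "B \<subseteq> V" "ann = annset B" using ann_eq_annset[OF fl] .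
  have "\<one> \<notin> ann"
  proof
    assume "\<one> \<in> ann"
    then have "V \<subseteq> W" using lsubD(2)[OF V] smult_one unfolding ann_def by fastforce
    then show False using ne WV by blast
  qed
  moreover have "I = ann \<or> I = carrier A" if I: "ideal I A" "ann \<subseteq> I" for I
  proof (cases "I = ann")
    case False
    interpret I: ideal I A by (rule I(1))
    note Il = ideal_lsub[OF I(1)]
    \<comment> \<open>\<open>I\<close> exceeds \<open>ann\<close>, so some \<open>i\<close> moves
      some \<open>u\<close> out of \<open>W\<close>. The pair stays fixed throughout the
      induction.\<close>
    have "\<exists>i\<in>I. \<exists>u\<in>V. i \<odot>\<^bsub>M\<^esub> u \<notin> W" using False I(2) I.Icarr unfolding ann_def by blast
    then obtain i u where iu: "i \<in> I" "u \<in> V" "i \<odot>\<^bsub>M\<^esub> u \<notin> W" by blast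
    have claim: "\<exists>i\<in>I. \<exists>n\<in>annset C. a = i \<oplus> n" if "finite C" "C \<subseteq> V" "a \<in> carrier A" for C a
      using that
    proof (induction C arbitrary: a)
      case empty
      then show ?case using I.zero_closed by (intro bexI[of _ \<zero>] bexI[of _ a]) (auto simp: annset_def)
    next
      case (insert v C)
      have v: "v \<in> V" "v \<in> carrier M" and C: "C \<subseteq> V" using insert.prems lsubD(2)[OF V] by auto
      note lC = lsub_annset[OF C]
      obtain j n where jn: "j \<in> I" "n \<in> annset C" "a = j \<oplus> n" using insert.IH[OF C] insert.prems by blast
      have sub: "lsub (carrier A) M (lsum M ((\<lambda>a. a \<odot>\<^bsub>M\<^esub> v) ` J) W)"
        and super: "W \<subseteq> lsum M ((\<lambda>a. a \<odot>\<^bsub>M\<^esub> v) ` J) W" "(\<lambda>a. a \<odot>\<^bsub>M\<^esub> v) ` J \<subseteq> lsum M ((\<lambda>a. a \<odot>\<^bsub>M\<^esub> v) ` J) W"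
        and le: "lsum M ((\<lambda>a. a \<odot>\<^bsub>M\<^esub> v) ` J) W \<subseteq> V"
        if J: "lsub (carrier A) (left_regular A) J" for J
      proof -
        have "lsub (carrier A) M ((\<lambda>a. a \<odot>\<^bsub>M\<^esub> v) ` J)" by (rule lsub_smult_image[OF J v(2)])
        then show "lsub (carrier A) M (lsum M ((\<lambda>a. a \<odot>\<^bsub>M\<^esub> v) ` J) W)"
          "W \<subseteq> lsum M ((\<lambda>a. a \<odot>\<^bsub>M\<^esub> v) ` J) W" "(\<lambda>a. a \<odot>\<^bsub>M\<^esub> v) ` J \<subseteq> lsum M ((\<lambda>a. a \<odot>\<^bsub>M\<^esub> v) ` J) W"
          using lsub_lsum lsum_superset W by blast+
        show "lsum M ((\<lambda>a. a \<odot>\<^bsub>M\<^esub> v) ` J) W \<subseteq> V"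
          using lsubD(2)[OF J] v lsubD(4,5)[OF V] WV unfolding lsum_def by auto
      qed
      show ?case
      proof (cases "n \<odot>\<^bsub>M\<^esub> v \<in> W")
        case True
        then show ?thesis using jn unfolding annset_insert by blast
      next
        case nW: False
        \<comment> \<open>By simplicity \<open>u\<close> is reached from \<open>v\<close>, modulo
          \<open>W\<close>, by some \<open>n'\<close> in \<open>annset C\<close>. Then
          \<open>i n'\<close> lies in \<open>I \<inter> annset C\<close> and sends \<open>v\<close>
          to \<open>i u\<close> modulo \<open>W\<close>, hence out of \<open>W\<close>.\<close>
        have "lsum M ((\<lambda>a. a \<odot>\<^bsub>M\<^esub> v) ` annset C) W = V"
          using simple[OF sub[OF lC] super(1)[OF lC] le[OF lC]] super(2)[OF lC] jn(2) nW by blast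
        then obtain n' w' where nw: "n' \<in> annset C" "w' \<in> W" "u = n' \<odot>\<^bsub>M\<^esub> v \<oplus>\<^bsub>M\<^esub> w'"
          using iu(2) unfolding lsum_def by blast
        let ?J = "I \<inter> annset C"
        have J: "lsub (carrier A) (left_regular A) ?J" by (rule lsub_Int[OF Il lC])
        have in': "i \<otimes> n' \<in> ?J"
          using I.I_r_closed[OF iu(1)] lsubD(5)[OF lC, of i n'] I.Icarr[OF iu(1)] nw(1) lsubD(2)[OF lC] by auto
        have "(i \<otimes> n') \<odot>\<^bsub>M\<^esub> v \<notin> W"
        proof
          assume *: "(i \<otimes> n') \<odot>\<^bsub>M\<^esub> v \<in> W"
          have "i \<odot>\<^bsub>M\<^esub> u = (i \<otimes> n') \<odot>\<^bsub>M\<^esub> v \<oplus>\<^bsub>M\<^esub> i \<odot>\<^bsub>M\<^esub> w'"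
            using nw v I.Icarr[OF iu(1)] lsubD(2)[OF W] lsubD(2)[OF lC nw(1)]
            by (simp add: smult_r_distr smult_assoc1 smult_closed)
          then show False using * lsubD(4)[OF W] lsubD(5)[OF W] I.Icarr[OF iu(1)] nw(2) iu(3) by metis
        qed
        then have "lsum M ((\<lambda>a. a \<odot>\<^bsub>M\<^esub> v) ` ?J) W = V"
          using simple[OF sub[OF J] super(1)[OF J] le[OF J]] super(2)[OF J] in' by blast
        moreover have "n \<odot>\<^bsub>M\<^esub> v \<in> V" using jn(2) lsubD(2)[OF lC] v lsubD(5)[OF V] by auto
        \<comment> \<open>Some \<open>c\<close> in \<open>I \<inter> annset C\<close> agrees with
          \<open>n\<close> on \<open>v\<close> modulo \<open>W\<close>. Moving \<open>c\<close> from
          the summand \<open>n\<close> to the summand \<open>j\<close> makes the second summand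
          annihilate \<open>v\<close> as well.\<close>
        ultimately obtain c w where cw: "c \<in> ?J" "w \<in> W" "n \<odot>\<^bsub>M\<^esub> v = c \<odot>\<^bsub>M\<^esub> v \<oplus>\<^bsub>M\<^esub> w"
          unfolding lsum_def by blast
        have carr: "n \<in> carrier A" "c \<in> carrier A" "w \<in> carrier M" "j \<in> carrier A"
          using jn cw lsubD(2)[OF lC] lsubD(2)[OF W] I.Icarr by auto
        have "(n \<ominus> c) \<odot>\<^bsub>M\<^esub> v = w"
          using carr v cw(3) by (simp add: smult_diff_l smult_closed M.add_minus_cancel_left)
        moreover have "n \<ominus> c \<in> annset C" using lsub_regular_diff[OF lC] jn(2) cw(1) by blast
        ultimately have "n \<ominus> c \<in> annset (insert v C)" unfolding annset_insert using cw(2) by simp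
        moreover have "j \<oplus> c \<in> I" using jn(1) cw(1) I.a_closed by blast
        moreover have "a = (j \<oplus> c) \<oplus> (n \<ominus> c)"
          unfolding jn(3) using carr by (intro add_diff_regroup)
        ultimately show ?thesis by blast
      qed
    qed
    have "carrier A \<subseteq> I"
    proof
      fix a assume "a \<in> carrier A"
      then obtain i n where "i \<in> I" "n \<in> annset B" "a = i \<oplus> n" using claim[OF B(1,2)] by blast
      then show "a \<in> I" using I(2) B(3) I.a_closed by blast
    qed
    then show ?thesis using I.a_subset by blast
  qed auto
  ultimately have "maximalideal ann A"
    using ideal_ann by (intro maximalidealI) auto
  then show ?thesis
    using annset_cofinite[OF fl B(1,2)] B(3) unfolding cfs_iff by simp
qed

end

text \<open>A largest submodule \<open>N\<close> killed by such a product is \<open>V\<close>.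
  Otherwise take \<open>N'\<close> minimal over \<open>N\<close>: the annihilator of the simple
  module \<open>N' / N\<close> is in the cofinite spectrum and serves as one more factor.\<close>

lemma flen_killed:
  assumes V: "lsub (carrier A) M V" and fl: "flen F M {\<zero>\<^bsub>M\<^esub>} V"
  shows "\<exists>ms. set ms \<subseteq> cfs K A \<and> (\<forall>a\<in>ideal_list_prod A ms. \<forall>v\<in>V. a \<odot>\<^bsub>M\<^esub> v = \<zero>\<^bsub>M\<^esub>)"
proof -
  let ?P = "\<lambda>N. \<exists>ms. set ms \<subseteq> cfs K A \<and> (\<forall>a\<in>ideal_list_prod A ms. \<forall>v\<in>N. a \<odot>\<^bsub>M\<^esub> v = \<zero>\<^bsub>M\<^esub>)"
  have flA: "flen (carrier A) M {\<zero>\<^bsub>M\<^esub>} V" using flen_scalars_mono[OF fl scal_subset] .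
  have "?P {\<zero>\<^bsub>M\<^esub>}" by (intro exI[of _ "[]"]) simp
  then have ex: "\<exists>N. lsub (carrier A) M N \<and> {\<zero>\<^bsub>M\<^esub>} \<subseteq> N \<and> N \<subseteq> V \<and> ?P N"
    using lsub_zero lsubD(3)[OF V] by blast
  obtain N where N: "lsub (carrier A) M N" "{\<zero>\<^bsub>M\<^esub>} \<subseteq> N" "N \<subseteq> V" "?P N"
    "\<And>N'. lsub (carrier A) M N' \<Longrightarrow> N \<subset> N' \<Longrightarrow> N' \<subseteq> V \<Longrightarrow> \<not> ?P N'"
    by (rule flen_maximal[OF flA V ex]) (rule that)
  have "N = V"
  proof (rule ccontr)
    assume "N \<noteq> V"
    then have ex': "\<exists>N'. lsub (carrier A) M N' \<and> N \<subseteq> N' \<and> N' \<subseteq> V \<and> N' \<noteq> N"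
      using V N(3) by (intro exI[of _ V]) auto
    obtain N' where N': "lsub (carrier A) M N'" "N \<subseteq> N'" "N' \<subseteq> V" "N' \<noteq> N"
      "\<And>N''. lsub (carrier A) M N'' \<Longrightarrow> N \<subseteq> N'' \<Longrightarrow> N'' \<subset> N' \<Longrightarrow> \<not> N'' \<noteq> N"
      by (rule flen_minimal[OF flen_mono[OF flA N(2) order_refl] ex']) (rule that)
    have m: "ann N N' \<in> cfs K A"
      using ann_cfs[OF N(1) N'(1,2) flen_mono[OF fl N(2) N'(3)] N'(4)[symmetric]] N'(5) by blast
    obtain ms where ms: "set ms \<subseteq> cfs K A" "\<And>a v. a \<in> ideal_list_prod A ms \<Longrightarrow> v \<in> N \<Longrightarrow> a \<odot>\<^bsub>M\<^esub> v = \<zero>\<^bsub>M\<^esub>"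
      using N(4) by blast
    have idl: "ideal (ideal_list_prod A ms) A"
      using ms(1) by (intro ideal_list_prod_ideal) (auto simp: cfs_def maximalideal_def)
    \<comment> \<open>The new factor is the rightmost one: it sends \<open>N'\<close> into
      \<open>N\<close>, which the remaining product kills.\<close>
    have "ideal_list_prod A (ann N N' # ms) \<subseteq> {a \<in> carrier A. \<forall>v\<in>N'. a \<odot>\<^bsub>M\<^esub> v = \<zero>\<^bsub>M\<^esub>}"
    proof (simp, rule ideal_prod_least)
      show "lsub (carrier A) (left_regular A) {a \<in> carrier A. \<forall>v\<in>N'. a \<odot>\<^bsub>M\<^esub> v = \<zero>\<^bsub>M\<^esub>}"
        using lsubD(2)[OF N'(1)] by (intro lsubI) (auto simp: smult_l_distr smult_assoc1)
      show "a \<otimes> b \<in> {a \<in> carrier A. \<forall>v\<in>N'. a \<odot>\<^bsub>M\<^esub> v = \<zero>\<^bsub>M\<^esub>}"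
        if "a \<in> ideal_list_prod A ms" "b \<in> ann N N'" for a b
        using that ms(2) ideal.Icarr[OF idl] lsubD(2)[OF N'(1)]
        unfolding ann_def[OF N(1) N'(1,2)] by (auto simp: smult_assoc1)
    qed
    then have "?P N'" using m ms(1) by (intro exI[of _ "ann N N' # ms"]) auto
    then show False using N(5)[OF N'(1)] N' by blast
  qed
  then show ?thesis using N(4) by blast
qed

end

context assoc_alg
begin

lemma cfs_ideal: "n \<in> cfs K A \<Longrightarrow> ideal n A"
  by (simp add: cfs_def maximalideal_def)

text \<open>For \<open>I = n^N\<close> the left ideal \<open>I\<close> has finitely many generators
  \<open>e\<close>, and \<open>n e\<close> lies in \<open>n I = I n\<close>. So each generator
  contributes to \<open>I / I n\<close> at most a quotient of \<open>A / n\<close>.\<close>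

lemma ideal_power_cofinite:
  assumes n: "n \<in> cfs K A" and noeth: "left_noetherian A"
  shows "flen (scal K A) (left_regular A) (ideal_power A n N) (carrier A)"
proof (induction N)
  case 0
  show ?case by (simp add: flen_refl)
next
  case (Suc N)
  let ?F = "scal K A" and ?A = "left_regular A" and ?I = "ideal_power A n N"
  interpret reg: alg_module K A "left_regular A"
    by (intro alg_module.intro assoc_alg_axioms left_regular_module)
  interpret FA: left_module "A\<lparr>carrier := ?F\<rparr>" ?A by (rule reg.scal_module)
  have n': "ideal n A" by (rule cfs_ideal[OF n])
  have I: "ideal ?I A" unfolding ideal_power_eq using n' by (intro ideal_list_prod_ideal) auto
  have E': "ideal (?I \<cdot> n) A" by (rule ideal_prod_is_ideal[OF I n'])
  note lE = ideal_lsub[OF E'] and lI = ideal_lsub[OF I]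
  have le: "?I \<cdot> n \<subseteq> ?I" using ideal_prod_inter[OF I n'] by blast
  obtain B where B: "finite B" "B \<subseteq> ?I" "lspan (carrier A) ?A B = ?I"
    using left_noetherian_fg[OF noeth lI] .
  have "C \<subseteq> ?I \<Longrightarrow> flen ?F ?A (?I \<cdot> n) (lspan (carrier A) ?A (C \<union> ?I \<cdot> n))" if "finite C" for C
    using that
  proof (induction C)
    case empty
    have "lspan (carrier A) ?A (?I \<cdot> n) = ?I \<cdot> n"
      using lspan_least[OF lE order_refl] lspan_superset[of "?I \<cdot> n"] by blast
    then show ?case by (simp add: flen_refl)
  next
    case (insert e C)
    let ?Y = "lspan (carrier A) ?A (C \<union> ?I \<cdot> n)"
    have c: "C \<union> ?I \<cdot> n \<subseteq> carrier A" "insert e C \<union> ?I \<cdot> n \<subseteq> carrier A" "e \<in> carrier A"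
      using insert.prems lsubD(1)[OF lI] lsubD(1)[OF lE] by auto
    have Y: "lsub (carrier A) ?A ?Y" using c by (intro reg.lsub_lspan) simp
    have "a \<otimes> e \<in> ?Y" if a: "a \<in> n" for a
    proof -
      have "a \<otimes> e \<in> n \<cdot> ?I" using ideal_prod.prod[OF a, of e ?I A] insert.prems by blast
      then show ?thesis
        unfolding ideal_power_commute[OF n'] using lspan_superset[of "C \<union> ?I \<cdot> n" "carrier A" ?A] by blast
    qed
    then have "flen ?F ?A ?Y (lsum ?A ((\<lambda>a. a \<odot>\<^bsub>?A\<^esub> e) ` carrier A) ?Y)"
      using n c lsub_mono[OF ideal_lsub[OF n'] scal_subset] reg.lsub_scal[OF Y]
      by (intro reg.flen_smult_image[of n]) (auto simp: cfs_iff)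
    moreover have "lsum ?A ((\<lambda>a. a \<odot>\<^bsub>?A\<^esub> e) ` carrier A) ?Y = lspan (carrier A) ?A (insert e C \<union> ?I \<cdot> n)"
      using reg.lspan_insert[of "C \<union> ?I \<cdot> n" e] c unfolding lsum_def by (simp; blast)
    moreover have "lsub (carrier A) ?A (lspan (carrier A) ?A (insert e C \<union> ?I \<cdot> n))"
      using c by (intro reg.lsub_lspan) simp
    moreover have "?I \<cdot> n \<subseteq> ?Y" using lspan_superset[of "C \<union> ?I \<cdot> n"] by blast
    moreover have "?Y \<subseteq> lspan (carrier A) ?A (insert e C \<union> ?I \<cdot> n)" by (rule lspan_mono) auto
    ultimately show ?case
      using FA.flen_trans[of ?Y "?I \<cdot> n"] insert reg.lsub_scal Y by auto
  qed
  from this[OF B(1,2)] have "flen ?F ?A (?I \<cdot> n) (lspan (carrier A) ?A (B \<union> ?I \<cdot> n))" .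
  moreover have "?I \<subseteq> lspan (carrier A) ?A (B \<union> ?I \<cdot> n)"
    using lspan_mono[of B "B \<union> ?I \<cdot> n" "carrier A" ?A] B(3) by blast
  ultimately have "flen ?F ?A (?I \<cdot> n) ?I" by (rule flen_mono[OF _ order_refl])
  then show ?case
    using FA.flen_trans[of ?I "?I \<cdot> n" "carrier A"] Suc.IH le reg.lsub_scal[OF lI]
      lsubD(1)[OF lI] FA.lsub_carrier by simp
qed

end

section \<open>Vanishing of \<open>Ext\<^sup>1\<close> and extension of homomorphisms\<close>

text \<open>The linear map from the free module on \<open>B\<close> that sends the basis element at
  \<open>x\<close> to \<open>s x\<close>. For \<open>s\<close> the identity on the carrier, its
  kernel is the carrier of \<open>syzygy\<close>.\<close>

definition comb :: "('r, 'm) module \<Rightarrow> 'i set \<Rightarrow> ('i \<Rightarrow> 'm) \<Rightarrow> ('i \<Rightarrow> 'r) \<Rightarrow> 'm" where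
  "comb M B s w = gfinprod (add_monoid M) (\<lambda>x. w x \<odot>\<^bsub>M\<^esub> s x) B"

lemma finsum_hom:
  assumes "abelian_group M" "abelian_group N"
    and f: "\<And>x. x \<in> carrier M \<Longrightarrow> f x \<in> carrier N"
      "\<And>x y. x \<in> carrier M \<Longrightarrow> y \<in> carrier M \<Longrightarrow> f (x \<oplus>\<^bsub>M\<^esub> y) = f x \<oplus>\<^bsub>N\<^esub> f y"
    and "finite D" "g \<in> D \<rightarrow> carrier M"
  shows "f (finsum M g D) = finsum N (\<lambda>x. f (g x)) D"
proof -
  interpret M: abelian_group M by fact
  interpret N: abelian_group N by fact
  have "f \<zero>\<^bsub>M\<^esub> \<oplus>\<^bsub>N\<^esub> f \<zero>\<^bsub>M\<^esub> = f \<zero>\<^bsub>M\<^esub>" using f(2)[of "\<zero>\<^bsub>M\<^esub>" "\<zero>\<^bsub>M\<^esub>"] by simp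
  then have zero: "f \<zero>\<^bsub>M\<^esub> = \<zero>\<^bsub>N\<^esub>" using f(1)[of "\<zero>\<^bsub>M\<^esub>"] by simp
  show ?thesis
    using assms(5,6)
  proof (induction D)
    case empty
    then show ?case using zero by (simp add: M.finsum_empty N.finsum_empty)
  next
    case (insert x D)
    then have "g \<in> D \<rightarrow> carrier M" "g x \<in> carrier M" "(\<lambda>x. f (g x)) \<in> D \<rightarrow> carrier N" "f (g x) \<in> carrier N"
      using f(1) by auto
    then show ?case
      using insert f by (simp add: M.finsum_insert N.finsum_insert M.finsum_closed)
  qed
qed

context left_module
begin

lemma comb_finsum:
  assumes "finite D" "D \<subseteq> B" "\<And>x. x \<in> B - D \<Longrightarrow> w x = \<zero>"
    and "w \<in> B \<rightarrow> carrier R" "s \<in> B \<rightarrow> carrier M"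
  shows "comb M B s w = finsum M (\<lambda>x. w x \<odot>\<^bsub>M\<^esub> s x) D"
proof -
  \<comment> \<open>\<open>gfinprod\<close> sums over the places where the term is nonzero, which
    can be fewer than those with a nonzero coefficient; all of them lie in \<open>D\<close>.\<close>
  let ?Z = "{x \<in> B. w x \<odot>\<^bsub>M\<^esub> s x \<noteq> \<zero>\<^bsub>M\<^esub>}"
  have Z: "?Z \<subseteq> D"
  proof
    fix x assume x: "x \<in> ?Z"
    then have "s x \<in> carrier M" using assms(5) by auto
    then show "x \<in> D" using x assms(3)[of x] by (cases "x \<in> D") auto
  qed
  have "finite ?Z" using finite_subset[OF Z assms(1)] .
  then have "comb M B s w = finsum M (\<lambda>x. w x \<odot>\<^bsub>M\<^esub> s x) ?Z"
    unfolding comb_def gfinprod_def finsum_def by simp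
  also have "\<dots> = finsum M (\<lambda>x. w x \<odot>\<^bsub>M\<^esub> s x) D"
  proof (rule M.add.finprod_mono_neutral_cong_left[OF assms(1) Z])
    show "\<And>i. i \<in> D - ?Z \<Longrightarrow> w i \<odot>\<^bsub>M\<^esub> s i = \<zero>\<^bsub>M\<^esub>" using assms(2) by blast
    show "(\<lambda>x. w x \<odot>\<^bsub>M\<^esub> s x) \<in> D \<rightarrow> carrier M"
      by (intro Pi_I smult_closed) (use assms(2,4,5) in blast)+
  qed auto
  finally show ?thesis .
qed

end

section \<open>Free modules and linear combinations\<close>

lemma free_module_simps:
  "carrier (free_module R B) = {f \<in> B \<rightarrow>\<^sub>E carrier R. finite {x \<in> B. f x \<noteq> \<zero>\<^bsub>R\<^esub>}}"
  "\<zero>\<^bsub>free_module R B\<^esub> = (\<lambda>x\<in>B. \<zero>\<^bsub>R\<^esub>)"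
  "f \<oplus>\<^bsub>free_module R B\<^esub> g = (\<lambda>x\<in>B. f x \<oplus>\<^bsub>R\<^esub> g x)"
  "a \<odot>\<^bsub>free_module R B\<^esub> f = (\<lambda>x\<in>B. a \<otimes>\<^bsub>R\<^esub> f x)"
  by (simp_all add: free_module_def)

context ring
begin

lemma free_module_mem:
  "f \<in> carrier (free_module R B) \<Longrightarrow> x \<in> B \<Longrightarrow> f x \<in> carrier R"
  unfolding free_module_simps by auto

lemma free_module_closed:
  assumes f: "f \<in> carrier (free_module R B)"
  shows "g \<in> carrier (free_module R B) \<Longrightarrow> (\<lambda>x\<in>B. f x \<oplus> g x) \<in> carrier (free_module R B)"
    and "a \<in> carrier R \<Longrightarrow> (\<lambda>x\<in>B. a \<otimes> f x) \<in> carrier (free_module R B)"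
proof -
  assume g: "g \<in> carrier (free_module R B)"
  have "{x \<in> B. f x \<oplus> g x \<noteq> \<zero>} \<subseteq> {x \<in> B. f x \<noteq> \<zero>} \<union> {x \<in> B. g x \<noteq> \<zero>}" by auto
  then have "finite {x \<in> B. f x \<oplus> g x \<noteq> \<zero>}"
    using f g finite_subset unfolding free_module_simps by blast
  then show "(\<lambda>x\<in>B. f x \<oplus> g x) \<in> carrier (free_module R B)"
    using f g unfolding free_module_simps by (auto cong: conj_cong)
next
  assume a: "a \<in> carrier R"
  have "{x \<in> B. a \<otimes> f x \<noteq> \<zero>} \<subseteq> {x \<in> B. f x \<noteq> \<zero>}" using a by auto
  then have "finite {x \<in> B. a \<otimes> f x \<noteq> \<zero>}"
    using f finite_subset unfolding free_module_simps by blast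
  then show "(\<lambda>x\<in>B. a \<otimes> f x) \<in> carrier (free_module R B)"
    using f a unfolding free_module_simps by (auto cong: conj_cong)
qed

lemma free_module_left_module: "left_module R (free_module R B)"
proof -
  have "abelian_group (free_module R B)"
  proof (rule abelian_groupI)
    fix f assume f: "f \<in> carrier (free_module R B)"
    have "(\<lambda>x\<in>B. (\<lambda>x\<in>B. \<ominus> \<one> \<otimes> f x) x \<oplus> f x) = (\<lambda>x\<in>B. \<zero>)"
      using free_module_mem[OF f] by (intro restrict_ext) (simp add: l_minus l_neg)
    then show "\<exists>y\<in>carrier (free_module R B). y \<oplus>\<^bsub>free_module R B\<^esub> f = \<zero>\<^bsub>free_module R B\<^esub>"
      using free_module_closed(2)[OF f, of "\<ominus> \<one>"] by (intro bexI[of _ "\<lambda>x\<in>B. \<ominus> \<one> \<otimes> f x"]) (simp_all add: free_module_simps)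
    show "\<zero>\<^bsub>free_module R B\<^esub> \<oplus>\<^bsub>free_module R B\<^esub> f = f"
      using f free_module_mem[OF f] unfolding free_module_simps by (auto simp: fun_eq_iff PiE_def extensional_def)
    fix g assume g: "g \<in> carrier (free_module R B)"
    show "f \<oplus>\<^bsub>free_module R B\<^esub> g = g \<oplus>\<^bsub>free_module R B\<^esub> f"
      unfolding free_module_simps(3) by (intro restrict_ext a_comm free_module_mem[OF f] free_module_mem[OF g])
    show "f \<oplus>\<^bsub>free_module R B\<^esub> g \<in> carrier (free_module R B)"
      unfolding free_module_simps(3) by (rule free_module_closed(1)[OF f g])
    fix h assume h: "h \<in> carrier (free_module R B)"
    show "f \<oplus>\<^bsub>free_module R B\<^esub> g \<oplus>\<^bsub>free_module R B\<^esub> h = f \<oplus>\<^bsub>free_module R B\<^esub> (g \<oplus>\<^bsub>free_module R B\<^esub> h)"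
      unfolding free_module_simps(3)
      by (intro restrict_ext) (simp add: a_assoc[OF free_module_mem[OF f] free_module_mem[OF g] free_module_mem[OF h]])
  qed (simp add: free_module_simps)
  moreover have "left_module_axioms R (free_module R B)"
  proof
    show "\<one> \<odot>\<^bsub>free_module R B\<^esub> f = f" if "f \<in> carrier (free_module R B)" for f
      using that free_module_mem[OF that] unfolding free_module_simps by (auto simp: fun_eq_iff PiE_def extensional_def)
    fix a f assume a: "a \<in> carrier R" and f: "f \<in> carrier (free_module R B)"
    show "a \<odot>\<^bsub>free_module R B\<^esub> f \<in> carrier (free_module R B)"
      unfolding free_module_simps(4) by (rule free_module_closed(2)[OF f a])
    fix b assume b: "b \<in> carrier R"
    show "(a \<oplus> b) \<odot>\<^bsub>free_module R B\<^esub> f = a \<odot>\<^bsub>free_module R B\<^esub> f \<oplus>\<^bsub>free_module R B\<^esub> b \<odot>\<^bsub>free_module R B\<^esub> f"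
      unfolding free_module_simps by (intro restrict_ext) (simp add: l_distr[OF a b free_module_mem[OF f]])
    show "(a \<otimes> b) \<odot>\<^bsub>free_module R B\<^esub> f = a \<odot>\<^bsub>free_module R B\<^esub> (b \<odot>\<^bsub>free_module R B\<^esub> f)"
      unfolding free_module_simps by (intro restrict_ext) (simp add: m_assoc[OF a b free_module_mem[OF f]])
  next
    fix a f g assume a: "a \<in> carrier R" and f: "f \<in> carrier (free_module R B)" and g: "g \<in> carrier (free_module R B)"
    show "a \<odot>\<^bsub>free_module R B\<^esub> (f \<oplus>\<^bsub>free_module R B\<^esub> g) = a \<odot>\<^bsub>free_module R B\<^esub> f \<oplus>\<^bsub>free_module R B\<^esub> a \<odot>\<^bsub>free_module R B\<^esub> g"
      unfolding free_module_simps
      by (intro restrict_ext) (simp add: r_distr[OF free_module_mem[OF f] free_module_mem[OF g] a])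
  qed
  ultimately show ?thesis by (intro left_module.intro ring_axioms)
qed

definition delta :: "'i set \<Rightarrow> 'i \<Rightarrow> 'i \<Rightarrow> 'a" where
  "delta B x = (\<lambda>y\<in>B. if y = x then \<one> else \<zero>)"

lemma delta_mem: "delta B x \<in> carrier (free_module R B)"
proof -
  have "{y \<in> B. delta B x y \<noteq> \<zero>} \<subseteq> {x}" unfolding delta_def by auto
  then have "finite {y \<in> B. delta B x y \<noteq> \<zero>}" using finite_subset by blast
  then show ?thesis unfolding free_module_simps by (auto simp: delta_def)
qed

end

context left_module
begin

context
  fixes B :: "'i set" and s
  assumes s: "s \<in> B \<rightarrow> carrier M"
begin

lemma comb_finsum_support:
  assumes w: "w \<in> carrier (free_module R B)" and "finite D" "D \<subseteq> B" "{x \<in> B. w x \<noteq> \<zero>} \<subseteq> D"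
  shows "comb M B s w = finsum M (\<lambda>x. w x \<odot>\<^bsub>M\<^esub> s x) D"
  using assms s by (intro comb_finsum) (auto simp: free_module_simps)

lemma smult_Pi: "w \<in> carrier (free_module R B) \<Longrightarrow> D \<subseteq> B \<Longrightarrow> (\<lambda>x. w x \<odot>\<^bsub>M\<^esub> s x) \<in> D \<rightarrow> carrier M"
  by (intro Pi_I smult_closed) (use R.free_module_mem[of w B] s in blast)+

lemma free_module_support: "w \<in> carrier (free_module R B) \<Longrightarrow> finite {x \<in> B. w x \<noteq> \<zero>}"
  unfolding free_module_simps by auto

lemma comb_closed: "w \<in> carrier (free_module R B) \<Longrightarrow> comb M B s w \<in> carrier M"
  using comb_finsum_support[of w "{x \<in> B. w x \<noteq> \<zero>}"] free_module_support[of w] smult_Pi[of w "{x \<in> B. w x \<noteq> \<zero>}"]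
  by (auto intro!: M.finsum_closed)

lemma comb_add:
  assumes w: "w \<in> carrier (free_module R B)" and v: "v \<in> carrier (free_module R B)"
  shows "comb M B s (w \<oplus>\<^bsub>free_module R B\<^esub> v) = comb M B s w \<oplus>\<^bsub>M\<^esub> comb M B s v"
proof -
  interpret FM: left_module R "free_module R B" by (rule R.free_module_left_module)
  let ?D = "{x \<in> B. w x \<noteq> \<zero>} \<union> {x \<in> B. v x \<noteq> \<zero>}"
  have D: "finite ?D" "?D \<subseteq> B" using w v free_module_support by auto
  have "comb M B s (w \<oplus>\<^bsub>free_module R B\<^esub> v) = finsum M (\<lambda>x. (w \<oplus>\<^bsub>free_module R B\<^esub> v) x \<odot>\<^bsub>M\<^esub> s x) ?D"
    using w v D by (intro comb_finsum_support FM.M.a_closed) (auto simp: free_module_simps)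
  also have "\<dots> = finsum M (\<lambda>x. w x \<odot>\<^bsub>M\<^esub> s x \<oplus>\<^bsub>M\<^esub> v x \<odot>\<^bsub>M\<^esub> s x) ?D"
  proof (rule M.finsum_cong')
    fix x assume x: "x \<in> ?D"
    then have "w x \<in> carrier R" "v x \<in> carrier R" "s x \<in> carrier M" "x \<in> B"
      using w v s R.free_module_mem by auto
    then show "(w \<oplus>\<^bsub>free_module R B\<^esub> v) x \<odot>\<^bsub>M\<^esub> s x = w x \<odot>\<^bsub>M\<^esub> s x \<oplus>\<^bsub>M\<^esub> v x \<odot>\<^bsub>M\<^esub> s x"
      by (simp add: free_module_simps smult_l_distr)
  qed (use smult_Pi[OF w D(2)] smult_Pi[OF v D(2)] in auto)
  also have "\<dots> = finsum M (\<lambda>x. w x \<odot>\<^bsub>M\<^esub> s x) ?D \<oplus>\<^bsub>M\<^esub> finsum M (\<lambda>x. v x \<odot>\<^bsub>M\<^esub> s x) ?D"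
    using smult_Pi[OF w D(2)] smult_Pi[OF v D(2)] by (intro M.finsum_addf)
  also have "\<dots> = comb M B s w \<oplus>\<^bsub>M\<^esub> comb M B s v"
    using comb_finsum_support[OF w D] comb_finsum_support[OF v D] by auto
  finally show ?thesis .
qed

lemma comb_smult:
  assumes a: "a \<in> carrier R" and w: "w \<in> carrier (free_module R B)"
  shows "comb M B s (a \<odot>\<^bsub>free_module R B\<^esub> w) = a \<odot>\<^bsub>M\<^esub> comb M B s w"
proof -
  interpret FM: left_module R "free_module R B" by (rule R.free_module_left_module)
  let ?D = "{x \<in> B. w x \<noteq> \<zero>}"
  have D: "finite ?D" "?D \<subseteq> B" using w free_module_support by auto
  have "comb M B s (a \<odot>\<^bsub>free_module R B\<^esub> w) = finsum M (\<lambda>x. (a \<odot>\<^bsub>free_module R B\<^esub> w) x \<odot>\<^bsub>M\<^esub> s x) ?D"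
    using w a D by (intro comb_finsum_support FM.smult_closed) (auto simp: free_module_simps)
  also have "\<dots> = finsum M (\<lambda>x. a \<odot>\<^bsub>M\<^esub> (w x \<odot>\<^bsub>M\<^esub> s x)) ?D"
  proof (rule M.finsum_cong')
    fix x assume x: "x \<in> ?D"
    then have "w x \<in> carrier R" "s x \<in> carrier M" "x \<in> B"
      using w s R.free_module_mem by auto
    then show "(a \<odot>\<^bsub>free_module R B\<^esub> w) x \<odot>\<^bsub>M\<^esub> s x = a \<odot>\<^bsub>M\<^esub> (w x \<odot>\<^bsub>M\<^esub> s x)"
      using a by (simp add: free_module_simps smult_assoc1)
  qed (use smult_Pi[OF w D(2)] a in \<open>auto intro!: smult_closed[of a] simp: Pi_iff\<close>)
  also have "\<dots> = a \<odot>\<^bsub>M\<^esub> finsum M (\<lambda>x. w x \<odot>\<^bsub>M\<^esub> s x) ?D"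
    using finsum_hom[OF M.abelian_group_axioms M.abelian_group_axioms, of "\<lambda>x. a \<odot>\<^bsub>M\<^esub> x" ?D "\<lambda>x. w x \<odot>\<^bsub>M\<^esub> s x"]
      a D(1) smult_Pi[OF w D(2)] by (simp add: smult_closed smult_r_distr)
  also have "\<dots> = a \<odot>\<^bsub>M\<^esub> comb M B s w" using comb_finsum_support[OF w D] by auto
  finally show ?thesis .
qed

lemma comb_delta:
  assumes "x \<in> B"
  shows "comb M B s (R.delta B x) = s x"
proof -
  have "comb M B s (R.delta B x) = finsum M (\<lambda>y. R.delta B x y \<odot>\<^bsub>M\<^esub> s y) {x}"
    using assms by (intro comb_finsum_support R.delta_mem) (auto simp: R.delta_def)
  also have "\<dots> = s x"
    using assms s by (simp add: M.finsum_insert M.finsum_empty R.delta_def smult_one Pi_iff)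
  finally show ?thesis .
qed

end

lemma syzygy_carrier:
  "carrier (syzygy R M) = {w \<in> carrier (free_module R (carrier M)). comb M (carrier M) (\<lambda>x. x) w = \<zero>\<^bsub>M\<^esub>}"
  by (simp add: syzygy_def comb_def)

end

lemma syzygy_ops:
  "ring.add (syzygy R M) = ring.add (free_module R (carrier M))"
  "smult (syzygy R M) = smult (free_module R (carrier M))"
  by (simp_all add: syzygy_def)

lemma hom_comb:
  assumes "left_module R M" "left_module R N"
    and f: "\<And>x. x \<in> carrier M \<Longrightarrow> f x \<in> carrier N"
      "\<And>x y. x \<in> carrier M \<Longrightarrow> y \<in> carrier M \<Longrightarrow> f (x \<oplus>\<^bsub>M\<^esub> y) = f x \<oplus>\<^bsub>N\<^esub> f y"
      "\<And>a x. a \<in> carrier R \<Longrightarrow> x \<in> carrier M \<Longrightarrow> f (a \<odot>\<^bsub>M\<^esub> x) = a \<odot>\<^bsub>N\<^esub> f x"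
    and s: "s \<in> B \<rightarrow> carrier M" and w: "w \<in> carrier (free_module R B)"
  shows "f (comb M B s w) = comb N B (\<lambda>x. f (s x)) w"
proof -
  interpret M: left_module R M by fact
  interpret N: left_module R N by fact
  let ?D = "{x \<in> B. w x \<noteq> \<zero>\<^bsub>R\<^esub>}"
  have D: "finite ?D" "?D \<subseteq> B" using w by (auto simp: free_module_simps)
  have s': "(\<lambda>x. f (s x)) \<in> B \<rightarrow> carrier N" using s f(1) by auto
  have "f (comb M B s w) = f (finsum M (\<lambda>x. w x \<odot>\<^bsub>M\<^esub> s x) ?D)"
    using M.comb_finsum_support[OF s w D] by auto
  also have "\<dots> = finsum N (\<lambda>x. f (w x \<odot>\<^bsub>M\<^esub> s x)) ?D"
    using M.smult_Pi[OF s w D(2)] D(1) f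
    by (intro finsum_hom M.abelian_group_axioms N.abelian_group_axioms) auto
  also have "\<dots> = finsum N (\<lambda>x. w x \<odot>\<^bsub>N\<^esub> f (s x)) ?D"
    using N.smult_Pi[OF s' w D(2)] f(3) M.R.free_module_mem[OF w] s D(2)
    by (intro N.finsum_cong') (auto simp: Pi_iff)
  also have "\<dots> = comb N B (\<lambda>x. f (s x)) w"
    using N.comb_finsum_support[OF s' w D] by auto
  finally show ?thesis .
qed

section \<open>Extension of homomorphisms from a trivial extension group\<close>

text \<open>A trivial \<open>Ext1\<close> has the set of restrictions as its only coset. The coset
  of \<open>f\<close> contains \<open>f\<close>, as zero plus \<open>f\<close>, so \<open>f\<close>
  is itself a restriction.\<close>

lemma Ext1_trivial_imp_restrict:
  assumes N: "left_module R N" and R: "ring R" and triv: "trivial_group (Ext1 R M N)"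
    and f: "f \<in> module_hom R (syzygy R M) N"
  obtains h where "h \<in> module_hom R (free_module R (carrier M)) N"
    "\<And>w. w \<in> carrier (syzygy R M) \<Longrightarrow> f w = h w"
proof -
  interpret N: left_module R N by fact
  let ?K = "carrier (syzygy R M)" and ?Fr = "free_module R (carrier M)"
  let ?H = "(\<lambda>f. restrict f ?K) ` module_hom R ?Fr N"
  interpret Fr: left_module R ?Fr by (rule ring.free_module_left_module[OF R])
  have "?H #>\<^bsub>Hom_group R (syzygy R M) N\<^esub> f \<in> carrier (Ext1 R M N)"
    unfolding Ext1_def FactGroup_def RCOSETS_def using f by (auto simp: Hom_group_def)
  then have eq: "?H #>\<^bsub>Hom_group R (syzygy R M) N\<^esub> f = ?H"
    using triv unfolding trivial_group_def by (simp add: Ext1_def FactGroup_def)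
  have KF: "?K \<subseteq> carrier ?Fr" unfolding syzygy_def by auto
  have "(\<lambda>x\<in>carrier ?Fr. \<zero>\<^bsub>N\<^esub>) \<in> module_hom R ?Fr N"
    unfolding module_hom_def by (auto simp: Fr.smult_closed)
  moreover have "(\<lambda>x\<in>?K. \<zero>\<^bsub>N\<^esub>) = restrict (\<lambda>x\<in>carrier ?Fr. \<zero>\<^bsub>N\<^esub>) ?K"
    using KF by (auto simp: fun_eq_iff)
  ultimately have "(\<lambda>x\<in>?K. \<zero>\<^bsub>N\<^esub>) \<in> ?H"
    by (metis (no_types, lifting) image_eqI)
  then have "(\<lambda>x\<in>?K. (\<lambda>x\<in>?K. \<zero>\<^bsub>N\<^esub>) x \<oplus>\<^bsub>N\<^esub> f x) \<in> ?H #>\<^bsub>Hom_group R (syzygy R M) N\<^esub> f"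
    unfolding r_coset_def by (rule UN_I) (simp add: Hom_group_def)
  moreover have "(\<lambda>x\<in>?K. (\<lambda>x\<in>?K. \<zero>\<^bsub>N\<^esub>) x \<oplus>\<^bsub>N\<^esub> f x) = f"
    using f unfolding module_hom_def by (auto simp: fun_eq_iff PiE_def extensional_def Pi_iff)
  ultimately have "f \<in> ?H" using eq by simp
  then obtain h where "h \<in> module_hom R ?Fr N" "f = restrict h ?K" by blast
  then show ?thesis using that by simp
qed

text \<open>Exactness of Hom(P, T) -> Hom(Q, T) -> Ext1(S, T) in the middle, by hand. Lifting the
  basis of the free module on \<open>S\<close> to \<open>P\<close> gives a map \<open>g\<close> over
  \<open>S\<close>. It carries syzygies into \<open>Q\<close>, so \<open>f\<close> after
  \<open>g\<close> extends to some \<open>h\<close> on the free module. The extension of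
  \<open>f\<close> sends \<open>x\<close> to \<open>f (x - g w) + h w\<close>, for any
  \<open>w\<close> with the same image in \<open>S\<close> as \<open>x\<close>.\<close>

lemma Ext1_trivial_imp_extension:
  assumes P: "left_module R P" and S: "left_module R S" and T: "left_module R T"
    and triv: "trivial_group (Ext1 R S T)"
    and p: "\<And>x. x \<in> carrier P \<Longrightarrow> p x \<in> carrier S"
      "\<And>x y. x \<in> carrier P \<Longrightarrow> y \<in> carrier P \<Longrightarrow> p (x \<oplus>\<^bsub>P\<^esub> y) = p x \<oplus>\<^bsub>S\<^esub> p y"
      "\<And>a x. a \<in> carrier R \<Longrightarrow> x \<in> carrier P \<Longrightarrow> p (a \<odot>\<^bsub>P\<^esub> x) = a \<odot>\<^bsub>S\<^esub> p x"
      "carrier S \<subseteq> p ` carrier P"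
    and Q: "Q = {x \<in> carrier P. p x = \<zero>\<^bsub>S\<^esub>}"
    and f: "\<And>x. x \<in> Q \<Longrightarrow> f x \<in> carrier T"
      "\<And>x y. x \<in> Q \<Longrightarrow> y \<in> Q \<Longrightarrow> f (x \<oplus>\<^bsub>P\<^esub> y) = f x \<oplus>\<^bsub>T\<^esub> f y"
      "\<And>a x. a \<in> carrier R \<Longrightarrow> x \<in> Q \<Longrightarrow> f (a \<odot>\<^bsub>P\<^esub> x) = a \<odot>\<^bsub>T\<^esub> f x"
  obtains f' where "\<And>x. x \<in> carrier P \<Longrightarrow> f' x \<in> carrier T"
    "\<And>a x. a \<in> carrier R \<Longrightarrow> x \<in> carrier P \<Longrightarrow> f' (a \<odot>\<^bsub>P\<^esub> x) = a \<odot>\<^bsub>T\<^esub> f' x"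
    "\<And>x. x \<in> Q \<Longrightarrow> f' x = f x"
proof -
  interpret P: left_module R P by fact
  interpret S: left_module R S by fact
  interpret T: left_module R T by fact
  let ?B = "carrier S" and ?Fr = "free_module R (carrier S)"
  interpret Fr: left_module R ?Fr by (rule P.R.free_module_left_module)
  have "\<forall>x\<in>carrier S. \<exists>y. y \<in> carrier P \<and> p y = x" using p(4) by blast
  then obtain s where s: "\<And>x. x \<in> carrier S \<Longrightarrow> s x \<in> carrier P \<and> p (s x) = x" by metis
  then have sP: "s \<in> ?B \<rightarrow> carrier P" by auto
  let ?g = "comb P ?B s"
  note g = P.comb_closed[OF sP] P.comb_add[OF sP] P.comb_smult[OF sP]
  have pg: "p (?g w) = comb S ?B (\<lambda>x. x) w" if w: "w \<in> carrier ?Fr" for w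
  proof -
    have id: "(\<lambda>x. x) \<in> ?B \<rightarrow> carrier S" and ps: "(\<lambda>x. p (s x)) \<in> ?B \<rightarrow> carrier S" using s by auto
    have D: "finite {x \<in> ?B. w x \<noteq> \<zero>\<^bsub>R\<^esub>}" using w by (auto simp: free_module_simps)
    have "p (?g w) = comb S ?B (\<lambda>x. p (s x)) w" using hom_comb[OF P S p(1-3) sP w] .
    also have "\<dots> = finsum S (\<lambda>x. w x \<odot>\<^bsub>S\<^esub> p (s x)) {x \<in> ?B. w x \<noteq> \<zero>\<^bsub>R\<^esub>}"
      using S.comb_finsum_support[OF ps w D] by auto
    also have "\<dots> = finsum S (\<lambda>x. w x \<odot>\<^bsub>S\<^esub> x) {x \<in> ?B. w x \<noteq> \<zero>\<^bsub>R\<^esub>}"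
      using s S.smult_Pi[OF id w, of "{x \<in> ?B. w x \<noteq> \<zero>\<^bsub>R\<^esub>}"] by (intro S.finsum_cong') auto
    also have "\<dots> = comb S ?B (\<lambda>x. x) w" using S.comb_finsum_support[OF id w D] by auto
    finally show ?thesis .
  qed
  have K: "carrier (syzygy R S) = {w \<in> carrier ?Fr. p (?g w) = \<zero>\<^bsub>S\<^esub>}"
    unfolding S.syzygy_carrier using pg by auto
  have KQ: "?g w \<in> Q" if "w \<in> carrier (syzygy R S)" for w using that g(1) unfolding K Q by blast
  have Ks: "lsub (carrier R) ?Fr (carrier (syzygy R S))"
    using lsub_preimage[OF Fr.left_module_axioms S S.lsub_zero Fr.lsub_carrier, of "\<lambda>w. p (?g w)"]
      p(1)[OF g(1)] p(2)[OF g(1) g(1)] p(3)[OF _ g(1)]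
    unfolding K by (simp add: g(2,3))
  have "(\<lambda>w\<in>carrier (syzygy R S). f (?g w)) \<in> module_hom R (syzygy R S) T"
  proof -
    have "w \<in> carrier ?Fr" if "w \<in> carrier (syzygy R S)" for w using that unfolding K by blast
    then show ?thesis
      unfolding module_hom_def
      using lsubD(4,5)[OF Ks] f(1)[OF KQ] f(2)[OF KQ KQ] f(3)[OF _ KQ]
      by (simp add: syzygy_ops g(2,3))
  qed
  from Ext1_trivial_imp_restrict[OF T P.R.ring_axioms triv this]
  obtain h where h0: "h \<in> module_hom R ?Fr T"
    "\<And>w. w \<in> carrier (syzygy R S) \<Longrightarrow> (\<lambda>w\<in>carrier (syzygy R S). f (?g w)) w = h w" by metis
  then have h: "\<And>w. w \<in> carrier ?Fr \<Longrightarrow> h w \<in> carrier T"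
    "\<And>v w. v \<in> carrier ?Fr \<Longrightarrow> w \<in> carrier ?Fr \<Longrightarrow> h (v \<oplus>\<^bsub>?Fr\<^esub> w) = h v \<oplus>\<^bsub>T\<^esub> h w"
    "\<And>a w. a \<in> carrier R \<Longrightarrow> w \<in> carrier ?Fr \<Longrightarrow> h (a \<odot>\<^bsub>?Fr\<^esub> w) = a \<odot>\<^bsub>T\<^esub> h w"
    "\<And>w. w \<in> carrier (syzygy R S) \<Longrightarrow> h w = f (?g w)"
    unfolding module_hom_def by auto
  have diffQ: "x \<ominus>\<^bsub>P\<^esub> ?g w \<in> Q" if x: "x \<in> carrier P" and w: "w \<in> carrier ?Fr" "p (?g w) = p x" for x w
  proof -
    let ?d = "x \<ominus>\<^bsub>P\<^esub> ?g w"
    have d: "?d \<in> carrier P" using x g(1)[OF w(1)] by simp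
    have "?d \<oplus>\<^bsub>P\<^esub> ?g w = x" using x g(1)[OF w(1)] by (simp add: P.M.minus_eq P.M.a_assoc P.M.l_neg)
    then have "p ?d \<oplus>\<^bsub>S\<^esub> p x = p x" using p(2)[OF d g(1)[OF w(1)]] w(2) by simp
    then show ?thesis using d p(1)[OF d] p(1)[OF x] unfolding Q by simp
  qed
  \<comment> \<open>\<open>P\<close> is the sum of \<open>Q\<close> and the image of
    \<open>g\<close>, glued along the syzygies; \<open>f\<close> is evaluated on the first part and
    \<open>h\<close> on the second.\<close>
  define val where "val = (\<lambda>x w. f (x \<ominus>\<^bsub>P\<^esub> ?g w) \<oplus>\<^bsub>T\<^esub> h w)"
  have indep: "val x w = val x w'" if x: "x \<in> carrier P" and w: "w \<in> carrier ?Fr" "p (?g w) = p x"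
    and w': "w' \<in> carrier ?Fr" "p (?g w') = p x" for x w w'
  proof -
    \<comment> \<open>The two lifts differ by a syzygy, on which \<open>h\<close> agrees with
      \<open>f\<close> after \<open>g\<close>.\<close>
    let ?v = "w \<ominus>\<^bsub>?Fr\<^esub> w'"
    have v: "?v \<in> carrier ?Fr" using w w' by simp
    have e: "w = ?v \<oplus>\<^bsub>?Fr\<^esub> w'" using w w' by (simp add: Fr.M.minus_eq Fr.M.a_assoc Fr.M.l_neg)
    note gv = g(1)[OF v] g(1)[OF w(1)] g(1)[OF w'(1)]
    have gw: "?g w = ?g ?v \<oplus>\<^bsub>P\<^esub> ?g w'" using g(2)[OF v w'(1)] e by simp
    then have "p x = p (?g ?v) \<oplus>\<^bsub>S\<^esub> p x" using p(2)[OF gv(1,3)] w(2) w'(2) by simp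
    then have "p (?g ?v) = \<zero>\<^bsub>S\<^esub>" using p(1)[OF gv(1)] p(1)[OF x] by simp
    then have vK: "?v \<in> carrier (syzygy R S)" using v unfolding K by blast
    have "(x \<ominus>\<^bsub>P\<^esub> ?g w) \<oplus>\<^bsub>P\<^esub> ?g ?v = x \<ominus>\<^bsub>P\<^esub> ?g w' \<oplus>\<^bsub>P\<^esub> (?g ?v \<oplus>\<^bsub>P\<^esub> \<ominus>\<^bsub>P\<^esub> ?g ?v)"
      unfolding gw using x gv by (simp add: P.M.minus_eq P.M.minus_add P.M.a_ac)
    then have "(x \<ominus>\<^bsub>P\<^esub> ?g w) \<oplus>\<^bsub>P\<^esub> ?g ?v = x \<ominus>\<^bsub>P\<^esub> ?g w'" using x gv by (simp add: P.M.r_neg)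
    then have "f (x \<ominus>\<^bsub>P\<^esub> ?g w') = f (x \<ominus>\<^bsub>P\<^esub> ?g w) \<oplus>\<^bsub>T\<^esub> h ?v"
      using f(2)[OF diffQ[OF x w] KQ[OF vK]] h(4)[OF vK] by simp
    moreover have "h w = h ?v \<oplus>\<^bsub>T\<^esub> h w'" using h(2)[OF v w'(1)] e by simp
    ultimately show ?thesis
      unfolding val_def using f(1)[OF diffQ[OF x w]] h(1)[OF v] h(1)[OF w'(1)] by (simp add: T.M.a_assoc)
  qed
  \<comment> \<open>The basis element at \<open>p x\<close> is a canonical lift of
    \<open>p x\<close>.\<close>
  let ?d = "\<lambda>x. P.R.delta ?B (p x)"
  have d: "?d x \<in> carrier ?Fr" "p (?g (?d x)) = p x" if "x \<in> carrier P" for x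
    using P.R.delta_mem[of ?B "p x"] P.comb_delta[OF sP p(1)[OF that]] s[OF p(1)[OF that]] by auto
  show ?thesis
  proof (rule that[of "\<lambda>x. val x (?d x)"])
    show "val x (?d x) \<in> carrier T" if x: "x \<in> carrier P" for x
      unfolding val_def using f(1)[OF diffQ[OF x d[OF x]]] h(1)[OF d(1)[OF x]] by simp
    show "val (a \<odot>\<^bsub>P\<^esub> x) (?d (a \<odot>\<^bsub>P\<^esub> x)) = a \<odot>\<^bsub>T\<^esub> val x (?d x)"
      if a: "a \<in> carrier R" and x: "x \<in> carrier P" for a x
    proof -
      note ax = P.smult_closed[OF a x] and dx = d[OF x]
      note ad = Fr.smult_closed[OF a dx(1)]
      \<comment> \<open>The canonical lift of \<open>a x\<close> is in general not \<open>a\<close>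
        times that of \<open>x\<close>; \<open>indep\<close> allows the latter to replace
        it.\<close>
      have "p (?g (a \<odot>\<^bsub>?Fr\<^esub> ?d x)) = p (a \<odot>\<^bsub>P\<^esub> x)"
        using p(3)[OF a x] p(3)[OF a g(1)[OF dx(1)]] g(3)[OF a dx(1)] dx(2) by simp
      then have "val (a \<odot>\<^bsub>P\<^esub> x) (?d (a \<odot>\<^bsub>P\<^esub> x)) = val (a \<odot>\<^bsub>P\<^esub> x) (a \<odot>\<^bsub>?Fr\<^esub> ?d x)"
        by (intro indep ax d[OF ax] ad)
      also have "a \<odot>\<^bsub>P\<^esub> x \<ominus>\<^bsub>P\<^esub> ?g (a \<odot>\<^bsub>?Fr\<^esub> ?d x) = a \<odot>\<^bsub>P\<^esub> (x \<ominus>\<^bsub>P\<^esub> ?g (?d x))"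
        using P.smult_diff_r[OF a x g(1)[OF dx(1)]] g(3)[OF a dx(1)] by simp
      then have "val (a \<odot>\<^bsub>P\<^esub> x) (a \<odot>\<^bsub>?Fr\<^esub> ?d x) = a \<odot>\<^bsub>T\<^esub> val x (?d x)"
        unfolding val_def
        using f(3)[OF a diffQ[OF x dx]] h(3)[OF a dx(1)] f(1)[OF diffQ[OF x dx]] h(1)[OF dx(1)] a
        by (simp add: T.smult_r_distr)
      finally show ?thesis .
    qed
    show "val x (?d x) = f x" if x: "x \<in> Q" for x
    proof -
      have xP: "x \<in> carrier P" "p x = \<zero>\<^bsub>S\<^esub>" using x unfolding Q by auto
      note dx = d[OF xP(1)]
      have dK: "?d x \<in> carrier (syzygy R S)" using dx xP(2) unfolding K by simp
      have "(x \<ominus>\<^bsub>P\<^esub> ?g (?d x)) \<oplus>\<^bsub>P\<^esub> ?g (?d x) = x"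
        using xP(1) g(1)[OF dx(1)] by (simp add: P.M.minus_eq P.M.a_assoc P.M.l_neg)
      then show ?thesis
        unfolding val_def h(4)[OF dK] using f(2)[OF diffQ[OF xP(1) dx] KQ[OF dK]] by simp
    qed
  qed
qed

section \<open>Products of ideals in the cofinite spectrum\<close>

text \<open>The left module \<open>E / Y\<close> for left ideals \<open>Y \<subseteq> E\<close>, with \<open>A / n\<close> acting through representatives.\<close>

definition subquotient :: "('a, 'c) ring_scheme \<Rightarrow> 'a set \<Rightarrow> 'a set \<Rightarrow> ('a set, 'a set) module" where
  "subquotient A Y E = \<lparr>carrier = (\<lambda>x. Y +>\<^bsub>A\<^esub> x) ` E, monoid.mult = rcoset_mult A Y, one = Y +>\<^bsub>A\<^esub> \<one>\<^bsub>A\<^esub>,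
     ring.zero = Y, ring.add = set_add A, smult = rcoset_mult A Y\<rparr>"

text \<open>Written in the literal form of an element of \<open>simples_at\<close>, so that the
  hypothesis on \<open>Ext1\<close> applies without transport along an isomorphism.\<close>

definition subquotient_module :: "('a, 'c) ring_scheme \<Rightarrow> 'a set \<Rightarrow> 'a set \<Rightarrow> 'a set \<Rightarrow> ('a, 'a set) module" where
  "subquotient_module A n Y E = restrict_scalars (\<lambda>a. n +>\<^bsub>A\<^esub> a) (subquotient A Y E)"

lemma abelian_group_cong:
  assumes "abelian_group M" "carrier N = carrier M" "\<zero>\<^bsub>N\<^esub> = \<zero>\<^bsub>M\<^esub>"
    "\<And>x y. x \<in> carrier M \<Longrightarrow> y \<in> carrier M \<Longrightarrow> x \<oplus>\<^bsub>N\<^esub> y = x \<oplus>\<^bsub>M\<^esub> y"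
  shows "abelian_group N"
proof -
  interpret M: abelian_group M by fact
  show ?thesis
  proof (rule abelian_groupI)
    show "\<exists>y\<in>carrier N. y \<oplus>\<^bsub>N\<^esub> x = \<zero>\<^bsub>N\<^esub>" if "x \<in> carrier N" for x
      using that assms M.l_neg by (intro bexI[of _ "\<ominus>\<^bsub>M\<^esub> x"]) auto
  qed (use assms in \<open>auto simp: M.a_ac\<close>)
qed

context ring
begin

context
  fixes n Y E
  assumes n: "ideal n R" and Y: "lsub (carrier R) (left_regular R) Y"
    and E: "lsub (carrier R) (left_regular R) E" and YE: "Y \<subseteq> E"
    and nE': "\<forall>a\<in>n. \<forall>x\<in>E. a \<otimes> x \<in> Y"
begin

private lemma nE: "a \<in> n \<Longrightarrow> x \<in> E \<Longrightarrow> a \<otimes> x \<in> Y" using nE' by blast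

private lemma YR: "abelian_subgroup Y R" by (rule lsub_abelian_subgroup[OF Y])
private lemma Ecarr: "x \<in> E \<Longrightarrow> x \<in> carrier R" using lsubD(2)[OF E] by simp

lemma subquotient_add:
  "x \<in> E \<Longrightarrow> y \<in> E \<Longrightarrow> (Y +> x) \<oplus>\<^bsub>subquotient R Y E\<^esub> (Y +> y) = Y +> (x \<oplus> y)"
  using abelian_subgroup.a_rcos_sum[OF YR] Ecarr by (simp add: subquotient_def)

text \<open>The product of \<open>k + a\<close> and \<open>y + x\<close> is \<open>a x\<close> plus
  \<open>(k + a) y\<close> plus \<open>k x\<close>. The last two terms lie in \<open>Y\<close>, the
  final one because \<open>n E\<close> does. So the union in \<open>rcoset_mult\<close> consists of
  a single coset.\<close>

lemma subquotient_smult: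
  assumes a: "a \<in> carrier R" and x: "x \<in> E"
  shows "(n +> a) \<odot>\<^bsub>subquotient R Y E\<^esub> (Y +> x) = Y +> (a \<otimes> x)"
proof -
  interpret n: ideal n R by (rule n)
  interpret Y: abelian_subgroup Y R by (rule YR)
  have "Y +> (u \<otimes> v) = Y +> (a \<otimes> x)" if u: "u \<in> n +> a" and v: "v \<in> Y +> x" for u v
  proof -
    obtain k y where k: "k \<in> n" "u = k \<oplus> a" and y: "y \<in> Y" "v = y \<oplus> x"
      using u v unfolding a_r_coset_def' by blast
    have c: "k \<in> carrier R" "y \<in> carrier R" "x \<in> carrier R" "y \<in> E"
      using k y n.a_Hcarr Y.a_Hcarr Ecarr x YE by auto
    have "u \<otimes> v = ((k \<oplus> a) \<otimes> y \<oplus> k \<otimes> x) \<oplus> a \<otimes> x"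
      using c a unfolding k(2) y(2) by (simp add: l_distr r_distr a_assoc)
    moreover have "(k \<oplus> a) \<otimes> y \<oplus> k \<otimes> x \<in> Y"
      using lsubD(4,5)[OF Y] nE[OF k(1) x] y(1) c a by simp
    ultimately have "u \<otimes> v \<in> Y +> (a \<otimes> x)" unfolding a_r_coset_def' by blast
    then show ?thesis using Y.a_repr_independence'[of "u \<otimes> v" "a \<otimes> x"] a c by simp
  qed
  moreover have "a \<in> n +> a" "x \<in> Y +> x" using n.a_rcos_self[OF a] Y.a_rcos_self[OF Ecarr[OF x]] by auto
  ultimately have "(\<Union>u\<in>n +> a. \<Union>v\<in>Y +> x. Y +> (u \<otimes> v)) = Y +> (a \<otimes> x)"
    by (intro equalityI UN_least) blast+
  then show ?thesis by (simp add: subquotient_def rcoset_mult_def)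
qed

lemma subquotient_carrier: "carrier (subquotient R Y E) = (\<lambda>x. Y +> x) ` E"
  and subquotient_zero: "\<zero>\<^bsub>subquotient R Y E\<^esub> = Y"
  by (simp_all add: subquotient_def)

lemma subquotient_abelian_group: "abelian_group (subquotient R Y E)"
proof (rule abelian_groupI)
  interpret Y: abelian_subgroup Y R by (rule YR)
  have z: "Y = Y +> \<zero>" using coset_eq_self_iff[OF YR, of \<zero>] lsubD(3)[OF Y] by simp
  have zE: "\<zero> \<in> E" using lsubD(3)[OF E] by simp
  show "\<zero>\<^bsub>subquotient R Y E\<^esub> \<in> carrier (subquotient R Y E)"
    unfolding subquotient_zero subquotient_carrier using z zE by blast
  fix x assume "x \<in> carrier (subquotient R Y E)"
  then obtain u where u: "x = Y +> u" "u \<in> E" unfolding subquotient_carrier by blast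
  have "(Y +> \<zero>) \<oplus>\<^bsub>subquotient R Y E\<^esub> x = x" using subquotient_add[OF zE u(2)] u Ecarr by simp
  then show "\<zero>\<^bsub>subquotient R Y E\<^esub> \<oplus>\<^bsub>subquotient R Y E\<^esub> x = x" unfolding subquotient_zero using z by simp
  have mu: "\<ominus> u \<in> E" using lsubD(5)[OF E, of "\<ominus> \<one>" u] u(2) Ecarr by (simp add: l_minus)
  have "(Y +> (\<ominus> u)) \<oplus>\<^bsub>subquotient R Y E\<^esub> x = \<zero>\<^bsub>subquotient R Y E\<^esub>"
    using subquotient_add[OF mu u(2)] u Ecarr z by (simp add: l_neg subquotient_zero)
  then show "\<exists>y\<in>carrier (subquotient R Y E). y \<oplus>\<^bsub>subquotient R Y E\<^esub> x = \<zero>\<^bsub>subquotient R Y E\<^esub>"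
    using mu unfolding subquotient_carrier by blast
qed (use lsubD(4)[OF E] Ecarr in \<open>auto simp: subquotient_carrier subquotient_add a_ac\<close>)

lemma subquotient_left_module: "left_module (R Quot n) (subquotient R Y E)"
proof -
  interpret n: ideal n R by (rule n)
  have "left_module_axioms (R Quot n) (subquotient R Y E)"
  proof (unfold_locales, goal_cases)
    case (1 a x)
    then show ?case using lsubD(5)[OF E]
      by (auto simp: FactRing_def A_RCOSETS_def' subquotient_carrier subquotient_smult)
  next
    case (2 a b x)
    then show ?case using lsubD(5)[OF E] Ecarr
      by (auto simp: FactRing_def A_RCOSETS_def' subquotient_carrier subquotient_smult subquotient_add
          n.a_rcos_sum l_distr)
  next
    case (3 a x y)
    then show ?case using lsubD(4,5)[OF E] Ecarr
      by (auto simp: FactRing_def A_RCOSETS_def' subquotient_carrier subquotient_smult subquotient_add r_distr)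
  next
    case (4 a b x)
    then show ?case using lsubD(5)[OF E] Ecarr
      by (auto simp: FactRing_def A_RCOSETS_def' subquotient_carrier subquotient_smult n.rcoset_mult_add m_assoc)
  next
    case (5 x)
    then show ?case using Ecarr
      by (auto simp: FactRing_def subquotient_carrier subquotient_smult)
  qed
  then show ?thesis by (intro left_module.intro subquotient_abelian_group n.quotient_is_ring)
qed

text \<open>A submodule of cosets is the image of its preimage in \<open>E\<close>, which is a left
  ideal between \<open>Y\<close> and \<open>E\<close>.\<close>

lemma subquotient_simple:
  assumes ne: "Y \<noteq> E"
    and max: "\<forall>N. lsub (carrier R) (left_regular R) N \<and> Y \<subseteq> N \<and> N \<subseteq> E \<longrightarrow> N = Y \<or> N = E"
  shows "simple_module (R Quot n) (subquotient R Y E)"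
proof -
  let ?S = "subquotient R Y E"
  interpret n: ideal n R by (rule n)
  interpret S: left_module "R Quot n" ?S by (rule subquotient_left_module)
  have ceq: "Y +> x = Y \<longleftrightarrow> x \<in> Y" if "x \<in> E" for x
    using coset_eq_self_iff[OF YR Ecarr[OF that]] .
  obtain e where e: "e \<in> E" "e \<notin> Y" using ne YE by blast
  have "carrier ?S \<noteq> {\<zero>\<^bsub>?S\<^esub>}"
    using e ceq[OF e(1)] unfolding subquotient_carrier subquotient_zero by blast
  moreover have "N = {\<zero>\<^bsub>?S\<^esub>} \<or> N = carrier ?S" if N: "lsub (carrier (R Quot n)) ?S N" for N
  proof -
    let ?P = "{x \<in> E. Y +> x \<in> N}"
    have "lsub (carrier R) (left_regular R) ?P"
    proof (rule lsubI, goal_cases)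
      case 1
      then show ?case using Ecarr by auto
    next
      case 2
      then show ?case using lsubD(3)[OF E] lsubD(3)[OF N] ceq[of \<zero>] lsubD(3)[OF Y]
        by (simp add: subquotient_zero)
    next
      case (3 x y)
      then show ?case using lsubD(4)[OF E] lsubD(4)[OF N] subquotient_add by fastforce
    next
      case (4 a x)
      moreover have "n +> a \<in> carrier (R Quot n)"
        using 4(1) by (auto simp: FactRing_def A_RCOSETS_def')
      ultimately show ?case using lsubD(5)[OF E] lsubD(5)[OF N, of "n +> a" "Y +> x"] subquotient_smult[of a x]
        by simp
    qed
    moreover have "Y \<subseteq> ?P"
    proof
      fix x assume x: "x \<in> Y"
      then show "x \<in> ?P" using ceq[of x] YE lsubD(3)[OF N] by (auto simp: subquotient_zero)
    qed
    moreover have "?P \<subseteq> E" by blast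
    ultimately have "?P = Y \<or> ?P = E" using max by blast
    moreover have "N = (\<lambda>x. Y +> x) ` ?P"
      using lsubD(1)[OF N] unfolding subquotient_carrier by blast
    moreover have "(\<lambda>x. Y +> x) ` Y = {Y}" using ceq YE lsubD(3)[OF Y] by auto
    ultimately show ?thesis unfolding subquotient_carrier subquotient_zero by auto
  qed
  ultimately show ?thesis
    unfolding simple_module_def S.submodule_iff_lsub using S.left_module_axioms by blast
qed

lemma subquotient_module_ops:
  "carrier (subquotient_module R n Y E) = (\<lambda>x. Y +> x) ` E" "\<zero>\<^bsub>subquotient_module R n Y E\<^esub> = Y"
  "x \<in> E \<Longrightarrow> y \<in> E \<Longrightarrow> (Y +> x) \<oplus>\<^bsub>subquotient_module R n Y E\<^esub> (Y +> y) = Y +> (x \<oplus> y)"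
  "a \<in> carrier R \<Longrightarrow> x \<in> E \<Longrightarrow> a \<odot>\<^bsub>subquotient_module R n Y E\<^esub> (Y +> x) = Y +> (a \<otimes> x)"
  using subquotient_add subquotient_smult subquotient_carrier subquotient_zero
  by (simp_all add: subquotient_module_def restrict_scalars_def)

lemma subquotient_module_left_module: "left_module R (subquotient_module R n Y E)"
proof -
  have "abelian_group (subquotient_module R n Y E)"
    by (rule abelian_group_cong[OF subquotient_abelian_group])
      (simp_all add: subquotient_module_def restrict_scalars_def)
  moreover have "left_module_axioms R (subquotient_module R n Y E)"
    by (unfold_locales)
      (use lsubD(4,5)[OF E] Ecarr in \<open>auto simp: subquotient_module_ops l_distr r_distr m_assoc\<close>)
  ultimately show ?thesis by (intro left_module.intro ring_axioms)
qed

end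

end

section \<open>Distinct cofinite ideals under quasicommutativity\<close>

context assoc_alg
begin

text \<open>\<open>L\<close> modulo \<open>m\<close> represents the simple module at
  \<open>m\<close> by cosets. It exists because the interval from \<open>m\<close> to
  \<open>A\<close> has finite length.\<close>

lemma minimal_left_ideal_over:
  assumes m: "m \<in> cfs K A"
  obtains L where "lsub (carrier A) (left_regular A) L" "m \<subseteq> L" "m \<noteq> L"
    "\<And>N. lsub (carrier A) (left_regular A) N \<Longrightarrow> m \<subseteq> N \<Longrightarrow> N \<subseteq> L \<Longrightarrow> N = m \<or> N = L"
proof -
  interpret m: maximalideal m A using m unfolding cfs_iff by blast
  interpret reg: left_module A "left_regular A" by (rule left_regular_module)
  have fl: "flen (carrier A) (left_regular A) m (carrier A)"
    using m flen_scalars_mono[OF _ scal_subset] unfolding cfs_iff by blast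
  have ex: "\<exists>N. lsub (carrier A) (left_regular A) N \<and> m \<subseteq> N \<and> N \<subseteq> carrier A \<and> N \<noteq> m"
    using reg.lsub_carrier m.a_subset m.I_notcarr by (intro exI[of _ "carrier A"]) auto
  obtain L where L: "lsub (carrier A) (left_regular A) L" "m \<subseteq> L" "L \<subseteq> carrier A" "L \<noteq> m"
    "\<And>N'. lsub (carrier A) (left_regular A) N' \<Longrightarrow> m \<subseteq> N' \<Longrightarrow> N' \<subset> L \<Longrightarrow> \<not> N' \<noteq> m"
    by (rule flen_minimal[OF fl ex]) (rule that)
  show ?thesis using L by (intro that[of L]) blast+
qed

text \<open>
  If \<open>b \<in> m \<inter> n\<close> were not in \<open>N\<^sub>0\<close>, some homomorphism \<open>m \<rightarrow> T\<close> to a simple module over \<open>A / n\<close> would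
  not kill \<open>b\<close>. On the other hand, \<open>l \<mapsto> f (b l)\<close> vanishes for all such \<open>f\<close> and \<open>b\<close> when \<open>l \<in> m\<close>, and,
  because \<open>Ext\<^sup>1\<close> vanishes, also for \<open>l\<close> in a left ideal that is minimal over \<open>m\<close>; the set of these
  \<open>l\<close> is a two-sided ideal, so it contains \<open>1\<close>.
\<close>

lemma quasicommutative_Int_subset:
  assumes qc: "quasicommutative K A" and m: "m \<in> cfs K A" and n: "n \<in> cfs K A" and mn: "m \<noteq> n"
    and N0: "lsub (carrier A) (left_regular A) N0" and prod: "\<And>b a. b \<in> n \<Longrightarrow> a \<in> m \<Longrightarrow> b \<otimes> a \<in> N0"
  shows "m \<inter> n \<subseteq> N0"
proof (rule ccontr)
  let ?A = "left_regular A"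
  let ?L = "lsub (carrier A) ?A"
  interpret reg: left_module A ?A by (rule left_regular_module)
  interpret m: maximalideal m A using m unfolding cfs_iff by blast
  interpret n: maximalideal n A using n unfolding cfs_iff by blast
  note im = m.ideal_axioms and iN = n.ideal_axioms
  note lm = ideal_lsub[OF im] and ln = ideal_lsub[OF iN]
  assume "\<not> m \<inter> n \<subseteq> N0"
  then obtain b where b: "b \<in> m" "b \<in> n" "b \<notin> N0" by blast
  \<comment> \<open>For a maximal member \<open>N\<close> of this family, \<open>m / N\<close> will
    be the module \<open>T\<close>; its coset map does not kill \<open>b\<close>.\<close>
  let ?\<A> = "{N. ?L N \<and> N0 \<inter> m \<subseteq> N \<and> N \<subseteq> m \<and> b \<notin> N}"
  have "\<exists>M\<in>?\<A>. \<forall>N\<in>?\<A>. M \<subseteq> N \<longrightarrow> N = M"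
  proof (rule subset_Zorn_nonempty)
    show "?\<A> \<noteq> {}" using lsub_Int[OF N0 lm] b by blast
    fix C assume C: "C \<noteq> {}" "subset.chain ?\<A> C"
    have mem: "?L N" "N0 \<inter> m \<subseteq> N" "N \<subseteq> m" "b \<notin> N" if "N \<in> C" for N
      using C(2) that unfolding subset.chain_def by auto
    have chain: "N \<subseteq> N' \<or> N' \<subseteq> N" if "N \<in> C" "N' \<in> C" for N N'
      using C(2) that unfolding subset.chain_def by auto
    have "?L (\<Union>C)"
    proof (rule lsubI)
      show "\<Union>C \<subseteq> carrier ?A" using lsubD(1)[OF mem(1)] by blast
      show "\<zero>\<^bsub>?A\<^esub> \<in> \<Union>C" using C(1) lsubD(3)[OF mem(1)] by blast
      show "x \<oplus>\<^bsub>?A\<^esub> y \<in> \<Union>C" if xy: "x \<in> \<Union>C" "y \<in> \<Union>C" for x y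
      proof -
        obtain N N' where "x \<in> N" "N \<in> C" "y \<in> N'" "N' \<in> C" using xy by blast
        then obtain N'' where "N'' \<in> C" "x \<in> N''" "y \<in> N''" using chain by blast
        then show ?thesis using lsubD(4)[OF mem(1)] by blast
      qed
      show "a \<odot>\<^bsub>?A\<^esub> x \<in> \<Union>C" if "a \<in> carrier A" "x \<in> \<Union>C" for a x
        using that lsubD(5)[OF mem(1)] by blast
    qed
    then show "\<Union>C \<in> ?\<A>" using C(1) mem(2-4) by blast
  qed
  then obtain N where N: "?L N" "N0 \<inter> m \<subseteq> N" "N \<subseteq> m" "b \<notin> N"
    and Nmax: "\<And>N'. ?L N' \<Longrightarrow> N \<subseteq> N' \<Longrightarrow> N' \<subseteq> m \<Longrightarrow> b \<notin> N' \<Longrightarrow> N' = N" by auto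
  have nmN: "a \<otimes> x \<in> N" if "a \<in> n" "x \<in> m" for a x
    using prod[OF that] N(2) m.I_l_closed[OF that(2) n.a_Hcarr[OF that(1)]] by blast
  obtain Ln where Ln: "?L Ln" "n \<subseteq> Ln" "n \<noteq> Ln"
    "\<And>N. ?L N \<Longrightarrow> n \<subseteq> N \<Longrightarrow> N \<subseteq> Ln \<Longrightarrow> N = n \<or> N = Ln"
    by (rule minimal_left_ideal_over[OF n]) (rule that)
  obtain Lm where Lm: "?L Lm" "m \<subseteq> Lm" "m \<noteq> Lm"
    "\<And>N. ?L N \<Longrightarrow> m \<subseteq> N \<Longrightarrow> N \<subseteq> Lm \<Longrightarrow> N = m \<or> N = Lm"
    by (rule minimal_left_ideal_over[OF m]) (rule that)
  \<comment> \<open>Maximality only says that \<open>b\<close> lies in every left ideal inside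
    \<open>m\<close> that is strictly above \<open>N\<close>. Simplicity of \<open>m / N\<close>
    also uses that \<open>n\<close> annihilates it, so that \<open>Ln y + N\<close> over
    \<open>N\<close> is zero or simple.\<close>
  have max: "N' = N \<or> N' = m" if N': "?L N'" "N \<subseteq> N'" "N' \<subseteq> m" for N'
  proof (cases "N' = N")
    case False
    then have bN': "b \<in> N'" using Nmax N' by blast
    \<comment> \<open>Otherwise \<open>Ln y + N\<close> is simple over \<open>N\<close> and not
      contained in \<open>N'\<close>, so it meets \<open>N'\<close> only in \<open>N\<close>; but
      both contain \<open>b\<close>. This is read off from the left ideal \<open>?D\<close> between
      \<open>n\<close> and \<open>Ln\<close>.\<close>
    have LnN': "l \<otimes> y \<in> N'" if l: "l \<in> Ln" and y: "y \<in> m" for l y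
    proof (rule ccontr)
      assume ly: "l \<otimes> y \<notin> N'"
      have yc: "y \<in> carrier A" using y m.a_Hcarr by blast
      let ?Y = "(\<lambda>l. l \<otimes> y) ` Ln"
      have Yl: "?L ?Y"
        using lsubD(2)[OF Ln(1)] yc
        by (intro lsub_image[OF reg.left_module_axioms reg.left_module_axioms Ln(1)]) (auto simp: l_distr m_assoc)
      let ?Z = "lsum ?A ?Y N"
      have "?L ?Z" using reg.lsub_lsum[OF Yl N(1)] .
      moreover have "N \<subseteq> ?Z" "?Y \<subseteq> ?Z" using reg.lsum_superset[OF Yl N(1)] by auto
      moreover have "?Z \<subseteq> m"
        using m.I_l_closed[OF y] lsubD(2)[OF Ln(1)] N(3) m.a_closed unfolding lsum_def by auto
      moreover have "?Z \<noteq> N" using \<open>?Y \<subseteq> ?Z\<close> l ly N'(2) by blast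
      ultimately have "b \<in> ?Z" using Nmax by blast
      then obtain l' s where ls: "l' \<in> Ln" "s \<in> N" "b = l' \<otimes> y \<oplus> s" unfolding lsum_def by auto
      let ?D = "{l \<in> Ln. l \<otimes> y \<in> N'}"
      have "?L ?D"
        using lsub_preimage[OF reg.left_module_axioms reg.left_module_axioms N'(1) Ln(1), of "\<lambda>l. l \<otimes> y"]
          lsubD(2)[OF Ln(1)] yc by (simp add: l_distr m_assoc)
      moreover have "n \<subseteq> ?D" using nmN y N'(2) Ln(2) by blast
      ultimately have "?D = n \<or> ?D = Ln" using Ln(4) by blast
      moreover have "l' \<otimes> y \<in> N'"
        using reg.lsub_cancel[OF N'(1), of "l' \<otimes> y" s] ls lsubD(2)[OF Ln(1)] yc N'(2) bN' by auto
      moreover have "l' \<notin> n" using nmN[of l' y] y ls N(4) lsubD(4)[OF N(1)] by auto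
      ultimately have "?D = Ln" using ls(1) by blast
      then show False using l ly by blast
    qed
    \<comment> \<open>A two-sided ideal that contains \<open>Ln\<close>, hence strictly more than
      the maximal ideal \<open>n\<close>.\<close>
    let ?I = "{a \<in> carrier A. \<forall>y\<in>m. a \<otimes> y \<in> N'}"
    have "ideal ?I A"
    proof (rule lsub_idealI)
      show "?L ?I"
        using lsubD[OF N'(1)] m.a_Hcarr by (intro lsubI) (auto simp: l_distr m_assoc)
      show "a \<otimes> x \<in> ?I" if "a \<in> ?I" "x \<in> carrier A" for a x
        using that m.I_l_closed m.a_Hcarr by (auto simp: m_assoc)
    qed
    moreover have "n \<subseteq> ?I" "Ln \<subseteq> ?I" using LnN' Ln(2) lsubD(2)[OF Ln(1)] by auto
    ultimately have "?I = carrier A" using n.I_maximal[of ?I] Ln(2,3) by blast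
    then have "\<one> \<in> ?I" by simp
    then have "m \<subseteq> N'" using m.a_Hcarr by auto
    then show ?thesis using N'(3) by blast
  qed auto
  have max': "\<forall>N'. ?L N' \<and> N \<subseteq> N' \<and> N' \<subseteq> m \<longrightarrow> N' = N \<or> N' = m" using max by blast
  have Lm4: "\<forall>N. ?L N \<and> m \<subseteq> N \<and> N \<subseteq> Lm \<longrightarrow> N = m \<or> N = Lm" using Lm(4) by blast
  have nmN': "\<forall>a\<in>n. \<forall>x\<in>m. a \<otimes> x \<in> N" using nmN by blast
  have mLm: "a \<otimes> x \<in> m" if "a \<in> m" "x \<in> Lm" for a x
    using m.I_r_closed[OF that(1)] lsubD(2)[OF Lm(1) that(2)] by simp
  have mLm': "\<forall>a\<in>m. \<forall>x\<in>Lm. a \<otimes> x \<in> m" using mLm by blast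
  \<comment> \<open>\<open>S\<close> is \<open>Lm / m\<close> and \<open>T\<close> is
    \<open>m / N\<close>: representatives of the simple modules at \<open>m\<close> and at
    \<open>n\<close>.\<close>
  define S where "S = subquotient_module A m m Lm"
  define T where "T = subquotient_module A n N m"
  note Sdef = S_def[unfolded subquotient_module_def]
  note Tdef = T_def[unfolded subquotient_module_def]
  note Sops = subquotient_module_ops[OF im lm Lm(1,2) mLm', folded S_def]
  note Tops = subquotient_module_ops[OF iN N(1) lm N(3) nmN', folded T_def]
  have Smod: "left_module A S"
    using subquotient_module_left_module[OF im lm Lm(1,2) mLm'] unfolding S_def .
  interpret T: left_module A T
    using subquotient_module_left_module[OF iN N(1) lm N(3) nmN'] unfolding T_def .
  have "S \<in> simples_at A m"
    using subquotient_simple[OF im lm Lm(1,2) mLm' Lm(3) Lm4] unfolding Sdef simples_at_def by blast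
  moreover have "T \<in> simples_at A n"
    using subquotient_simple[OF iN N(1) lm N(3) nmN' _ max'] b N(4) unfolding Tdef simples_at_def by blast
  ultimately have triv: "trivial_group (Ext1 A S T)"
    using qc m n mn unfolding quasicommutative_def by blast
  define hom where "hom = (\<lambda>f. (\<forall>x\<in>m. f x \<in> carrier T) \<and> (\<forall>x\<in>m. \<forall>y\<in>m. f (x \<oplus> y) = f x \<oplus>\<^bsub>T\<^esub> f y) \<and>
    (\<forall>a\<in>carrier A. \<forall>x\<in>m. f (a \<otimes> x) = a \<odot>\<^bsub>T\<^esub> f x))"
  have homD: "f x \<in> carrier T" "y \<in> m \<Longrightarrow> f (x \<oplus> y) = f x \<oplus>\<^bsub>T\<^esub> f y"
    "a \<in> carrier A \<Longrightarrow> f (a \<otimes> x) = a \<odot>\<^bsub>T\<^esub> f x" if "hom f" "x \<in> m" for f x y a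
    using that unfolding hom_def by auto
  have nT: "c \<odot>\<^bsub>T\<^esub> t = \<zero>\<^bsub>T\<^esub>" if c: "c \<in> n" and t: "t \<in> carrier T" for c t
  proof -
    obtain x where x: "x \<in> m" "t = N +> x" using t unfolding Tops(1) by blast
    have "N +> (c \<otimes> x) = N"
      using nmN[OF c x(1)] coset_eq_self_iff[OF lsub_abelian_subgroup[OF N(1)]] m.a_Hcarr[OF x(1)] n.a_Hcarr[OF c]
      by simp
    then show ?thesis using Tops(4)[OF n.a_Hcarr[OF c] x(1)] x(2) Tops(2) by simp
  qed
  let ?I = "{l \<in> carrier A. \<forall>f c. hom f \<longrightarrow> c \<in> m \<inter> n \<longrightarrow> f (c \<otimes> l) = \<zero>\<^bsub>T\<^esub>}"
  have I1: "ideal ?I A"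
  proof (rule lsub_idealI)
    show "?L ?I"
    proof (rule lsubI, goal_cases)
      case 2
      have "f (c \<otimes> \<zero>) = \<zero>\<^bsub>T\<^esub>" if f: "hom f" and c: "c \<in> m \<inter> n" for f c
        using homD(3)[OF f, of \<zero> \<zero>] homD(1)[OF f, of \<zero>] c m.a_Hcarr m.zero_closed by simp
      then show ?case by simp
    next
      case (3 x y)
      have "f (c \<otimes> (x \<oplus> y)) = \<zero>\<^bsub>T\<^esub>" if f: "hom f" and c: "c \<in> m \<inter> n" for f c
      proof -
        have "f (c \<otimes> x) = \<zero>\<^bsub>T\<^esub>" "f (c \<otimes> y) = \<zero>\<^bsub>T\<^esub>" using 3 f c by blast+
        moreover have "c \<otimes> (x \<oplus> y) = c \<otimes> x \<oplus> c \<otimes> y" using 3 c m.a_Hcarr[of c] by (simp add: r_distr)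
        ultimately show ?thesis
          using homD(2)[OF f, of "c \<otimes> x" "c \<otimes> y"] 3 c m.I_r_closed[of c] by simp
      qed
      then show ?case using 3 by simp
    next
      case (4 a x)
      have "f (c \<otimes> (a \<otimes> x)) = \<zero>\<^bsub>T\<^esub>" if f: "hom f" and c: "c \<in> m \<inter> n" for f c
      proof -
        have "c \<otimes> a \<in> m \<inter> n" using c 4(1) m.I_r_closed n.I_r_closed by blast
        then have "f ((c \<otimes> a) \<otimes> x) = \<zero>\<^bsub>T\<^esub>" using 4(2) f by blast
        then show ?thesis using c m.a_Hcarr[of c] 4 by (simp add: m_assoc)
      qed
      then show ?case using 4 by simp
    qed auto
    show "l \<otimes> x \<in> ?I" if l: "l \<in> ?I" and x: "x \<in> carrier A" for l x
    proof -
      have "f (c \<otimes> (l \<otimes> x)) = \<zero>\<^bsub>T\<^esub>" if f: "hom f" and c: "c \<in> m \<inter> n" for f c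
      proof -
        \<comment> \<open>Right multiplication by \<open>x\<close> maps \<open>m\<close> linearly to
          itself, so it can be composed with \<open>f\<close>. This is why \<open>?I\<close>
          quantifies over all homomorphisms and not just over the coset map.\<close>
        have "hom (\<lambda>y. f (y \<otimes> x))"
          unfolding hom_def
          using homD[OF f] m.I_r_closed x m.a_Hcarr by (simp add: l_distr m_assoc)
        then have "f ((c \<otimes> l) \<otimes> x) = \<zero>\<^bsub>T\<^esub>" using l c by blast
        then show ?thesis using c m.a_Hcarr[of c] l x by (simp add: m_assoc)
      qed
      then show ?thesis using l x by simp
    qed
  qed
  have I2: "m \<subseteq> ?I"
  proof -
    have "f (c \<otimes> l) = \<zero>\<^bsub>T\<^esub>" if "hom f" "c \<in> m \<inter> n" "l \<in> m" for f c l
      using homD(3)[OF that(1,3), of c] nT[of c "f l"] homD(1)[OF that(1,3)] that(2) m.a_Hcarr[of c] by simp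
    then show ?thesis using m.a_Hcarr by blast
  qed
  \<comment> \<open>\<open>f\<close> extends to some \<open>f'\<close> on \<open>Lm\<close> because
    \<open>Lm / m\<close> is \<open>S\<close>. Then \<open>f (c l)\<close> equals \<open>c\<close>
    times \<open>f' l\<close>, and \<open>c\<close> lies in \<open>n\<close>, which annihilates
    \<open>T\<close>.\<close>
  have I3: "Lm \<subseteq> ?I"
  proof -
    have "f (c \<otimes> l) = \<zero>\<^bsub>T\<^esub>" if f: "hom f" and c: "c \<in> m \<inter> n" and l: "l \<in> Lm" for f c l
    proof -
      have P: "left_module A (?A\<lparr>carrier := Lm\<rparr>)" by (rule reg.lsub_left_module[OF Lm(1)])
      have Q: "m = {x \<in> Lm. m +> x = m}"
        using coset_eq_self_iff[OF lsub_abelian_subgroup[OF lm]] Lm(2) lsubD(2)[OF Lm(1)] by auto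
      obtain f' where f': "\<And>x. x \<in> carrier (?A\<lparr>carrier := Lm\<rparr>) \<Longrightarrow> f' x \<in> carrier T"
        "\<And>a x. a \<in> carrier A \<Longrightarrow> x \<in> carrier (?A\<lparr>carrier := Lm\<rparr>) \<Longrightarrow>
          f' (a \<odot>\<^bsub>?A\<lparr>carrier := Lm\<rparr>\<^esub> x) = a \<odot>\<^bsub>T\<^esub> f' x"
        "\<And>x. x \<in> m \<Longrightarrow> f' x = f x"
        by (rule Ext1_trivial_imp_extension[OF P Smod T.left_module_axioms triv, of "\<lambda>x. m +> x" m f])
          (use Q Sops homD[OF f] in auto)
      have "f (c \<otimes> l) = f' (c \<otimes> l)" using f'(3) mLm c l by simp
      also have "\<dots> = c \<odot>\<^bsub>T\<^esub> f' l" using f'(2)[of c l] c l m.a_Hcarr by simp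
      also have "\<dots> = \<zero>\<^bsub>T\<^esub>" using nT f'(1) c l by simp
      finally show ?thesis .
    qed
    then show ?thesis using lsubD(2)[OF Lm(1)] by auto
  qed
  have "?I = m \<or> ?I = carrier A" by (rule m.I_maximal[OF I1 I2]) (rule Collect_restrict)
  moreover have "?I \<noteq> m" using I3 Lm(2,3) by (metis subset_antisym)
  ultimately have "?I = carrier A" by argo
  then have "\<one> \<in> ?I" by simp
  \<comment> \<open>The coset map, with \<open>l\<close> equal to 1 and \<open>c\<close> equal to
    \<open>b\<close>, puts \<open>b\<close> into \<open>N\<close>.\<close>
  moreover have "hom (\<lambda>x. N +> x)"
    unfolding hom_def using Tops by auto
  ultimately have "N +> (b \<otimes> \<one>) = \<zero>\<^bsub>T\<^esub>" using b by blast
  then show False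
    using coset_eq_self_iff[OF lsub_abelian_subgroup[OF N(1)], of b] b N(4) m.a_Hcarr[OF b(1)] Tops(2) by simp
qed

lemma quasicommutative_ideal_prod_commute:
  assumes qc: "quasicommutative K A" and m: "m \<in> cfs K A" and n: "n \<in> cfs K A"
  shows "m \<cdot> n = n \<cdot> m"
proof -
  have eq: "n \<cdot> m = m \<inter> n" if mn: "m \<in> cfs K A" "n \<in> cfs K A" "m \<noteq> n" for m n
  proof
    note I = cfs_ideal[OF mn(2)] cfs_ideal[OF mn(1)]
    show "m \<inter> n \<subseteq> n \<cdot> m"
      by (rule quasicommutative_Int_subset[OF qc mn ideal_lsub[OF ideal_prod_is_ideal[OF I]]])
        (rule ideal_prod.prod)
    show "n \<cdot> m \<subseteq> m \<inter> n" using ideal_prod_inter[OF I] by blast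
  qed
  show ?thesis using eq[OF m n] eq[OF n m] by (cases "m = n") (auto simp: Int_commute)
qed

end

section \<open>Primary decomposition of locally finite modules\<close>

context ring
begin

definition comaximal :: "'a set \<Rightarrow> 'a set \<Rightarrow> bool" where
  "comaximal I J \<longleftrightarrow> (\<exists>i\<in>I. \<exists>j\<in>J. \<one> = i \<oplus> j)"

lemma comaximal_sym: "ideal I R \<Longrightarrow> ideal J R \<Longrightarrow> comaximal I J \<Longrightarrow> comaximal J I"
  unfolding comaximal_def using ideal.Icarr a_comm by metis

lemma comaximal_ideal_prod:
  assumes I: "ideal I R" and J: "ideal J R" and J': "ideal J' R"
    and "comaximal I J" "comaximal I J'"
  shows "comaximal I (J \<cdot> J')"
proof -
  interpret I: ideal I R by fact
  obtain i j i' j' where ij: "i \<in> I" "j \<in> J" "\<one> = i \<oplus> j" "i' \<in> I" "j' \<in> J'" "\<one> = i' \<oplus> j'"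
    using assms(4,5) unfolding comaximal_def by blast
  have c: "i \<in> carrier R" "j \<in> carrier R" "i' \<in> carrier R" "j' \<in> carrier R"
    using ij ideal.Icarr[OF I] ideal.Icarr[OF J] ideal.Icarr[OF J'] by auto
  \<comment> \<open>In the expansion of the product of the two decompositions every term except
    \<open>j j'\<close> has a factor in \<open>I\<close>.\<close>
  have "\<one> = (i \<oplus> j) \<otimes> (i' \<oplus> j')" unfolding ij(3)[symmetric] ij(6)[symmetric] by simp
  also have "\<dots> = (i \<otimes> (i' \<oplus> j') \<oplus> j \<otimes> i') \<oplus> j \<otimes> j'"
    using c by (simp add: l_distr r_distr a_ac)
  finally have "\<one> = (i \<otimes> (i' \<oplus> j') \<oplus> j \<otimes> i') \<oplus> j \<otimes> j'" .
  moreover have "i \<otimes> (i' \<oplus> j') \<oplus> j \<otimes> i' \<in> I"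
    using ij c I.I_l_closed I.I_r_closed I.a_closed by simp
  moreover have "j \<otimes> j' \<in> J \<cdot> J'" using ij by (intro ideal_prod.prod)
  ultimately show ?thesis unfolding comaximal_def by blast
qed

lemma comaximal_carrier: "ideal I R \<Longrightarrow> comaximal I (carrier R)"
  unfolding comaximal_def
  by (intro bexI[of _ \<zero>] bexI[of _ \<one>]) (auto simp: additive_subgroup.zero_closed ideal.axioms(1))

lemma maximalideal_comaximal:
  assumes m: "maximalideal m R" and n: "maximalideal n R" and mn: "m \<noteq> n"
  shows "comaximal m n"
proof -
  interpret m: maximalideal m R by fact
  interpret n: maximalideal n R by fact
  have i: "ideal (m <+> n) R" by (rule add_ideals[OF m.ideal_axioms n.ideal_axioms])
  have "x = x \<oplus> \<zero>" if "x \<in> m" for x using that m.a_Hcarr by simp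
  then have 1: "m \<subseteq> m <+> n" using n.zero_closed unfolding set_add_def' by blast
  have "x = \<zero> \<oplus> x" if "x \<in> n" for x using that n.a_Hcarr by simp
  then have 2: "n \<subseteq> m <+> n" using m.zero_closed unfolding set_add_def' by blast
  have c: "m <+> n \<subseteq> carrier R" using ideal.Icarr[OF i] by blast
  have "\<not> n \<subseteq> m" using n.I_maximal[OF m.ideal_axioms _ m.a_subset] m.I_notcarr mn by blast
  then have "m <+> n = carrier R" using m.I_maximal[OF i 1 c] 2 by blast
  then have "\<one> \<in> m <+> n" by simp
  then show ?thesis unfolding comaximal_def set_add_def' by blast
qed

lemma comaximal_list_prod:
  assumes "ideal I R" "\<forall>m\<in>set ms. ideal m R \<and> comaximal I m"
  shows "comaximal I (ideal_list_prod R ms)"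
  using assms(2)
proof (induction ms)
  case (Cons m ms)
  then show ?case
    by (auto intro!: comaximal_ideal_prod assms(1) ideal_list_prod_ideal)
qed (use comaximal_carrier[OF assms(1)] in simp)

lemma comaximal_power:
  assumes "ideal I R" "ideal J R" "comaximal I J"
  shows "comaximal (ideal_power R I k) (ideal_power R J l)"
proof -
  have J: "ideal (ideal_power R J l) R" unfolding ideal_power_eq using assms by (intro ideal_list_prod_ideal) auto
  have I: "ideal (ideal_power R I k) R" unfolding ideal_power_eq using assms by (intro ideal_list_prod_ideal) auto
  have "comaximal I (ideal_power R J l)"
    unfolding ideal_power_eq using assms by (intro comaximal_list_prod) auto
  then have "comaximal (ideal_power R J l) I" using comaximal_sym assms J by blast
  then have "comaximal (ideal_power R J l) (ideal_power R I k)"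
    unfolding ideal_power_eq[of R I] using assms J by (intro comaximal_list_prod) auto
  then show ?thesis using comaximal_sym I J by blast
qed

lemma ideal_power_ideal: "ideal n R \<Longrightarrow> ideal (ideal_power R n k) R"
  unfolding ideal_power_eq by (intro ideal_list_prod_ideal) auto

lemma ideal_power_antimono:
  assumes "ideal n R" "k \<le> l"
  shows "ideal_power R n l \<subseteq> ideal_power R n k"
  using assms(2)
proof (induction l rule: dec_induct)
  case (step l)
  then show ?case using ideal_prod_inter[OF ideal_power_ideal assms(1), of n l] assms(1) by auto
qed simp

end

context assoc_alg
begin

lemma cfs_list_prod_ideal: "set ms \<subseteq> cfs K A \<Longrightarrow> ideal (ideal_list_prod A ms) A"
  using cfs_ideal by (intro ideal_list_prod_ideal) auto

lemma cfs_comaximal: "m \<in> cfs K A \<Longrightarrow> n \<in> cfs K A \<Longrightarrow> m \<noteq> n \<Longrightarrow> comaximal m n"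
  unfolding cfs_iff by (blast intro: maximalideal_comaximal)

context
  assumes qc: "quasicommutative K A"
begin

lemma ideal_list_prod_commute1:
  "set ms \<subseteq> cfs K A \<Longrightarrow> n \<in> cfs K A \<Longrightarrow> ideal_list_prod A ms \<cdot> n = n \<cdot> ideal_list_prod A ms"
proof (induction ms)
  case Nil
  then show ?case using ideal_prod_one[OF cfs_ideal] ideal_prod_carrier_left[OF cfs_ideal] by simp
next
  case (Cons m ms)
  then have I: "ideal (ideal_list_prod A ms) A" "ideal m A" "ideal n A"
    using cfs_list_prod_ideal cfs_ideal by auto
  have "ideal_list_prod A ms \<cdot> m \<cdot> n = ideal_list_prod A ms \<cdot> (n \<cdot> m)"
    using quasicommutative_ideal_prod_commute[OF qc, of m n] Cons.prems I by (simp add: ideal_prod_assoc)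
  also have "\<dots> = n \<cdot> ideal_list_prod A ms \<cdot> m"
    using Cons I by (simp add: ideal_prod_assoc[symmetric])
  finally show ?case using I by (simp add: ideal_prod_assoc)
qed

lemma ideal_list_prod_commute:
  "set ms \<subseteq> cfs K A \<Longrightarrow> set ns \<subseteq> cfs K A \<Longrightarrow>
    ideal_list_prod A ms \<cdot> ideal_list_prod A ns = ideal_list_prod A ns \<cdot> ideal_list_prod A ms"
proof (induction ns)
  case Nil
  then show ?case
    using ideal_prod_one[OF cfs_list_prod_ideal] ideal_prod_carrier_left[OF cfs_list_prod_ideal] by simp
next
  case (Cons n ns)
  then have I: "ideal (ideal_list_prod A ms) A" "ideal (ideal_list_prod A ns) A" "ideal n A"
    using cfs_list_prod_ideal cfs_ideal by auto
  have "ideal_list_prod A ms \<cdot> (ideal_list_prod A ns \<cdot> n) = ideal_list_prod A ns \<cdot> (ideal_list_prod A ms \<cdot> n)"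
    using Cons I by (simp add: ideal_prod_assoc[symmetric])
  also have "\<dots> = ideal_list_prod A ns \<cdot> n \<cdot> ideal_list_prod A ms"
    using ideal_list_prod_commute1[of ms n] Cons.prems I by (simp add: ideal_prod_assoc)
  finally show ?case by simp
qed

text \<open>All copies of \<open>n\<close> are collected at once, so that every remaining factor is
  comaximal to \<open>n\<close>.\<close>

lemma ideal_list_prod_split:
  "set ms \<subseteq> cfs K A \<Longrightarrow> n \<in> cfs K A \<Longrightarrow> ideal_list_prod A ms =
    ideal_list_prod A (filter (\<lambda>m. m \<noteq> n) ms) \<cdot> ideal_power A n (count_list ms n)"
proof (induction ms)
  case Nil
  then show ?case using ideal_prod_one[OF oneideal] by simp
next
  case (Cons m ms)
  have I: "ideal (ideal_list_prod A (filter (\<lambda>m. m \<noteq> n) ms)) A" "ideal m A"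
      "ideal (ideal_power A n (count_list ms n)) A"
    using Cons.prems cfs_ideal by (auto intro!: cfs_list_prod_ideal ideal_power_ideal)
  show ?case
  proof (cases "m = n")
    case True
    then show ?thesis using Cons I by (simp add: ideal_prod_assoc)
  next
    case False
    have "m \<cdot> ideal_power A n (count_list ms n) = ideal_power A n (count_list ms n) \<cdot> m"
      using ideal_list_prod_commute1[of "replicate (count_list ms n) n" m] Cons.prems
      unfolding ideal_power_eq by (auto simp: set_replicate_conv_if)
    then show ?thesis using False Cons I by (simp add: ideal_prod_assoc)
  qed
qed

end

end

section \<open>Primary parts and locally finite vectors\<close>

context alg_module
begin

lemma lsub_primary_part:
  assumes n: "ideal n A"
  shows "lsub (carrier A) M (primary_part A M n)"
proof (rule lsubI)
  note I = ideal_power_ideal[OF n]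
  show "primary_part A M n \<subseteq> carrier M" unfolding primary_part_def by blast
  show "\<zero>\<^bsub>M\<^esub> \<in> primary_part A M n"
    unfolding primary_part_def using ideal.Icarr[OF I] by (auto intro!: exI[of _ 1])
  show "x \<oplus>\<^bsub>M\<^esub> y \<in> primary_part A M n" if xy: "x \<in> primary_part A M n" "y \<in> primary_part A M n" for x y
  proof -
    obtain k l where k: "k > 0" "x \<in> carrier M" "\<And>a. a \<in> ideal_power A n k \<Longrightarrow> a \<odot>\<^bsub>M\<^esub> x = \<zero>\<^bsub>M\<^esub>"
      and l: "y \<in> carrier M" "\<And>a. a \<in> ideal_power A n l \<Longrightarrow> a \<odot>\<^bsub>M\<^esub> y = \<zero>\<^bsub>M\<^esub>"
      using xy unfolding primary_part_def by blast
    have "a \<odot>\<^bsub>M\<^esub> (x \<oplus>\<^bsub>M\<^esub> y) = \<zero>\<^bsub>M\<^esub>" if a: "a \<in> ideal_power A n (max k l)" for a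
    proof -
      have "a \<in> ideal_power A n k" "a \<in> ideal_power A n l"
        using a ideal_power_antimono[OF n, of k "max k l"] ideal_power_antimono[OF n, of l "max k l"] by auto
      then show ?thesis using k(2) l(1) k(3)[of a] l(2)[of a] ideal.Icarr[OF I a] by (simp add: smult_r_distr)
    qed
    then show ?thesis using k(1,2) l(1) unfolding primary_part_def by (auto intro!: exI[of _ "max k l"])
  qed
  show "b \<odot>\<^bsub>M\<^esub> x \<in> primary_part A M n" if b: "b \<in> carrier A" and x: "x \<in> primary_part A M n" for b x
  proof -
    obtain k where k: "k > 0" "x \<in> carrier M" "\<And>a. a \<in> ideal_power A n k \<Longrightarrow> a \<odot>\<^bsub>M\<^esub> x = \<zero>\<^bsub>M\<^esub>"
      using x unfolding primary_part_def by blast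
    have "a \<odot>\<^bsub>M\<^esub> (b \<odot>\<^bsub>M\<^esub> x) = \<zero>\<^bsub>M\<^esub>" if a: "a \<in> ideal_power A n k" for a
      using k(3)[OF ideal.I_r_closed[OF I a b]] smult_assoc1[OF ideal.Icarr[OF I a] b k(2)] by simp
    then show ?thesis using k(1,2) b unfolding primary_part_def by (auto intro!: smult_closed)
  qed
qed

definition locfin :: "'m \<Rightarrow> bool" where
  "locfin x \<longleftrightarrow> flen F M {\<zero>\<^bsub>M\<^esub>} ((\<lambda>a. a \<odot>\<^bsub>M\<^esub> x) ` carrier A)"

lemma lsub_orbit: "x \<in> carrier M \<Longrightarrow> lsub (carrier A) M ((\<lambda>a. a \<odot>\<^bsub>M\<^esub> x) ` carrier A)"
  using lsub_smult_image left_module.lsub_carrier[OF left_regular_module] by simp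

lemma primary_part_locfin:
  assumes n: "n \<in> cfs K A" and noeth: "left_noetherian A" and x: "x \<in> primary_part A M n"
  shows "locfin x"
proof -
  obtain k where k: "x \<in> carrier M" "\<And>a. a \<in> ideal_power A n k \<Longrightarrow> a \<odot>\<^bsub>M\<^esub> x = \<zero>\<^bsub>M\<^esub>"
    using x unfolding primary_part_def by blast
  note I = ideal_lsub[OF ideal_power_ideal[OF cfs_ideal[OF n]], of k]
  have "flen F M {\<zero>\<^bsub>M\<^esub>} (lsum M ((\<lambda>a. a \<odot>\<^bsub>M\<^esub> x) ` carrier A) {\<zero>\<^bsub>M\<^esub>})"
    using k lsub_mono[OF I scal_subset] lsub_scal[OF lsub_zero] ideal_power_cofinite[OF n noeth]
    by (intro flen_smult_image) auto
  then show ?thesis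
    unfolding locfin_def using lsum_superset(1)[OF lsub_orbit[OF k(1)] lsub_zero]
    by (rule flen_mono[OF _ order_refl])
qed

lemma locfin_add:
  assumes x: "x \<in> carrier M" "locfin x" and y: "y \<in> carrier M" "locfin y"
  shows "locfin (x \<oplus>\<^bsub>M\<^esub> y)"
proof -
  interpret FM: left_module "A\<lparr>carrier := F\<rparr>" M by (rule scal_module)
  note X = lsub_orbit[OF x(1)] and Y = lsub_orbit[OF y(1)]
  have "flen F M {\<zero>\<^bsub>M\<^esub>} (lsum M ((\<lambda>a. a \<odot>\<^bsub>M\<^esub> x) ` carrier A) ((\<lambda>a. a \<odot>\<^bsub>M\<^esub> y) ` carrier A))"
    using FM.flen_lsum[of "(\<lambda>a. a \<odot>\<^bsub>M\<^esub> x) ` carrier A" "(\<lambda>a. a \<odot>\<^bsub>M\<^esub> y) ` carrier A"]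
      lsub_scal[OF X] lsub_scal[OF Y] lsubD(3)[OF X] lsubD(3)[OF Y] x(2) y(2)
    unfolding locfin_def by simp
  moreover have "(\<lambda>a. a \<odot>\<^bsub>M\<^esub> (x \<oplus>\<^bsub>M\<^esub> y)) ` carrier A \<subseteq>
      lsum M ((\<lambda>a. a \<odot>\<^bsub>M\<^esub> x) ` carrier A) ((\<lambda>a. a \<odot>\<^bsub>M\<^esub> y) ` carrier A)"
    unfolding lsum_def using x(1) y(1) smult_r_distr by blast
  ultimately show ?thesis unfolding locfin_def by (rule flen_mono[OF _ order_refl])
qed

lemma locfin_finsum:
  assumes "finite D" "\<And>i. i \<in> D \<Longrightarrow> g i \<in> carrier M \<and> locfin (g i)"
  shows "locfin (finsum M g D)"
  using assms
proof (induction D)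
  case empty
  have "(\<lambda>a. a \<odot>\<^bsub>M\<^esub> \<zero>\<^bsub>M\<^esub>) ` carrier A \<subseteq> {\<zero>\<^bsub>M\<^esub>}" by auto
  then show ?case unfolding locfin_def M.finsum_empty using flen_mono[OF flen_refl order_refl] by blast
next
  case (insert i D)
  then have "g \<in> D \<rightarrow> carrier M" "g i \<in> carrier M" by auto
  then show ?case using insert by (simp add: M.finsum_insert locfin_add M.finsum_closed)
qed

text \<open>Write \<open>1 = e + f\<close> with \<open>e\<close> in the product of the factors other
  than \<open>m\<close> and \<open>f\<close> in the power of \<open>m\<close>. Then
  \<open>e x\<close> is killed by that power and \<open>f x\<close> by the shorter product, to which
  the induction hypothesis applies.\<close>

lemma killed_decomposition:
  assumes qc: "quasicommutative K A"
  shows "set ms \<subseteq> cfs K A \<Longrightarrow> x \<in> carrier M \<Longrightarrow> \<forall>a\<in>ideal_list_prod A ms. a \<odot>\<^bsub>M\<^esub> x = \<zero>\<^bsub>M\<^esub> \<Longrightarrow>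
    \<exists>D g. finite D \<and> D \<subseteq> set ms \<and> (\<forall>n\<in>D. g n \<in> primary_part A M n) \<and> x = finsum M g D"
proof (induction ms arbitrary: x rule: length_induct)
  case (1 ms)
  show ?case
  proof (cases ms)
    case Nil
    then have "x = \<zero>\<^bsub>M\<^esub>" using 1(3,4) smult_one[of x] by auto
    then show ?thesis by (intro exI[of _ "{}"]) simp
  next
    case (Cons m ms0)
    define k where "k = count_list ms m"
    define ns where "ns = filter (\<lambda>p. p \<noteq> m) ms"
    have m: "m \<in> cfs K A" and ns: "set ns \<subseteq> cfs K A" "length ns < length ms" "m \<notin> set ns" "set ns \<subseteq> set ms"
      using 1(2) Cons length_filter_le[of "\<lambda>p. p \<noteq> m" ms0] unfolding ns_def by (auto simp: less_Suc_eq_le)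
    have k: "k > 0" unfolding k_def Cons by simp
    note Im = cfs_ideal[OF m]
    have split: "ideal_list_prod A ms = ideal_list_prod A ns \<cdot> ideal_power A m k"
      unfolding ns_def k_def by (rule ideal_list_prod_split[OF qc 1(2) m])
    \<comment> \<open>Both orders of the factors occur: \<open>a e\<close> with \<open>a\<close> in
      the power of \<open>m\<close> uses this one, \<open>a f\<close> with \<open>a\<close> in the
      shorter product the original one.\<close>
    have split': "ideal_list_prod A ms = ideal_power A m k \<cdot> ideal_list_prod A ns"
      unfolding split ideal_power_eq using m ns(1)
      by (intro ideal_list_prod_commute[OF qc]) (auto simp: set_replicate_conv_if)
    note I = cfs_list_prod_ideal[OF ns(1)] ideal_power_ideal[OF Im, of k]
    have "comaximal m (ideal_list_prod A ns)"
      using ns cfs_comaximal[OF m] cfs_ideal by (intro comaximal_list_prod Im) auto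
    then have "comaximal (ideal_list_prod A ns) m" using comaximal_sym Im I(1) by blast
    then have "comaximal (ideal_list_prod A ns) (ideal_power A m k)"
      unfolding ideal_power_eq using Im I(1) by (intro comaximal_list_prod) auto
    then obtain e f where ef: "e \<in> ideal_list_prod A ns" "f \<in> ideal_power A m k" "\<one> = e \<oplus> f"
      unfolding comaximal_def by blast
    have c: "e \<in> carrier A" "f \<in> carrier A" using ef ideal.Icarr[OF I(1)] ideal.Icarr[OF I(2)] by auto
    have "a \<odot>\<^bsub>M\<^esub> (e \<odot>\<^bsub>M\<^esub> x) = \<zero>\<^bsub>M\<^esub>" if a: "a \<in> ideal_power A m k" for a
      using 1(3,4) ideal_prod.prod[OF a ef(1), of A] smult_assoc1[OF ideal.Icarr[OF I(2) a] c(1), of x]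
      unfolding split' by simp
    then have ex: "e \<odot>\<^bsub>M\<^esub> x \<in> primary_part A M m"
      unfolding primary_part_def using k 1(3) c by (auto intro!: smult_closed)
    have fx: "f \<odot>\<^bsub>M\<^esub> x \<in> carrier M" using c 1(3) smult_closed by blast
    have "a \<odot>\<^bsub>M\<^esub> (f \<odot>\<^bsub>M\<^esub> x) = \<zero>\<^bsub>M\<^esub>" if a: "a \<in> ideal_list_prod A ns" for a
      using 1(3,4) ideal_prod.prod[OF a ef(2), of A] smult_assoc1[OF ideal.Icarr[OF I(1) a] c(2), of x]
      unfolding split by simp
    then have "\<exists>D g. finite D \<and> D \<subseteq> set ns \<and> (\<forall>n\<in>D. g n \<in> primary_part A M n) \<and> f \<odot>\<^bsub>M\<^esub> x = finsum M g D"
      using 1(1)[rule_format, OF ns(2,1) fx] by blast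
    then obtain D g where D: "finite D" "D \<subseteq> set ns" "\<forall>n\<in>D. g n \<in> primary_part A M n"
      "f \<odot>\<^bsub>M\<^esub> x = finsum M g D" by (elim exE conjE)
    let ?g = "g(m := e \<odot>\<^bsub>M\<^esub> x)"
    have mD: "m \<notin> D" using D(2) ns(3) by blast
    have gc: "g \<in> D \<rightarrow> carrier M" using D(3) unfolding primary_part_def by auto
    have "finsum M ?g (insert m D) = e \<odot>\<^bsub>M\<^esub> x \<oplus>\<^bsub>M\<^esub> finsum M ?g D"
      using M.finsum_insert[OF D(1) mD, of ?g] gc mD c 1(3) smult_closed by auto
    also have "finsum M ?g D = finsum M g D"
      using gc mD by (intro M.finsum_cong') auto
    also have "e \<odot>\<^bsub>M\<^esub> x \<oplus>\<^bsub>M\<^esub> finsum M g D = x"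
      using smult_l_distr[OF c 1(3)] ef(3) smult_one[OF 1(3)] D(4) by simp
    finally have "x = finsum M ?g (insert m D)" ..
    moreover have "\<forall>n\<in>insert m D. ?g n \<in> primary_part A M n" using D(3) ex by simp
    moreover have "insert m D \<subseteq> set ms" using D(2) ns(4) Cons by auto
    moreover have "finite (insert m D)" using D(1) by simp
    ultimately show ?thesis by (intro exI[of _ "insert m D"] exI[of _ ?g] conjI)
  qed
qed

text \<open>\<open>J\<close> is a product of powers of the ideals in \<open>D\<close>. It is
  comaximal to every power of \<open>n\<close>, so that the exponent that kills the component at
  \<open>n\<close> can be chosen afterwards.\<close>

lemma annihilator_of_family:
  assumes n: "n \<in> cfs K A" and "finite D" "D \<subseteq> cfs K A" "n \<notin> D" "\<And>p. p \<in> D \<Longrightarrow> g p \<in> primary_part A M p"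
  shows "\<exists>J. ideal J A \<and> (\<forall>k. comaximal (ideal_power A n k) J) \<and> (\<forall>a\<in>J. \<forall>p\<in>D. a \<odot>\<^bsub>M\<^esub> g p = \<zero>\<^bsub>M\<^esub>)"
  using assms(2-5)
proof (induction D)
  case empty
  then show ?case
    using comaximal_carrier[OF ideal_power_ideal[OF cfs_ideal[OF n]]] oneideal by (intro exI[of _ "carrier A"]) auto
next
  case (insert p D)
  have "\<exists>J. ideal J A \<and> (\<forall>k. comaximal (ideal_power A n k) J) \<and> (\<forall>a\<in>J. \<forall>p\<in>D. a \<odot>\<^bsub>M\<^esub> g p = \<zero>\<^bsub>M\<^esub>)"
    by (rule insert.IH) (use insert.prems in auto)
  then obtain J where J: "ideal J A" "\<And>k. comaximal (ideal_power A n k) J"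
    "\<And>a p. a \<in> J \<Longrightarrow> p \<in> D \<Longrightarrow> a \<odot>\<^bsub>M\<^esub> g p = \<zero>\<^bsub>M\<^esub>" by blast
  obtain l where l: "\<And>a. a \<in> ideal_power A p l \<Longrightarrow> a \<odot>\<^bsub>M\<^esub> g p = \<zero>\<^bsub>M\<^esub>"
    using insert.prems(3)[of p] unfolding primary_part_def by blast
  have p: "ideal p A" "comaximal n p" using insert.prems cfs_ideal cfs_comaximal[OF n] by auto
  have "J \<cdot> ideal_power A p l \<subseteq> J \<inter> ideal_power A p l"
    by (rule ideal_prod_inter[OF J(1) ideal_power_ideal[OF p(1)]])
  then have "\<forall>a\<in>J \<cdot> ideal_power A p l. \<forall>q\<in>insert p D. a \<odot>\<^bsub>M\<^esub> g q = \<zero>\<^bsub>M\<^esub>" using J(3) l by blast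
  moreover have "comaximal (ideal_power A n k) (J \<cdot> ideal_power A p l)" for k
    using J(1,2) p comaximal_power[OF cfs_ideal[OF n] p] cfs_ideal[OF n]
    by (intro comaximal_ideal_prod ideal_power_ideal) auto
  ultimately show ?case using ideal_prod_is_ideal[OF J(1) ideal_power_ideal[OF p(1)]] by blast
qed

text \<open>Write \<open>1 = i + j\<close> with \<open>i\<close> killing \<open>g n\<close> and
  \<open>j\<close> killing the other components. Applying \<open>j\<close> to the vanishing sum
  shows that \<open>j\<close> kills \<open>g n\<close> too, so 1 does.\<close>

lemma primary_parts_independent:
  assumes "finite D" "D \<subseteq> cfs K A" "\<And>p. p \<in> D \<Longrightarrow> g p \<in> primary_part A M p"
    and sum: "finsum M g D = \<zero>\<^bsub>M\<^esub>" and n: "n \<in> D"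
  shows "g n = \<zero>\<^bsub>M\<^esub>"
proof -
  have gc: "g p \<in> carrier M" if "p \<in> D" for p using assms(3)[OF that] unfolding primary_part_def by blast
  obtain k where k: "\<And>a. a \<in> ideal_power A n k \<Longrightarrow> a \<odot>\<^bsub>M\<^esub> g n = \<zero>\<^bsub>M\<^esub>"
    using assms(3)[OF n] unfolding primary_part_def by blast
  have n': "n \<in> cfs K A" using n assms(2) by blast
  let ?r = "finsum M g (D - {n})"
  have "\<exists>J. ideal J A \<and> (\<forall>k. comaximal (ideal_power A n k) J) \<and> (\<forall>a\<in>J. \<forall>p\<in>D - {n}. a \<odot>\<^bsub>M\<^esub> g p = \<zero>\<^bsub>M\<^esub>)"
    by (rule annihilator_of_family[OF n']) (use assms(1-3) in auto)
  then obtain J where J: "ideal J A" "comaximal (ideal_power A n k) J"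
    "\<And>a p. a \<in> J \<Longrightarrow> p \<in> D - {n} \<Longrightarrow> a \<odot>\<^bsub>M\<^esub> g p = \<zero>\<^bsub>M\<^esub>" by blast
  have rc: "?r \<in> carrier M" using gc by (intro M.finsum_closed) auto
  have "finsum M g (insert n (D - {n})) = g n \<oplus>\<^bsub>M\<^esub> ?r"
    using gc n assms(1) by (intro M.finsum_insert) auto
  then have eq: "g n \<oplus>\<^bsub>M\<^esub> ?r = \<zero>\<^bsub>M\<^esub>" using sum n by (simp add: insert_absorb)
  obtain i j where ij: "i \<in> ideal_power A n k" "j \<in> J" "\<one> = i \<oplus> j" using J(2) unfolding comaximal_def by blast
  have c: "i \<in> carrier A" "j \<in> carrier A"
    using ij ideal.Icarr[OF J(1)] ideal.Icarr[OF ideal_power_ideal[OF cfs_ideal[OF n']]] by auto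
  have "j \<odot>\<^bsub>M\<^esub> ?r = finsum M (\<lambda>p. j \<odot>\<^bsub>M\<^esub> g p) (D - {n})"
    using c gc assms(1) by (intro finsum_hom M.abelian_group_axioms) (auto simp: smult_r_distr smult_closed)
  also have "\<dots> = finsum M (\<lambda>p. \<zero>\<^bsub>M\<^esub>) (D - {n})"
    using J(3)[OF ij(2)] by (intro M.finsum_cong') auto
  finally have jr: "j \<odot>\<^bsub>M\<^esub> ?r = \<zero>\<^bsub>M\<^esub>" by (simp add: M.finsum_zero)
  have "j \<odot>\<^bsub>M\<^esub> (g n \<oplus>\<^bsub>M\<^esub> ?r) = j \<odot>\<^bsub>M\<^esub> g n" using c gc[OF n] rc jr by (simp add: smult_r_distr smult_closed)
  then have "j \<odot>\<^bsub>M\<^esub> g n = \<zero>\<^bsub>M\<^esub>" using eq c by simp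
  then show ?thesis
    using smult_l_distr[OF c gc[OF n]] k[OF ij(1)] ij(3) smult_one[OF gc[OF n]] by simp
qed

end

section \<open>Internal direct sums in terms of finite families\<close>

text \<open>Summation over \<open>sum_group\<close> is a homomorphism in any case; surjectivity is
  the spanning clause and injectivity the independence clause.\<close>

lemma is_direct_sum_iff:
  fixes M :: "('r, 'm) module"
  assumes M: "abelian_group M" and sub: "\<And>i. i \<in> I \<Longrightarrow> subgroup (H i) (add_monoid M)"
  shows "is_direct_sum M I H \<longleftrightarrow>
    (\<forall>x\<in>carrier M. \<exists>D g. finite D \<and> D \<subseteq> I \<and> (\<forall>i\<in>D. g i \<in> H i) \<and> x = finsum M g D) \<and>
    (\<forall>D g. finite D \<longrightarrow> D \<subseteq> I \<longrightarrow> (\<forall>i\<in>D. g i \<in> H i) \<longrightarrow> finsum M g D = \<zero>\<^bsub>M\<^esub> \<longrightarrow> (\<forall>i\<in>D. g i = \<zero>\<^bsub>M\<^esub>))"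
  (is "_ \<longleftrightarrow> ?span \<and> ?indep")
proof -
  interpret M: abelian_group M by fact
  let ?G = "\<lambda>i. (add_monoid M)\<lparr>carrier := H i\<rparr>"
  let ?S = "sum_group I ?G" and ?h = "\<lambda>f. gfinprod (add_monoid M) f I"
  have G: "group (?G i)" if "i \<in> I" for i
    using M.add.subgroup_imp_group[OF sub[OF that]] .
  have Hc: "x \<in> carrier M" if "i \<in> I" "x \<in> H i" for i x
    using subgroup.mem_carrier[OF sub[OF that(1)] that(2)] by simp
  have Hz: "\<zero>\<^bsub>M\<^esub> \<in> H i" if "i \<in> I" for i using subgroup.one_closed[OF sub[OF that]] by simp
  have carr: "carrier ?S = {f \<in> \<Pi>\<^sub>E i\<in>I. H i. finite {i \<in> I. f i \<noteq> \<zero>\<^bsub>M\<^esub>}}"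
    using carrier_sum_group[of I ?G] G by simp
  have val: "?h f = finsum M f {i \<in> I. f i \<noteq> \<zero>\<^bsub>M\<^esub>}" if "f \<in> carrier ?S" for f
    using that unfolding carr gfinprod_def finsum_def by simp
  have hom: "?h \<in> hom ?S (add_monoid M)"
  proof (rule homI)
    fix f assume f: "f \<in> carrier ?S"
    then have fc: "f \<in> I \<rightarrow> carrier M" "finite {i \<in> I. f i \<noteq> \<zero>\<^bsub>M\<^esub>}" unfolding carr using Hc by auto
    then show "?h f \<in> carrier (add_monoid M)" using M.add.gfinprod_closed[of f I] by simp
    fix g assume g: "g \<in> carrier ?S"
    then have gc: "g \<in> I \<rightarrow> carrier M" "finite {i \<in> I. g i \<noteq> \<zero>\<^bsub>M\<^esub>}" unfolding carr using Hc by auto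
    have "?h (f \<otimes>\<^bsub>?S\<^esub> g) = gfinprod (add_monoid M) (\<lambda>i. f i \<oplus>\<^bsub>M\<^esub> g i) I"
      using fc gc by (intro M.add.gfinprod_cong) (auto simp: simp_implies_def)
    also have "\<dots> = ?h f \<oplus>\<^bsub>M\<^esub> ?h g"
      using M.add.gfinprod_distrib[of I f g] fc gc by simp
    finally show "?h (f \<otimes>\<^bsub>?S\<^esub> g) = ?h f \<otimes>\<^bsub>add_monoid M\<^esub> ?h g" by simp
  qed
  interpret h: group_hom ?S "add_monoid M" ?h
    by (intro group_hom.intro group_hom_axioms.intro hom M.add.is_group sum_group G)
  have ext: "\<exists>f\<in>carrier ?S. ?h f = finsum M g D \<and> (\<forall>i\<in>D. f i = g i)"
    if D: "finite D" "D \<subseteq> I" "\<forall>i\<in>D. g i \<in> H i" for D g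
  proof -
    \<comment> \<open>Extended by zero, a finite family becomes an element of
      \<open>sum_group\<close> with the same sum.\<close>
    let ?f = "\<lambda>i\<in>I. if i \<in> D then g i else \<zero>\<^bsub>M\<^esub>"
    have fD: "{i \<in> I. ?f i \<noteq> \<zero>\<^bsub>M\<^esub>} \<subseteq> D" by auto
    have f: "?f \<in> carrier ?S"
      unfolding carr using D Hz finite_subset[OF fD D(1)] by auto
    have "?h ?f = finsum M ?f {i \<in> I. ?f i \<noteq> \<zero>\<^bsub>M\<^esub>}" by (rule val[OF f])
    also have "\<dots> = finsum M g D"
      using D fD Hc by (intro M.add.finprod_mono_neutral_cong_left) (auto split: if_splits)
    finally show ?thesis using f D(2) by (intro bexI[of _ ?f]) auto
  qed
  have surj: "?h ` carrier ?S = carrier M \<longleftrightarrow> ?span"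
  proof
    assume eq: "?h ` carrier ?S = carrier M"
    show ?span
    proof
      fix x assume "x \<in> carrier M"
      then have "x \<in> ?h ` carrier ?S" unfolding eq .
      then obtain f where f: "f \<in> carrier ?S" "x = ?h f" by (elim imageE)
      then show "\<exists>D g. finite D \<and> D \<subseteq> I \<and> (\<forall>i\<in>D. g i \<in> H i) \<and> x = finsum M g D"
        using val[OF f(1)] unfolding carr
        by (intro exI[of _ "{i \<in> I. f i \<noteq> \<zero>\<^bsub>M\<^esub>}"] exI[of _ f]) auto
    qed
  next
    assume sp: ?span
    have "carrier M \<subseteq> ?h ` carrier ?S"
    proof
      fix x assume "x \<in> carrier M"
      from bspec[OF sp this]
      obtain D g where D: "finite D" "D \<subseteq> I" "\<forall>i\<in>D. g i \<in> H i" "x = finsum M g D" by (elim exE conjE)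
      obtain f where f: "f \<in> carrier ?S" "?h f = finsum M g D" using ext[OF D(1-3)] by (elim bexE conjE)
      show "x \<in> ?h ` carrier ?S" unfolding D(4) f(2)[symmetric] using f(1) by (rule imageI)
    qed
    moreover have "?h ` carrier ?S \<subseteq> carrier M" using h.hom_closed by auto
    ultimately show "?h ` carrier ?S = carrier M" by blast
  qed
  have inj: "inj_on ?h (carrier ?S) \<longleftrightarrow> ?indep"
    unfolding h.inj_on_one_iff
  proof
    assume *: "\<forall>x. x \<in> carrier ?S \<longrightarrow> ?h x = \<one>\<^bsub>add_monoid M\<^esub> \<longrightarrow> x = \<one>\<^bsub>?S\<^esub>"
    show ?indep
    proof (intro allI impI ballI)
      fix D g i assume D: "finite D" "D \<subseteq> I" "\<forall>i\<in>D. g i \<in> H i" "finsum M g D = \<zero>\<^bsub>M\<^esub>" and i: "i \<in> D"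
      obtain f where f: "f \<in> carrier ?S" "?h f = finsum M g D" "\<forall>i\<in>D. f i = g i" using ext[OF D(1-3)] by (elim bexE conjE)
      then have "f = \<one>\<^bsub>?S\<^esub>" using * D(4) by simp
      then show "g i = \<zero>\<^bsub>M\<^esub>" using bspec[OF f(3) i] subsetD[OF D(2) i] by simp
    qed
  next
    assume ind: ?indep
    show "\<forall>x. x \<in> carrier ?S \<longrightarrow> ?h x = \<one>\<^bsub>add_monoid M\<^esub> \<longrightarrow> x = \<one>\<^bsub>?S\<^esub>"
    proof (intro allI impI)
      fix f assume f: "f \<in> carrier ?S" "?h f = \<one>\<^bsub>add_monoid M\<^esub>"
      have "f i = \<zero>\<^bsub>M\<^esub>" if i: "i \<in> {i \<in> I. f i \<noteq> \<zero>\<^bsub>M\<^esub>}" for i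
        using ind[rule_format, of "{i \<in> I. f i \<noteq> \<zero>\<^bsub>M\<^esub>}" f i] f val[OF f(1)] i unfolding carr by auto
      then have "f i = \<zero>\<^bsub>M\<^esub>" if "i \<in> I" for i using that by blast
      then show "f = \<one>\<^bsub>?S\<^esub>" using f(1) unfolding carr by (auto simp: fun_eq_iff PiE_def extensional_def)
    qed
  qed
  show ?thesis
    unfolding is_direct_sum_def iso_def bij_betw_def surj[symmetric] inj[symmetric] using sub hom by auto
qed

text \<open>Independence comes from comaximality for every module, so it remains to see that the
  finite sums of primary vectors are exactly the locally finite vectors.\<close>

theorem (in alg_module) direct_sum_primary_iff:
  assumes qc: "quasicommutative K A" and noeth: "left_noetherian A"
  shows "is_direct_sum M (cfs K A) (primary_part A M) \<longleftrightarrow> (\<forall>x\<in>carrier M. locfin x)"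
proof -
  have sub: "subgroup (primary_part A M n) (add_monoid M)" if "n \<in> cfs K A" for n
    using lsub_primary_part[OF cfs_ideal[OF that]] submodule.axioms(1) submodule_iff_lsub by blast
  have indep: "\<forall>D g. finite D \<longrightarrow> D \<subseteq> cfs K A \<longrightarrow> (\<forall>i\<in>D. g i \<in> primary_part A M i) \<longrightarrow>
      finsum M g D = \<zero>\<^bsub>M\<^esub> \<longrightarrow> (\<forall>i\<in>D. g i = \<zero>\<^bsub>M\<^esub>)"
  proof (intro allI impI ballI)
    fix D g i assume D: "finite D" "D \<subseteq> cfs K A" "\<forall>i\<in>D. g i \<in> primary_part A M i"
      "finsum M g D = \<zero>\<^bsub>M\<^esub>" "i \<in> D"
    show "g i = \<zero>\<^bsub>M\<^esub>" by (rule primary_parts_independent[OF D(1,2) bspec[OF D(3)] D(4,5)])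
  qed
  have "(\<exists>D g. finite D \<and> D \<subseteq> cfs K A \<and> (\<forall>i\<in>D. g i \<in> primary_part A M i) \<and> x = finsum M g D) \<longleftrightarrow> locfin x"
    if x: "x \<in> carrier M" for x
  proof
    assume "\<exists>D g. finite D \<and> D \<subseteq> cfs K A \<and> (\<forall>i\<in>D. g i \<in> primary_part A M i) \<and> x = finsum M g D"
    then obtain D g where D: "finite D" "D \<subseteq> cfs K A" "\<forall>i\<in>D. g i \<in> primary_part A M i" "x = finsum M g D" by blast
    show "locfin x"
      unfolding D(4) using D(1-3) primary_part_locfin[OF _ noeth] lsub_primary_part[OF cfs_ideal, THEN lsubD(2)]
      by (intro locfin_finsum) blast+
  next
    assume lf: "locfin x"
    obtain ms where ms: "set ms \<subseteq> cfs K A"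
      "\<forall>a\<in>ideal_list_prod A ms. \<forall>v\<in>(\<lambda>a. a \<odot>\<^bsub>M\<^esub> x) ` carrier A. a \<odot>\<^bsub>M\<^esub> v = \<zero>\<^bsub>M\<^esub>"
      using flen_killed[OF lsub_orbit[OF x]] lf unfolding locfin_def by blast
    have "x \<in> (\<lambda>a. a \<odot>\<^bsub>M\<^esub> x) ` carrier A" using smult_one[OF x] by (intro image_eqI[of _ _ \<one>]) auto
    then have "\<forall>a\<in>ideal_list_prod A ms. a \<odot>\<^bsub>M\<^esub> x = \<zero>\<^bsub>M\<^esub>" using ms(2) by blast
    from killed_decomposition[OF qc ms(1) x this]
    obtain D g where D: "finite D" "D \<subseteq> set ms" "\<forall>n\<in>D. g n \<in> primary_part A M n" "x = finsum M g D"
      by (elim exE conjE)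
    then show "\<exists>D g. finite D \<and> D \<subseteq> cfs K A \<and> (\<forall>i\<in>D. g i \<in> primary_part A M i) \<and> x = finsum M g D"
      using ms(1) by (intro exI[of _ D] exI[of _ g] conjI) auto
  qed
  then have "(\<forall>x\<in>carrier M. \<exists>D g. finite D \<and> D \<subseteq> cfs K A \<and> (\<forall>i\<in>D. g i \<in> primary_part A M i) \<and> x = finsum M g D) \<longleftrightarrow>
    (\<forall>x\<in>carrier M. locfin x)" by (rule ball_cong[OF refl])
  then show ?thesis
    by (simp only: is_direct_sum_iff[OF M.abelian_group_axioms sub] eqTrueI[OF indep] simp_thms)
qed

section \<open>Fixed rings of finite groups\<close>

text \<open>The spans of the finite subsets of \<open>E\<close> are directed, so their union is a
  submodule and contains the finitely many generators \<open>Y\<close>. It allows generators to be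
  picked from a prescribed set, such as a left ideal of the fixed ring or vectors of a special
  shape.\<close>

lemma (in left_module) lspan_finite_subset:
  assumes E: "E \<subseteq> carrier M" and Y: "finite Y" "lspan (carrier R) M Y = lspan (carrier R) M E"
  obtains E' where "finite E'" "E' \<subseteq> E" "lspan (carrier R) M E' = lspan (carrier R) M E"
proof -
  let ?S = "lspan (carrier R) M"
  let ?U = "{y. \<exists>E'. finite E' \<and> E' \<subseteq> E \<and> y \<in> ?S E'}"
  have l: "lsub (carrier R) M (?S E')" if "E' \<subseteq> E" for E' using that E by (intro lsub_lspan) auto
  have "lsub (carrier R) M ?U"
  proof (rule lsubI)
    show "?U \<subseteq> carrier M" using lsubD(1)[OF l] by blast
    show "\<zero>\<^bsub>M\<^esub> \<in> ?U" using lsubD(3)[OF l[of "{}"]] by blast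
    show "x \<oplus>\<^bsub>M\<^esub> y \<in> ?U" if xy: "x \<in> ?U" "y \<in> ?U" for x y
    proof -
      obtain C D where CD: "finite C" "C \<subseteq> E" "x \<in> ?S C" "finite D" "D \<subseteq> E" "y \<in> ?S D" using xy by blast
      then have "x \<in> ?S (C \<union> D)" "y \<in> ?S (C \<union> D)"
        using lspan_mono[of C "C \<union> D" "carrier R" M] lspan_mono[of D "C \<union> D" "carrier R" M] by blast+
      then have "x \<oplus>\<^bsub>M\<^esub> y \<in> ?S (C \<union> D)" using CD by (intro lsubD(4)[OF l]) auto
      then show ?thesis using CD by (intro CollectI exI[of _ "C \<union> D"]) auto
    qed
    show "a \<odot>\<^bsub>M\<^esub> x \<in> ?U" if "a \<in> carrier R" "x \<in> ?U" for a x
      using that lsubD(5)[OF l] by blast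
  qed
  moreover have "E \<subseteq> ?U"
  proof
    fix e assume "e \<in> E"
    then show "e \<in> ?U" using lspan_superset[of "{e}" "carrier R" M] by (intro CollectI exI[of _ "{e}"]) auto
  qed
  ultimately have "?S E \<subseteq> ?U" by (rule lspan_least)
  then have "\<forall>y\<in>Y. \<exists>E'. finite E' \<and> E' \<subseteq> E \<and> y \<in> ?S E'"
    using lspan_superset[of Y "carrier R" M] Y(2) by blast
  from bchoice[OF this] obtain h where h: "\<forall>y\<in>Y. finite (h y) \<and> h y \<subseteq> E \<and> y \<in> ?S (h y)" by (elim exE)
  let ?E' = "\<Union>(h ` Y)"
  have E': "finite ?E'" "?E' \<subseteq> E" using h Y(1) by auto
  have "y \<in> ?S ?E'" if "y \<in> Y" for y
    using h that lspan_mono[of "h y" ?E' "carrier R" M] by blast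
  then have "?S Y \<subseteq> ?S ?E'" using E' E by (intro lspan_least lsub_lspan) auto
  then have "?S ?E' = ?S E" using Y(2) lspan_mono[OF E'(2), of "carrier R" M] by simp
  then show ?thesis using that E' by blast
qed

text \<open>Exhibits the free module on a finite set as finitely generated, so that
  \<open>noetherian_lsub_fg\<close> applies inside it.\<close>

lemma (in ring) free_module_lspan_delta:
  assumes "finite B"
  shows "lspan (carrier R) (free_module R B) (delta B ` B) = carrier (free_module R B)"
proof -
  let ?M = "free_module R B"
  interpret left_module R ?M by (rule free_module_left_module)
  have dc: "delta B ` B \<subseteq> carrier ?M" by (intro image_subsetI delta_mem)
  note S = lsub_lspan[OF dc]
  have "f \<in> lspan (carrier R) ?M (delta B ` B)"
    if "finite D" "D \<subseteq> B" "f \<in> carrier ?M" "\<forall>x\<in>B - D. f x = \<zero>" for D f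
    using that
  proof (induction D arbitrary: f)
    case empty
    then have "f = \<zero>\<^bsub>?M\<^esub>" by (auto simp: free_module_simps fun_eq_iff PiE_def extensional_def)
    then show ?case using lsubD(3)[OF S] by simp
  next
    case (insert x D)
    let ?f = "\<lambda>y\<in>B. if y = x then \<zero> else f y"
    note mem = free_module_mem[OF insert.prems(2)]
    have sub: "{y \<in> B. ?f y \<noteq> \<zero>} \<subseteq> {y \<in> B. f y \<noteq> \<zero>}" by auto
    have "finite {y \<in> B. f y \<noteq> \<zero>}" using insert.prems(2) by (simp add: free_module_simps)
    then have f': "?f \<in> carrier ?M"
      using finite_subset[OF sub] mem by (auto simp: free_module_simps)
    then have f'S: "?f \<in> lspan (carrier R) ?M (delta B ` B)"
      by (intro insert.IH f') (use insert.prems in auto)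
    have "delta B x \<in> lspan (carrier R) ?M (delta B ` B)"
      using insert.prems(1) lspan_superset[of "delta B ` B"] by blast
    then have "f x \<odot>\<^bsub>?M\<^esub> delta B x \<oplus>\<^bsub>?M\<^esub> ?f \<in> lspan (carrier R) ?M (delta B ` B)"
      using lsubD(4,5)[OF S] f'S mem insert.prems(1) by auto
    moreover have "f x \<odot>\<^bsub>?M\<^esub> delta B x \<oplus>\<^bsub>?M\<^esub> ?f = f"
    proof
      fix y
      show "(f x \<odot>\<^bsub>?M\<^esub> delta B x \<oplus>\<^bsub>?M\<^esub> ?f) y = f y"
        using mem[of y] mem[of x] insert.prems(1,2)
        by (auto simp: free_module_simps(2-) delta_def) (auto simp: free_module_simps PiE_def extensional_def)
    qed
    ultimately show ?case by simp
  qed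
  from this[OF assms] show ?thesis using lspan_carrier[OF dc] by auto
qed

lemma left_regular_restrict: "left_regular (R\<lparr>carrier := S\<rparr>) = (left_regular R)\<lparr>carrier := S\<rparr>"
  by (simp add: left_regular_def)

text \<open>
  The element \<open>c\<close> is the inverse of the order of \<open>W\<close>, so that \<open>tr\<close> below is the averaging operator, a
  projection onto the fixed ring.
\<close>

locale finite_auts = ring R for R (structure) +
  fixes W :: "('a \<Rightarrow> 'a) set" and c
  assumes finite_W: "finite W"
    and aut_closed: "s \<in> W \<Longrightarrow> x \<in> carrier R \<Longrightarrow> s x \<in> carrier R"
    and aut_add: "s \<in> W \<Longrightarrow> x \<in> carrier R \<Longrightarrow> y \<in> carrier R \<Longrightarrow> s (x \<oplus> y) = s x \<oplus> s y"
    and aut_mult: "s \<in> W \<Longrightarrow> x \<in> carrier R \<Longrightarrow> y \<in> carrier R \<Longrightarrow> s (x \<otimes> y) = s x \<otimes> s y"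
    and aut_one: "s \<in> W \<Longrightarrow> s \<one> = \<one>"
    and aut_shift: "s \<in> W \<Longrightarrow> \<exists>b. bij_betw b W W \<and> (\<forall>t\<in>W. \<forall>x\<in>carrier R. b t x = s (t x))"
    and aut_inverse: "s \<in> W \<Longrightarrow> \<exists>t\<in>W. \<forall>x\<in>carrier R. s (t x) = x"
    and c_closed: "c \<in> carrier R"
    and c_central: "x \<in> carrier R \<Longrightarrow> c \<otimes> x = x \<otimes> c"
    and c_fixed: "s \<in> W \<Longrightarrow> s c = c"
    and c_card: "x \<in> carrier R \<Longrightarrow> c \<otimes> finsum R (\<lambda>s. x) W = x"
begin

definition tr :: "'a \<Rightarrow> 'a" where "tr x = c \<otimes> finsum R (\<lambda>s. s x) W"

abbreviation G where "G \<equiv> fixed_ring (carrier R) W"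

lemma fixed_subset: "G \<subseteq> carrier R"
  unfolding fixed_ring_def by blast

lemma sum_closed: "x \<in> carrier R \<Longrightarrow> finsum R (\<lambda>s. s x) W \<in> carrier R"
  using aut_closed by (intro finsum_closed) auto

lemma tr_closed: "x \<in> carrier R \<Longrightarrow> tr x \<in> carrier R"
  unfolding tr_def using c_closed sum_closed by simp

lemma aut_zero: "s \<in> W \<Longrightarrow> s \<zero> = \<zero>"
  using aut_add[of s \<zero> \<zero>] aut_closed[of s \<zero>] by simp

lemma aut_minus: "s \<in> W \<Longrightarrow> x \<in> carrier R \<Longrightarrow> s (\<ominus> x) = \<ominus> s x"
  using aut_add[of s "\<ominus> x" x] aut_closed[of s] aut_zero[of s] by (intro minus_equality[symmetric]) (auto simp: l_neg)

lemma fixed_subring: "subring G R"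
proof (rule subringI)
  fix a b assume "a \<in> G" "b \<in> G"
  then have ab: "a \<in> carrier R" "b \<in> carrier R" "\<And>s. s \<in> W \<Longrightarrow> s a = a" "\<And>s. s \<in> W \<Longrightarrow> s b = b"
    unfolding fixed_ring_def by auto
  have "s (a \<otimes> b) = a \<otimes> b" "s (a \<oplus> b) = a \<oplus> b" "s (\<ominus> a) = \<ominus> a" if s: "s \<in> W" for s
    using aut_mult[OF s ab(1,2)] aut_add[OF s ab(1,2)] aut_minus[OF s ab(1)] ab(3,4)[OF s] by auto
  then show "a \<otimes> b \<in> G" "a \<oplus> b \<in> G" "\<ominus> a \<in> G" unfolding fixed_ring_def using ab(1,2) by auto
qed (auto simp: fixed_ring_def aut_one)

lemma tr_fixed:
  assumes x: "x \<in> carrier R"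
  shows "tr x \<in> G"
proof -
  have "s (tr x) = tr x" if s: "s \<in> W" for s
  proof -
    obtain b where b: "bij_betw b W W" "\<forall>t\<in>W. \<forall>x\<in>carrier R. b t x = s (t x)" using aut_shift[OF s] by blast
    \<comment> \<open>Left translation by \<open>s\<close> permutes \<open>W\<close>, so applying
      \<open>s\<close> only reorders the sum.\<close>
    have "s (finsum R (\<lambda>t. t x) W) = finsum R (\<lambda>t. s (t x)) W"
      using aut_closed aut_add s x finite_W by (intro finsum_hom abelian_group_axioms) auto
    also have "\<dots> = finsum R (\<lambda>t. b t x) W"
      using b aut_closed s x bij_betwE[OF b(1)] by (intro finsum_cong') auto
    also have "\<dots> = finsum R (\<lambda>t. t x) (b ` W)"
      using b(1) aut_closed x unfolding bij_betw_def by (intro finsum_reindex[symmetric]) auto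
    also have "\<dots> = finsum R (\<lambda>t. t x) W" using b(1) unfolding bij_betw_def by simp
    finally have eq: "s (finsum R (\<lambda>t. t x) W) = finsum R (\<lambda>t. t x) W" .
    have "s (tr x) = s c \<otimes> s (finsum R (\<lambda>t. t x) W)"
      unfolding tr_def by (rule aut_mult[OF s c_closed sum_closed[OF x]])
    then show ?thesis unfolding tr_def c_fixed[OF s] eq .
  qed
  then show ?thesis unfolding fixed_ring_def using tr_closed[OF x] by blast
qed

lemma tr_add:
  assumes "x \<in> carrier R" "y \<in> carrier R"
  shows "tr (x \<oplus> y) = tr x \<oplus> tr y"
proof -
  have "finsum R (\<lambda>s. s (x \<oplus> y)) W = finsum R (\<lambda>s. s x \<oplus> s y) W"
    using assms aut_closed aut_add by (intro finsum_cong') auto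
  also have "\<dots> = finsum R (\<lambda>s. s x) W \<oplus> finsum R (\<lambda>s. s y) W"
    using assms aut_closed by (intro finsum_addf) auto
  finally show ?thesis unfolding tr_def using assms sum_closed c_closed by (simp add: r_distr)
qed

lemma sum_mult_right:
  assumes "\<And>s. s \<in> W \<Longrightarrow> h s \<in> carrier R" "a \<in> carrier R"
  shows "finsum R (\<lambda>s. h s \<otimes> a) W = finsum R h W \<otimes> a"
  using assms finsum_hom[of R R "\<lambda>x. x \<otimes> a" W h] finite_W abelian_group_axioms by (auto simp: l_distr)

lemma tr_mult_fixed:
  assumes x: "x \<in> carrier R" and a: "a \<in> G"
  shows "tr (x \<otimes> a) = tr x \<otimes> a"
proof -
  have ac: "a \<in> carrier R" "\<And>s. s \<in> W \<Longrightarrow> s a = a" using a unfolding fixed_ring_def by auto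
  have "finsum R (\<lambda>s. s (x \<otimes> a)) W = finsum R (\<lambda>s. s x \<otimes> a) W"
  proof (rule finsum_cong')
    fix s assume s: "s \<in> W"
    show "s (x \<otimes> a) = s x \<otimes> a" unfolding aut_mult[OF s x ac(1)] ac(2)[OF s] ..
  qed (use x ac(1) aut_closed in auto)
  also have "\<dots> = finsum R (\<lambda>s. s x) W \<otimes> a"
    using x ac(1) aut_closed by (intro sum_mult_right) auto
  finally show ?thesis unfolding tr_def using x ac sum_closed c_closed by (simp add: m_assoc)
qed

lemma tr_of_fixed:
  assumes a: "a \<in> G"
  shows "tr a = a"
proof -
  have ac: "a \<in> carrier R" "\<And>s. s \<in> W \<Longrightarrow> s a = a" using a unfolding fixed_ring_def by auto
  have "finsum R (\<lambda>s. s a) W = finsum R (\<lambda>s. a) W" using ac by (intro finsum_cong') auto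
  then show ?thesis unfolding tr_def using c_card ac by simp
qed

lemma fixed_left_module: "left_module (R\<lparr>carrier := G\<rparr>) (left_regular R)"
  by (intro left_module.subring_left_module left_regular_module fixed_subring)

text \<open>The left ideal of \<open>R\<close> generated by \<open>I\<close> is already generated by
  finitely many \<open>x_i\<close> in \<open>I\<close>. If an element of \<open>I\<close> is the sum
  of the \<open>r_i x_i\<close>, averaging fixes it and turns the coefficients into
  \<open>tr r_i\<close>, so the \<open>x_i\<close> generate \<open>I\<close> over the fixed
  ring.\<close>

lemma fixed_left_noetherian:
  assumes noeth: "left_noetherian R"
  shows "left_noetherian (R\<lparr>carrier := G\<rparr>)"
proof -
  interpret reg: left_module R "left_regular R" by (rule left_regular_module)
  interpret GR: left_module "R\<lparr>carrier := G\<rparr>" "left_regular R" by (rule fixed_left_module)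
  note Gs = subringE[OF fixed_subring]
  have G: "lsub G (left_regular R) G" by (rule lsub_subring[OF fixed_subring order_refl])
  interpret GG: left_module "R\<lparr>carrier := G\<rparr>" "(left_regular R)\<lparr>carrier := G\<rparr>"
    using GR.lsub_left_module[of G] G by simp
  have "fin_gen (R\<lparr>carrier := G\<rparr>) ((left_regular R)\<lparr>carrier := I\<rparr>)"
    if I: "lsub G (left_regular R) I" "I \<subseteq> G" for I
  proof -
    have Ic: "I \<subseteq> carrier (left_regular R)" using lsubD(1)[OF I(1)] .
    obtain Y where Y: "finite Y" "lspan (carrier R) (left_regular R) Y = lspan (carrier R) (left_regular R) I"
      using left_noetherian_fg[OF noeth reg.lsub_lspan[OF Ic]] by metis
    obtain X' where X': "finite X'" "X' \<subseteq> I"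
      "lspan (carrier R) (left_regular R) X' = lspan (carrier R) (left_regular R) I"
      using reg.lspan_finite_subset[OF Ic Y] .
    let ?D = "lspan G (left_regular R) X'"
    have D: "lsub G (left_regular R) ?D" using GR.lsub_lspan[of X'] X'(2) Ic by auto
    \<comment> \<open>The extra factor \<open>r\<close> makes the set a left ideal of
      \<open>R\<close>; at 1 it says that \<open>tr y\<close> lies in \<open>?D\<close>.\<close>
    have "lsub (carrier R) (left_regular R) {y \<in> carrier R. \<forall>r\<in>carrier R. tr (r \<otimes> y) \<in> ?D}"
    proof (rule lsubI, goal_cases)
      case 2
      have "tr \<zero> = \<zero>" using tr_of_fixed Gs(2) by blast
      then show ?case using lsubD(3)[OF D] by simp
    next
      case (3 x y)
      then show ?case using lsubD(4)[OF D] by (simp add: r_distr tr_add)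
    next
      case (4 a x)
      then show ?case by (simp add: m_assoc[symmetric])
    qed auto
    moreover have "X' \<subseteq> {y \<in> carrier R. \<forall>r\<in>carrier R. tr (r \<otimes> y) \<in> ?D}"
    proof
      fix x assume x: "x \<in> X'"
      then have "x \<in> G" "x \<in> ?D" using X'(2) I(2) lspan_superset[of X'] by blast+
      then show "x \<in> {y \<in> carrier R. \<forall>r\<in>carrier R. tr (r \<otimes> y) \<in> ?D}"
        using tr_mult_fixed tr_fixed lsubD(5)[OF D] fixed_subset by auto
    qed
    ultimately have "lspan (carrier R) (left_regular R) X' \<subseteq> {y \<in> carrier R. \<forall>r\<in>carrier R. tr (r \<otimes> y) \<in> ?D}"
      by (rule lspan_least)
    then have "I \<subseteq> {y \<in> carrier R. \<forall>r\<in>carrier R. tr (r \<otimes> y) \<in> ?D}"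
      unfolding X'(3) using lspan_superset[of I] by blast
    then have "tr (\<one> \<otimes> y) \<in> ?D" if "y \<in> I" for y using that by blast
    then have "I \<subseteq> ?D" using tr_of_fixed I(2) fixed_subset by (auto simp: subset_iff)
    moreover have "?D \<subseteq> I" by (rule lspan_least[OF I(1) X'(2)])
    ultimately show ?thesis
      unfolding fin_gen_restrict_iff[OF fixed_subring I(1)] using X'(1,2) by blast
  qed
  then show ?thesis
    unfolding left_noetherian_def left_regular_restrict GG.submodule_iff_lsub
    using lsub_restrict_carrier[of G "left_regular R"] fixed_subset by auto
qed

text \<open>
  For finitely many \<open>t \<in> T\<close> the vectors \<open>(g\<^sup>-\<^sup>1 t)\<^sub>g\<close> generate the submodule of \<open>R\<^sup>W\<close> generated by all
  \<open>(g\<^sup>-\<^sup>1 s)\<^sub>g\<close>. Applying \<open>g\<close> to a relation \<open>g\<^sup>-\<^sup>1 s = \<Sum> r\<^sub>t g\<^sup>-\<^sup>1 t\<close> and averaging gives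
  \<open>s = \<Sum> tr r\<^sub>t \<cdot> t\<close>, so \<open>T\<close> generates \<open>R\<close> over the fixed ring.
\<close>

lemma fixed_fin_gen:
  assumes noeth: "left_noetherian R"
  shows "fin_gen (R\<lparr>carrier := G\<rparr>) ((left_regular R)\<lparr>carrier := carrier R\<rparr>)"
proof -
  let ?M = "free_module R W"
  interpret GR: left_module "R\<lparr>carrier := G\<rparr>" "left_regular R" by (rule fixed_left_module)
  interpret M: left_module R ?M by (rule free_module_left_module)
  note Gs = subringE[OF fixed_subring]
  have RG: "lsub G (left_regular R) (carrier R)" by (rule lsub_subring[OF carrier_is_subring fixed_subset])
  have "\<forall>s\<in>W. \<exists>t. t \<in> W \<and> (\<forall>x\<in>carrier R. s (t x) = x)" using aut_inverse by blast
  \<comment> \<open>\<open>v g\<close> plays the role of the inverse of \<open>g\<close>, known here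
    only through \<open>g (v g x) = x\<close>.\<close>
  from bchoice[OF this] obtain v where v: "\<forall>s\<in>W. v s \<in> W \<and> (\<forall>x\<in>carrier R. s (v s x) = x)" by (elim exE)
  define p where "p = (\<lambda>x. \<lambda>g\<in>W. v g x)"
  have p: "p x \<in> carrier ?M" if "x \<in> carrier R" for x
    unfolding p_def free_module_simps using v aut_closed that finite_W by auto
  have pc: "p ` carrier R \<subseteq> carrier ?M" using p by blast
  have "lspan (carrier R) ?M (p ` carrier R) \<subseteq> lspan (carrier R) ?M (delta W ` W)"
    unfolding free_module_lspan_delta[OF finite_W] by (rule M.lspan_carrier[OF pc])
  moreover have "finite (delta W ` W)" "delta W ` W \<subseteq> carrier ?M"
    using finite_W by (auto intro: delta_mem)
  ultimately obtain Y where Y: "finite Y" "lspan (carrier R) ?M Y = lspan (carrier R) ?M (p ` carrier R)"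
    using M.noetherian_lsub_fg[OF noeth _ _ M.lsub_lspan[OF pc], of "delta W ` W"] by metis
  obtain E where E: "finite E" "E \<subseteq> p ` carrier R"
    "lspan (carrier R) ?M E = lspan (carrier R) ?M (p ` carrier R)"
    using M.lspan_finite_subset[OF pc Y] .
  obtain T where T: "T \<subseteq> carrier R" "finite T" "E = p ` T"
    using finite_subset_image[OF E(1,2)] by metis
  let ?D = "lspan G (left_regular R) T"
  have D: "lsub G (left_regular R) ?D" using GR.lsub_lspan[of T] T(1) by simp
  \<comment> \<open>A trace twisted by position: on \<open>p t\<close> it gives \<open>tr r\<close>
    times \<open>t\<close>, and on \<open>p x\<close> with \<open>r\<close> equal to 1 it returns
    \<open>x\<close>.\<close>
  let ?sum = "\<lambda>r f. c \<otimes> finsum R (\<lambda>g. g (r \<otimes> f g)) W"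
  let ?P = "{f \<in> carrier ?M. \<forall>r\<in>carrier R. ?sum r f \<in> ?D}"
  have sc: "(\<lambda>g. g (r \<otimes> f g)) \<in> W \<rightarrow> carrier R" if "r \<in> carrier R" "f \<in> carrier ?M" for r f
    using that aut_closed free_module_mem[of f W] by auto
  have "lsub (carrier R) ?M ?P"
  proof (rule lsubI, goal_cases)
    case 2
    have "?sum r \<zero>\<^bsub>?M\<^esub> = \<zero>" if "r \<in> carrier R" for r
    proof -
      have "finsum R (\<lambda>g. g (r \<otimes> \<zero>\<^bsub>?M\<^esub> g)) W = finsum R (\<lambda>g. \<zero>) W"
        using that aut_zero by (intro finsum_cong') (auto simp: free_module_simps)
      then show ?thesis using c_closed by (simp add: finsum_zero)
    qed
    then show ?case using lsubD(3)[OF D] by simp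
  next
    case (3 f h)
    have "?sum r (f \<oplus>\<^bsub>?M\<^esub> h) = ?sum r f \<oplus> ?sum r h" if r: "r \<in> carrier R" for r
    proof -
      have "finsum R (\<lambda>g. g (r \<otimes> (f \<oplus>\<^bsub>?M\<^esub> h) g)) W = finsum R (\<lambda>g. g (r \<otimes> f g) \<oplus> g (r \<otimes> h g)) W"
      proof (rule finsum_cong')
        fix g assume g: "g \<in> W"
        have "f g \<in> carrier R" "h g \<in> carrier R" using 3 free_module_mem[OF _ g] by simp_all
        then show "g (r \<otimes> (f \<oplus>\<^bsub>?M\<^esub> h) g) = g (r \<otimes> f g) \<oplus> g (r \<otimes> h g)"
          using g r by (simp add: free_module_simps r_distr aut_add)
      qed (use sc r 3 in \<open>auto simp: Pi_iff\<close>)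
      also have "\<dots> = finsum R (\<lambda>g. g (r \<otimes> f g)) W \<oplus> finsum R (\<lambda>g. g (r \<otimes> h g)) W"
        using sc r 3 by (intro finsum_addf) auto
      finally show ?thesis using sc r 3 c_closed by (simp add: r_distr finsum_closed)
    qed
    then show ?case using 3 lsubD(4)[OF D] by simp
  next
    case (4 a f)
    have "?sum r (a \<odot>\<^bsub>?M\<^esub> f) = ?sum (r \<otimes> a) f" if r: "r \<in> carrier R" for r
    proof -
      have "finsum R (\<lambda>g. g (r \<otimes> (a \<odot>\<^bsub>?M\<^esub> f) g)) W = finsum R (\<lambda>g. g (r \<otimes> a \<otimes> f g)) W"
      proof (rule finsum_cong')
        fix g assume g: "g \<in> W"
        have "f g \<in> carrier R" using 4(2) free_module_mem[OF _ g] by simp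
        then show "g (r \<otimes> (a \<odot>\<^bsub>?M\<^esub> f) g) = g (r \<otimes> a \<otimes> f g)"
          using g r 4(1) by (simp add: free_module_simps m_assoc)
      qed (use sc r 4 in auto)
      then show ?thesis by simp
    qed
    then show ?case using 4 M.smult_closed by simp
  qed auto
  moreover have "E \<subseteq> ?P"
  proof -
    have "?sum r (p t) \<in> ?D" if t: "t \<in> T" and r: "r \<in> carrier R" for r t
    proof -
      have tc: "t \<in> carrier R" using t T(1) by blast
      have "finsum R (\<lambda>g. g (r \<otimes> p t g)) W = finsum R (\<lambda>g. g r \<otimes> t) W"
      proof (rule finsum_cong')
        fix g assume g: "g \<in> W"
        have "g (r \<otimes> v g t) = g r \<otimes> g (v g t)" using g r tc v aut_closed by (intro aut_mult) auto
        moreover have "g (v g t) = t" using g v tc by blast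
        ultimately show "g (r \<otimes> p t g) = g r \<otimes> t" using g by (simp add: p_def)
      qed (use r tc aut_closed in auto)
      also have "\<dots> = finsum R (\<lambda>g. g r) W \<otimes> t" using r tc aut_closed by (intro sum_mult_right) auto
      finally have "?sum r (p t) = tr r \<otimes> t"
        unfolding tr_def using r tc sum_closed c_closed by (simp add: m_assoc)
      then show ?thesis
        using lsubD(5)[OF D tr_fixed[OF r], of t] t lspan_superset[of T G "left_regular R"] by auto
    qed
    then show ?thesis using T(1,3) p by auto
  qed
  ultimately have "lspan (carrier R) ?M (p ` carrier R) \<subseteq> ?P"
    using lspan_least[of "carrier R" ?M ?P E] E(3) by simp
  then have P: "p x \<in> ?P" if "x \<in> carrier R" for x
    using that lspan_superset[of "p ` carrier R" "carrier R" ?M] by blast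
  have "carrier R \<subseteq> ?D"
  proof
    fix x assume x: "x \<in> carrier R"
    have "finsum R (\<lambda>g. g (\<one> \<otimes> p x g)) W = finsum R (\<lambda>g. x) W"
      using x v aut_closed by (intro finsum_cong') (auto simp: p_def)
    then have "?sum \<one> (p x) = x" using c_card[OF x] by simp
    moreover have "?sum \<one> (p x) \<in> ?D" using P[OF x] by blast
    ultimately show "x \<in> ?D" by simp
  qed
  moreover have "?D \<subseteq> carrier R" using lsubD(1)[OF D] by simp
  ultimately show ?thesis
    unfolding fin_gen_restrict_iff[OF fixed_subring RG] using T(1,2) by blast
qed

end

lemma (in ring) opp_finsum:
  assumes "finite X'" "f \<in> X' \<rightarrow> carrier R"
  shows "finsum (opp_ring R) f X' = finsum R f X'"
proof -
  interpret opp: ring "opp_ring R" by (rule opp_ring_ring)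
  show ?thesis
    using assms
  proof (induction X')
    case (insert x X')
    then have "f \<in> X' \<rightarrow> carrier R" "f x \<in> carrier R" by auto
    then show ?case using insert opp.finsum_insert[of X' x f] finsum_insert[of X' x f] by simp
  qed (simp add: opp.finsum_empty)
qed

text \<open>Averaging is symmetric in left and right because \<open>c\<close> is central, so the
  results on left ideals and left generators also yield those for the right side.\<close>

lemma (in finite_auts) finite_auts_opp: "finite_auts (opp_ring R) W c"
  by (intro finite_auts.intro opp_ring_ring finite_auts_axioms.intro)
    (use finite_W aut_closed aut_add aut_mult aut_one aut_shift aut_inverse c_closed c_central c_fixed c_card
      in \<open>auto simp: opp_finsum\<close>)

section \<open>Harish-Chandra subalgebras and modules\<close>

context assoc_alg
begin

context
  fixes S assumes S: "is_subalgebra K A S"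
begin

lemma subalgebra_subring: "subring S A"
  using S unfolding is_subalgebra_def by blast

lemma subalgebra_assoc_algebra: "assoc_algebra K (A\<lparr>carrier := S\<rparr>)"
proof -
  interpret KA: module K A by (rule moduleK)
  interpret S: ring "A\<lparr>carrier := S\<rparr>" by (rule subring_is_ring[OF subalgebra_subring])
  have c: "x \<in> carrier A" if "x \<in> S" for x using subringE(1)[OF subalgebra_subring] that by blast
  have "module K (A\<lparr>carrier := S\<rparr>)"
  proof (rule moduleI)
    show "cring K" by (rule KA.is_cring)
    show "abelian_group (A\<lparr>carrier := S\<rparr>)" by (rule S.abelian_group_axioms)
  qed (use S c in \<open>auto simp: is_subalgebra_def KA.smult_l_distr KA.smult_r_distr KA.smult_assoc1\<close>)
  then show ?thesis
    using fieldK S.ring_axioms c smult_mult unfolding assoc_algebra_def by simp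
qed

text \<open>All subalgebras share one copy of the field, so a dimension bound carries over from one
  to another unchanged.\<close>

lemma subalgebra_scal: "scal K (A\<lparr>carrier := S\<rparr>) = scal K A"
  by (simp add: scal_def)

lemma scal_subset_subalgebra: "scal K A \<subseteq> S"
  using S subringE(3)[OF subalgebra_subring] unfolding is_subalgebra_def scal_def by auto

lemma subalgebra_alg_module: "left_module A M \<Longrightarrow> alg_module K (A\<lparr>carrier := S\<rparr>) M"
  using left_module.subring_left_module[OF _ subalgebra_subring] subalgebra_assoc_algebra
  by (intro alg_module.intro assoc_alg.intro)

end

section \<open>Local finiteness over two subalgebras\<close>

lemma locfin_restrict:
  assumes G: "is_subalgebra K A G" and L: "is_subalgebra K A L" and GL: "G \<subseteq> L"
    and M: "left_module A M"
    and lf: "alg_module.locfin K (A\<lparr>carrier := L\<rparr>) M x"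
  shows "alg_module.locfin K (A\<lparr>carrier := G\<rparr>) M x"
proof -
  interpret L: alg_module K "A\<lparr>carrier := L\<rparr>" M by (rule subalgebra_alg_module[OF L M])
  interpret G: alg_module K "A\<lparr>carrier := G\<rparr>" M by (rule subalgebra_alg_module[OF G M])
  show ?thesis
    using lf flen_mono[OF _ order_refl image_mono[OF GL]]
    unfolding G.locfin_def L.locfin_def by (simp add: subalgebra_scal[OF G] subalgebra_scal[OF L])
qed

text \<open>Each \<open>t (G x)\<close> is in general a subspace but not a
  \<open>G\<close>-submodule, so the sum is formed over the field. The generators are right
  generators because \<open>G\<close> has to stand next to \<open>x\<close>.\<close>

lemma locfin_extend:
  assumes G: "is_subalgebra K A G" and L: "is_subalgebra K A L" and GL: "G \<subseteq> L"
    and fg: "fin_gen_right A G L" and M: "left_module A M" and x: "x \<in> carrier M"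
    and lf: "alg_module.locfin K (A\<lparr>carrier := G\<rparr>) M x"
  shows "alg_module.locfin K (A\<lparr>carrier := L\<rparr>) M x"
proof -
  interpret M: left_module A M by fact
  interpret A: alg_module K A M by (intro alg_module.intro assoc_alg_axioms M)
  interpret L: alg_module K "A\<lparr>carrier := L\<rparr>" M by (rule subalgebra_alg_module[OF L M])
  interpret G: alg_module K "A\<lparr>carrier := G\<rparr>" M by (rule subalgebra_alg_module[OF G M])
  interpret opp: ring "opp_ring A" by (rule opp_ring_ring)
  let ?F = "scal K A"
  interpret FM: left_module "A\<lparr>carrier := ?F\<rparr>" M by (rule scal_left_module[OF M])
  note Gr = subalgebra_subring[OF G] and Lr = subalgebra_subring[OF L]
  note Gs = subringE[OF Gr] and Ls = subringE[OF Lr]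
  let ?O = "left_regular (opp_ring A)"
  have "\<exists>T. finite T \<and> T \<subseteq> L \<and> lspan G ?O T = L"
    using fg unfolding fin_gen_right_def opp_ring_restrict
      opp.fin_gen_restrict_iff[OF opp_subring[OF Gr] opp.lsub_subring[OF opp_subring[OF Lr] GL]] .
  then obtain T where T: "finite T" "T \<subseteq> L" "lspan G ?O T = L" by blast
  let ?Gx = "(\<lambda>a. a \<odot>\<^bsub>M\<^esub> x) ` G"
  have Gx: "lsub G M ?Gx" using G.lsub_orbit[OF x] by simp
  then have FGx: "lsub ?F M ?Gx" by (rule lsub_mono[OF _ scal_subset_subalgebra[OF G]])
  have flGx: "flen ?F M {\<zero>\<^bsub>M\<^esub>} ?Gx" using lf unfolding G.locfin_def by (simp add: subalgebra_scal[OF G])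
  \<comment> \<open>\<open>V\<close> collects the subspaces \<open>t (G x)\<close>, each the image
    of \<open>G x\<close> under a map linear over the field.\<close>
  have "\<exists>V. lsub ?F M V \<and> flen ?F M {\<zero>\<^bsub>M\<^esub>} V \<and> (\<forall>t\<in>T. \<forall>g\<in>G. (t \<otimes> g) \<odot>\<^bsub>M\<^esub> x \<in> V)"
    using T(1,2)
  proof (induction T)
    case empty
    show ?case using FM.lsub_zero flen_refl by (intro exI[of _ "{\<zero>\<^bsub>M\<^esub>}"]) auto
  next
    case (insert t T)
    then obtain V where V: "lsub ?F M V" "flen ?F M {\<zero>\<^bsub>M\<^esub>} V" "\<forall>t\<in>T. \<forall>g\<in>G. (t \<otimes> g) \<odot>\<^bsub>M\<^esub> x \<in> V" by auto
    have t: "t \<in> carrier A" using insert.prems Ls(1) by auto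
    let ?h = "\<lambda>y. t \<odot>\<^bsub>M\<^esub> y"
    have hG: "lsub ?F M (?h ` ?Gx)"
      using lsub_image[OF FM.left_module_axioms FM.left_module_axioms, of ?Gx ?h] FGx t lsubD(2)[OF FGx]
        A.scal_smult_commute by (simp add: M.smult_closed M.smult_r_distr)
    have "flen ?F M V (lsum M (?h ` ?Gx) V)"
      using flen_image[OF FM.left_module_axioms FM.left_module_axioms, of ?Gx V "{\<zero>\<^bsub>M\<^esub>}" ?h] FGx flGx t
        lsubD(2,3)[OF FGx] lsubD(3)[OF V(1)] V(1) A.scal_smult_commute
      by (simp add: M.smult_closed M.smult_r_distr)
    then have "flen ?F M {\<zero>\<^bsub>M\<^esub>} (lsum M (?h ` ?Gx) V)"
      using FM.flen_trans[of V "{\<zero>\<^bsub>M\<^esub>}" "lsum M (?h ` ?Gx) V"] V(1,2) hG lsubD(3)[OF V(1)]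
        FM.lsub_lsum[of "?h ` ?Gx" V] FM.lsum_superset[of "?h ` ?Gx" V] by simp
    moreover have "(t \<otimes> g) \<odot>\<^bsub>M\<^esub> x \<in> lsum M (?h ` ?Gx) V" if g: "g \<in> G" for g
    proof -
      have "(t \<otimes> g) \<odot>\<^bsub>M\<^esub> x = ?h (g \<odot>\<^bsub>M\<^esub> x)" using t g Gs(1) x by (intro M.smult_assoc1) auto
      then show ?thesis using g FM.lsum_superset(1)[of "?h ` ?Gx" V] hG V(1) by auto
    qed
    moreover have "V \<subseteq> lsum M (?h ` ?Gx) V" using FM.lsum_superset(2)[of "?h ` ?Gx" V] hG V(1) by simp
    ultimately show ?case
      using V(3) FM.lsub_lsum[of "?h ` ?Gx" V] hG V(1) by (intro exI[of _ "lsum M (?h ` ?Gx) V"]) auto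
  qed
  then obtain V where V: "lsub ?F M V" "flen ?F M {\<zero>\<^bsub>M\<^esub>} V" "\<And>t g. t \<in> T \<Longrightarrow> g \<in> G \<Longrightarrow> (t \<otimes> g) \<odot>\<^bsub>M\<^esub> x \<in> V"
    by blast
  \<comment> \<open>The quantifier over \<open>g\<close> makes the set stable under right
    multiplication by \<open>G\<close>, so it contains \<open>L\<close> as soon as it contains
    \<open>T\<close>.\<close>
  have "lsub G ?O {l \<in> carrier A. \<forall>g\<in>G. (l \<otimes> g) \<odot>\<^bsub>M\<^esub> x \<in> V}"
  proof (rule lsubI, goal_cases)
    case 2
    show ?case using x Gs(1) lsubD(3)[OF V(1)] by (auto simp: subset_iff)
  next
    case (3 a b)
    then show ?case
      using x Gs(1) lsubD(4)[OF V(1)] by (auto simp: l_distr M.smult_l_distr subset_iff)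
  next
    case (4 a l)
    have "l \<otimes> a \<otimes> g = l \<otimes> (a \<otimes> g)" if "g \<in> G" for g using that 4 Gs(1) by (intro m_assoc) auto
    then show ?case using 4 Gs(1,6) by auto
  qed auto
  moreover have "T \<subseteq> {l \<in> carrier A. \<forall>g\<in>G. (l \<otimes> g) \<odot>\<^bsub>M\<^esub> x \<in> V}" using V(3) T(2) Ls(1) by auto
  ultimately have *: "L \<subseteq> {l \<in> carrier A. \<forall>g\<in>G. (l \<otimes> g) \<odot>\<^bsub>M\<^esub> x \<in> V}"
    using lspan_least[of G ?O _ T] T(3) by simp
  have "l \<odot>\<^bsub>M\<^esub> x \<in> V" if l: "l \<in> L" for l
  proof -
    have "(l \<otimes> \<one>) \<odot>\<^bsub>M\<^esub> x \<in> V" using * l Gs(3) by blast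
    then show ?thesis using l Ls(1) by (simp add: subset_iff)
  qed
  then have "(\<lambda>a. a \<odot>\<^bsub>M\<^esub> x) ` L \<subseteq> V" by blast
  then show ?thesis
    unfolding L.locfin_def using flen_mono[OF V(2) order_refl] by (simp add: subalgebra_scal[OF L])
qed

text \<open>The direct sum condition is the one place where the subalgebra occurs, and it amounts to
  local finiteness for either subalgebra.\<close>

lemma HC_modules_eq:
  assumes G: "is_subalgebra K A G" and L: "is_subalgebra K A L" and GL: "G \<subseteq> L"
    and fg: "fin_gen_right A G L"
    and qc: "quasicommutative K (A\<lparr>carrier := L\<rparr>)" "quasicommutative K (A\<lparr>carrier := G\<rparr>)"
    and noeth: "noetherian (A\<lparr>carrier := L\<rparr>)" "noetherian (A\<lparr>carrier := G\<rparr>)"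
  shows "HC_modules K A L = HC_modules K A G"
proof -
  have "is_direct_sum M (cfs K (A\<lparr>carrier := L\<rparr>)) (primary_part (A\<lparr>carrier := L\<rparr>) M) \<longleftrightarrow>
    is_direct_sum M (cfs K (A\<lparr>carrier := G\<rparr>)) (primary_part (A\<lparr>carrier := G\<rparr>) M)"
    if M: "left_module A M" for M :: "('a, 'd) module"
  proof -
    interpret L: alg_module K "A\<lparr>carrier := L\<rparr>" M by (rule subalgebra_alg_module[OF L M])
    interpret G: alg_module K "A\<lparr>carrier := G\<rparr>" M by (rule subalgebra_alg_module[OF G M])
    have "L.locfin x \<longleftrightarrow> G.locfin x" if "x \<in> carrier M" for x
      using locfin_restrict[OF G L GL M] locfin_extend[OF G L GL fg M that] by blast
    then have "(\<forall>x\<in>carrier M. L.locfin x) \<longleftrightarrow> (\<forall>x\<in>carrier M. G.locfin x)" by (rule ball_cong[OF refl])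
    then show ?thesis
      using L.direct_sum_primary_iff[OF qc(1)] G.direct_sum_primary_iff[OF qc(2)] noeth
      unfolding noetherian_def by blast
  qed
  then show ?thesis unfolding HC_modules_def by blast
qed

lemma finsum_const_card:
  assumes "finite X'" and x: "x \<in> carrier A"
  shows "finsum A (\<lambda>s. x) X' = ([card X'] \<cdot>\<^bsub>K\<^esub> \<one>\<^bsub>K\<^esub>) \<odot>\<^bsub>A\<^esub> x"
  using assms(1)
proof (induction X')
  interpret K: field K by (rule fieldK)
  interpret KA: module K A by (rule moduleK)
  case empty
  then show ?case using x by (simp add: add_pow_def)
next
  interpret K: field K by (rule fieldK)
  interpret KA: module K A by (rule moduleK)
  case (insert s X')
  have n: "[card X'] \<cdot>\<^bsub>K\<^esub> \<one>\<^bsub>K\<^esub> \<in> carrier K" by (rule K.add.nat_pow_closed) simp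
  have "[Suc (card X')] \<cdot>\<^bsub>K\<^esub> \<one>\<^bsub>K\<^esub> = [card X'] \<cdot>\<^bsub>K\<^esub> \<one>\<^bsub>K\<^esub> \<oplus>\<^bsub>K\<^esub> \<one>\<^bsub>K\<^esub>" by (simp add: add_pow_def)
  then show ?case using insert x n by (simp add: KA.smult_l_distr a_comm)
qed

section \<open>Finite groups of algebra automorphisms\<close>

context
  fixes W
  assumes finW: "finite W" and W: "subgroup W (algebra_AutoGroup K A)"
    and card: "[card W] \<cdot>\<^bsub>K\<^esub> \<one>\<^bsub>K\<^esub> \<in> Units K"
begin

lemma W_auts:
  assumes "s \<in> W"
  shows "s \<in> extensional (carrier A)" "bij_betw s (carrier A) (carrier A)"
    "x \<in> carrier A \<Longrightarrow> s x \<in> carrier A"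
    "x \<in> carrier A \<Longrightarrow> y \<in> carrier A \<Longrightarrow> s (x \<oplus> y) = s x \<oplus> s y"
    "x \<in> carrier A \<Longrightarrow> y \<in> carrier A \<Longrightarrow> s (x \<otimes> y) = s x \<otimes> s y" "s \<one> = \<one>"
    "k \<in> carrier K \<Longrightarrow> x \<in> carrier A \<Longrightarrow> s (k \<odot>\<^bsub>A\<^esub> x) = k \<odot>\<^bsub>A\<^esub> s x"
proof -
  have "s \<in> algebra_auto K A"
    using subgroup.subset[OF W] assms by (auto simp: algebra_AutoGroup_def)
  then have s: "s \<in> Bij (carrier A)" "s \<in> ring_iso A A"
    "\<forall>c\<in>carrier K. \<forall>x\<in>carrier A. s (c \<odot>\<^bsub>A\<^esub> x) = c \<odot>\<^bsub>A\<^esub> s x" unfolding algebra_auto_def by auto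
  show "s \<in> extensional (carrier A)" "bij_betw s (carrier A) (carrier A)" using s(1) unfolding Bij_def by auto
  show "x \<in> carrier A \<Longrightarrow> s x \<in> carrier A"
    "x \<in> carrier A \<Longrightarrow> y \<in> carrier A \<Longrightarrow> s (x \<oplus> y) = s x \<oplus> s y"
    "x \<in> carrier A \<Longrightarrow> y \<in> carrier A \<Longrightarrow> s (x \<otimes> y) = s x \<otimes> s y" "s \<one> = \<one>"
    using s(2) unfolding ring_iso_def ring_hom_def by auto
  show "k \<in> carrier K \<Longrightarrow> x \<in> carrier A \<Longrightarrow> s (k \<odot>\<^bsub>A\<^esub> x) = k \<odot>\<^bsub>A\<^esub> s x" using s(3) by blast
qed

text \<open>Left translation by \<open>s\<close> is injective on \<open>W\<close>, hence bijective
  by finiteness, and a preimage of the identity is a right inverse of \<open>s\<close>.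
  \<open>compose\<close> cuts functions off at the carrier, as \<open>BijGroup\<close> does.\<close>

lemma W_shift:
  assumes s: "s \<in> W"
  shows "bij_betw (compose (carrier A) s) W W" "\<exists>t\<in>W. \<forall>x\<in>carrier A. s (t x) = x"
proof -
  let ?L = "carrier A"
  have Bij: "t \<in> Bij ?L" if "t \<in> W" for t using W_auts(1,2)[OF that] unfolding Bij_def by blast
  have cl: "compose ?L s t \<in> W" if t: "t \<in> W" for t
    using subgroup.m_closed[OF W s t] Bij[OF s] Bij[OF t] by (simp add: algebra_AutoGroup_def BijGroup_def)
  have inj: "inj_on (compose ?L s) W"
  proof (rule inj_onI)
    fix t t' assume t: "t \<in> W" "t' \<in> W" "compose ?L s t = compose ?L s t'"
    have "t x = t' x" if x: "x \<in> ?L" for x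
    proof -
      have "s (t x) = s (t' x)" using fun_cong[OF t(3), of x] x by (simp add: compose_def)
      then show ?thesis
        using W_auts(2)[OF s] W_auts(3)[OF t(1) x] W_auts(3)[OF t(2) x] unfolding bij_betw_def inj_on_def by blast
    qed
    then show "t = t'" using W_auts(1)[OF t(1)] W_auts(1)[OF t(2)] by (intro extensionalityI)
  qed
  have surj: "compose ?L s ` W = W" using finW cl inj by (intro endo_inj_surj) auto
  show "bij_betw (compose ?L s) W W" using inj surj unfolding bij_betw_def by blast
  have "(\<lambda>x\<in>?L. x) \<in> W" using subgroup.one_closed[OF W] by (simp add: algebra_AutoGroup_def BijGroup_def)
  then obtain t where "t \<in> W" "compose ?L s t = (\<lambda>x\<in>?L. x)" using surj by (metis imageE)
  then show "\<exists>t\<in>W. \<forall>x\<in>?L. s (t x) = x" by (metis compose_eq restrict_apply')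
qed

text \<open>The constant is the inverse of the group order, moved into the algebra. As a scalar it
  is central, and it is fixed because the automorphisms are linear over the field.\<close>

lemma algebra_auts_finite_auts:
  "finite_auts A W (inv\<^bsub>K\<^esub> ([card W] \<cdot>\<^bsub>K\<^esub> \<one>\<^bsub>K\<^esub>) \<odot>\<^bsub>A\<^esub> \<one>)" (is "finite_auts A W (?c \<odot>\<^bsub>A\<^esub> \<one>)")
proof -
  interpret K: field K by (rule fieldK)
  interpret KA: module K A by (rule moduleK)
  have c: "?c \<in> carrier K" "?c \<otimes>\<^bsub>K\<^esub> ([card W] \<cdot>\<^bsub>K\<^esub> \<one>\<^bsub>K\<^esub>) = \<one>\<^bsub>K\<^esub>"
    using K.Units_inv_closed[OF card] K.Units_l_inv[OF card] by auto
  show ?thesis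
  proof (intro finite_auts.intro ring_axioms finite_auts_axioms.intro)
    show "\<exists>b. bij_betw b W W \<and> (\<forall>t\<in>W. \<forall>x\<in>carrier A. b t x = s (t x))" if "s \<in> W" for s
      using W_shift(1)[OF that] by (intro exI[of _ "compose (carrier A) s"]) (simp add: compose_eq)
    show "(?c \<odot>\<^bsub>A\<^esub> \<one>) \<otimes> finsum A (\<lambda>s. x) W = x" if x: "x \<in> carrier A" for x
    proof -
      have n: "[card W] \<cdot>\<^bsub>K\<^esub> \<one>\<^bsub>K\<^esub> \<in> carrier K" using card by (rule K.Units_closed)
      have "(?c \<odot>\<^bsub>A\<^esub> \<one>) \<otimes> finsum A (\<lambda>s. x) W = ?c \<odot>\<^bsub>A\<^esub> (([card W] \<cdot>\<^bsub>K\<^esub> \<one>\<^bsub>K\<^esub>) \<odot>\<^bsub>A\<^esub> x)"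
        unfolding finsum_const_card[OF finW x] using c(1) n x by (intro scal_mult(1)) auto
      also have "\<dots> = x" using c n x by (simp add: KA.smult_assoc1[symmetric])
      finally show ?thesis .
    qed
    show "s (?c \<odot>\<^bsub>A\<^esub> \<one>) = ?c \<odot>\<^bsub>A\<^esub> \<one>" if "s \<in> W" for s
      using W_auts(6,7)[OF that] c(1) by simp
    show "(?c \<odot>\<^bsub>A\<^esub> \<one>) \<otimes> x = x \<otimes> (?c \<odot>\<^bsub>A\<^esub> \<one>)" if "x \<in> carrier A" for x
      using scal_mult[OF c(1) that] by simp
  qed (use finW W_auts W_shift c in auto)
qed

lemma fixed_ring_subalgebra: "is_subalgebra K A (fixed_ring (carrier A) W)"
  unfolding is_subalgebra_def
proof (intro conjI ballI)
  show "subring (fixed_ring (carrier A) W) A"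
    by (rule finite_auts.fixed_subring[OF algebra_auts_finite_auts])
  show "k \<odot>\<^bsub>A\<^esub> x \<in> fixed_ring (carrier A) W" if "k \<in> carrier K" "x \<in> fixed_ring (carrier A) W" for k x
  proof -
    have x: "x \<in> carrier A" "\<And>s. s \<in> W \<Longrightarrow> s x = x" using that(2) unfolding fixed_ring_def by auto
    have "s (k \<odot>\<^bsub>A\<^esub> x) = k \<odot>\<^bsub>A\<^esub> x" if s: "s \<in> W" for s
      using W_auts(7)[OF s \<open>k \<in> carrier K\<close> x(1)] x(2)[OF s] by simp
    then show ?thesis unfolding fixed_ring_def using K_smult_closed[OF that(1) x(1)] by blast
  qed
qed

end

end

section \<open>The fixed ring inside the ambient algebra, and the theorem\<close>

lemma fixed_ring_noetherian_fin_gen: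
  assumes U: "assoc_algebra K U" and L: "is_subalgebra K U L" and noeth: "noetherian (U\<lparr>carrier := L\<rparr>)"
    and W: "finite W" "subgroup W (algebra_AutoGroup K (U\<lparr>carrier := L\<rparr>))"
      "[card W] \<cdot>\<^bsub>K\<^esub> \<one>\<^bsub>K\<^esub> \<in> Units K"
  shows "is_subalgebra K U (fixed_ring L W)" "fixed_ring L W \<subseteq> L"
    "noetherian (U\<lparr>carrier := fixed_ring L W\<rparr>)"
    "fin_gen_left U (fixed_ring L W) L" "fin_gen_right U (fixed_ring L W) L"
proof -
  interpret U: assoc_alg K U by (rule assoc_alg.intro[OF U])
  interpret L: assoc_alg K "U\<lparr>carrier := L\<rparr>"
    by (rule assoc_alg.intro[OF U.subalgebra_assoc_algebra[OF L]])
  let ?G = "fixed_ring L W"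
  let ?c = "inv\<^bsub>K\<^esub> ([card W] \<cdot>\<^bsub>K\<^esub> \<one>\<^bsub>K\<^esub>) \<odot>\<^bsub>U\<^esub> \<one>\<^bsub>U\<^esub>"
  interpret fin: finite_auts "U\<lparr>carrier := L\<rparr>" W ?c
    using L.algebra_auts_finite_auts[OF W] by simp
  interpret opp: finite_auts "opp_ring (U\<lparr>carrier := L\<rparr>)" W ?c by (rule fin.finite_auts_opp)
  show sub: "?G \<subseteq> L" unfolding fixed_ring_def by blast
  have "is_subalgebra K (U\<lparr>carrier := L\<rparr>) ?G" using L.fixed_ring_subalgebra[OF W] by simp
  then have G: "subring ?G (U\<lparr>carrier := L\<rparr>)" "\<forall>c\<in>carrier K. \<forall>x\<in>?G. c \<odot>\<^bsub>U\<^esub> x \<in> ?G"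
    unfolding is_subalgebra_def by auto
  have "subring ?G U"
    using U.subring_iff[of ?G] L.subring_iff[of ?G] G(1) sub subringE(1)[OF U.subalgebra_subring[OF L]] by auto
  then show "is_subalgebra K U ?G" using G(2) unfolding is_subalgebra_def by blast
  show "noetherian (U\<lparr>carrier := ?G\<rparr>)"
    using fin.fixed_left_noetherian opp.fixed_left_noetherian noeth
    unfolding noetherian_def opp_ring_restrict by simp
  show "fin_gen_left U ?G L"
    using fin.fixed_fin_gen noeth unfolding noetherian_def fin_gen_left_def left_regular_restrict by simp
  show "fin_gen_right U ?G L"
    using opp.fixed_fin_gen noeth
    unfolding noetherian_def fin_gen_right_def opp_ring_restrict left_regular_restrict by simp
qed

theorem theorem3p18:
  fixes K :: "('k, 'c) ring_scheme" and U :: "('k, 'a) module"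
  assumes "assoc_algebra K U"
  shows
    "(\<forall>L G. is_subalgebra K U L \<and> is_subalgebra K U G \<and> G \<subseteq> L \<and>
        quasicommutative K (U\<lparr>carrier := L\<rparr>) \<and> noetherian (U\<lparr>carrier := L\<rparr>) \<and>
        quasicommutative K (U\<lparr>carrier := G\<rparr>) \<and> noetherian (U\<lparr>carrier := G\<rparr>) \<and>
        fin_gen_left U G L \<and> fin_gen_right U G L \<longrightarrow>
        (HC_subalgebra K U L \<longleftrightarrow> HC_subalgebra K U G) \<and>
        (HC_subalgebra K U L \<longrightarrow>
           (HC_modules K U L :: ('a, 'm) module set) = HC_modules K U G)) \<and>
     (\<forall>L W. HC_subalgebra K U L \<and> noetherian (U\<lparr>carrier := L\<rparr>) \<and>
        finite W \<and> subgroup W (algebra_AutoGroup K (U\<lparr>carrier := L\<rparr>)) \<and>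
        [card W] \<cdot>\<^bsub>K\<^esub> \<one>\<^bsub>K\<^esub> \<in> Units K \<and>
        quasicommutative K (U\<lparr>carrier := fixed_ring L W\<rparr>) \<longrightarrow>
        HC_subalgebra K U (fixed_ring L W) \<and>
        (HC_modules K U L :: ('a, 'm) module set) = HC_modules K U (fixed_ring L W))"
proof -
  interpret U: assoc_alg K U by (rule assoc_alg.intro[OF assms])
  have main: "(HC_subalgebra K U L \<longleftrightarrow> HC_subalgebra K U G) \<and>
      (HC_modules K U L :: ('a, 'm) module set) = HC_modules K U G"
    if L: "is_subalgebra K U L" and G: "is_subalgebra K U G" and GL: "G \<subseteq> L"
      and qc: "quasicommutative K (U\<lparr>carrier := L\<rparr>)" "quasicommutative K (U\<lparr>carrier := G\<rparr>)"
      and noeth: "noetherian (U\<lparr>carrier := L\<rparr>)" "noetherian (U\<lparr>carrier := G\<rparr>)"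
      and fg: "fin_gen_left U G L" "fin_gen_right U G L" for L G
  proof
    have "quasicentral U L \<longleftrightarrow> quasicentral U G"
      by (rule quasicentral_iff[OF U.ring_axioms U.subalgebra_subring[OF G] U.subalgebra_subring[OF L] GL noeth(2) fg])
    then show "HC_subalgebra K U L \<longleftrightarrow> HC_subalgebra K U G"
      using L G qc unfolding HC_subalgebra_def by blast
    show "(HC_modules K U L :: ('a, 'm) module set) = HC_modules K U G"
      by (rule U.HC_modules_eq[OF G L GL fg(2) qc noeth])
  qed
  show ?thesis
  proof (intro conjI allI impI; elim conjE)
    fix L W assume H: "HC_subalgebra K U L" and noeth: "noetherian (U\<lparr>carrier := L\<rparr>)"
      and W: "finite W" "subgroup W (algebra_AutoGroup K (U\<lparr>carrier := L\<rparr>))"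
        "[card W] \<cdot>\<^bsub>K\<^esub> \<one>\<^bsub>K\<^esub> \<in> Units K"
      and qc: "quasicommutative K (U\<lparr>carrier := fixed_ring L W\<rparr>)"
    have L: "is_subalgebra K U L" "quasicommutative K (U\<lparr>carrier := L\<rparr>)"
      using H unfolding HC_subalgebra_def by auto
    \<comment> \<open>Averaging supplies the hypotheses of the first part for the fixed ring, apart
      from its quasicommutativity, which is assumed as \<open>qc\<close>.\<close>
    note F = fixed_ring_noetherian_fin_gen[OF assms L(1) noeth W]
    note * = main[OF L(1) F(1,2) L(2) qc noeth F(3-5)]
    show "HC_subalgebra K U (fixed_ring L W)" using * H by blast
    show "(HC_modules K U L :: ('a, 'm) module set) = HC_modules K U (fixed_ring L W)" using * by blast
  qed (use main in blast)+
qed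

end
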